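(* An ${\mathcal L}({\mathcal U},{\mathcal Y})$-valued function $S$ defined on ${\mathbb B}^d$ is an inner multiplier if and only if it admits a weakly coisometric realization $S(\lambda)=D+C(I-Z(\lambda)A)^{-1}Z(\lambda)B$ such that (1) the state tuple ${\mathbf A}=(A_1,\dots,A_d)$ is commutative and strongly stable, and (2) the output pair $(C,{\mathbf A})$ is isometric, i.e., $\sum_{j=1}^dA_j^*A_j+C^*C=I_{\mathcal X}$.
   Context: Let ${\mathbb B}^d=\{\lambda\in{\mathbb C}^d:\langle\lambda,\lambda\rangle<1\}$. ${\mathcal H}_{\mathcal Y}(k_d)$ is the reproducing kernel Hilbert space of ${\mathcal Y}$-valued functions on ${\mathbb B}^d$ with kernel $k_d(\lambda,\zeta)I_{\mathcal Y}$, $k_d(\lambda,\zeta)=1/(1-\langle\lambda,\zeta\rangle)$. ${\mathcal S}_d({\mathcal U},{\mathcal Y})$ is the set of ${\mathcal L}({\mathcal U},{\mathcal Y})$-valued holomorphic $S$ on ${\mathbb B}^d$ such that $M_S:f\mapsto Sf$ is a contraction from ${\mathcal H}_{\mathcal U}(k_d)$ into ${\mathcal H}_{\mathcal Y}(k_d)$; $S$ is an inner multiplier if it is in ${\mathcal S}_d({\mathcal U},{\mathcal Y})$ and $M_S$ is a partial isometry. A realization: Hilbert space ${\mathcal X}$, $A_j\in{\mathcal L}({\mathcal X})$, $B_j\in{\mathcal L}({\mathcal U},{\mathcal X})$, $C\in{\mathcal L}({\mathcal X},{\mathcal Y})$, $D\in{\mathcal L}({\mathcal U},{\mathcal Y})$,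 $A=\mathrm{col}(A_j)$, $B=\mathrm{col}(B_j)$, $Z(\lambda)=[\lambda_1I_{\mathcal X}\ \cdots\ \lambda_dI_{\mathcal X}]$, connecting operator ${\mathbf U}=\begin{bmatrix}A&B\\C&D\end{bmatrix}:{\mathcal X}\oplus{\mathcal U}\to{\mathcal X}^d\oplus{\mathcal Y}$. Weakly coisometric: ${\mathbf U}$ is a contraction and ${\mathbf U}^*$ is isometric on ${\mathcal D}\oplus{\mathcal Y}$, ${\mathcal D}=\overline{\mathrm{span}}\{Z(\zeta)^*(I-A^*Z(\zeta)^* )^{-1}C^*y:\zeta\in{\mathbb B}^d,y\in{\mathcal Y}\}$. Commutative: $A_iA_j=A_jA_i$. For commuting ${\mathbf A}$ and $n\in{\mathbb Z}_+^d$, ${\mathbf A}^n=A_1^{n_1}\cdots A_d^{n_d}$; ${\mathbf A}$ is strongly stable if $\lim_{N\to\infty}\sum_{n\in{\mathbb Z}_+^d,|n|=N}\frac{N!}{n!}\|{\mathbf A}^nx\|^2=0$ for all $x\in{\mathcal X}$ ($n!=n_1!\cdots n_d!$, $|n|=\sum n_j$). *)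

theory Defs
  imports "HOL-Analysis.Analysis" "HOL-Library.Function_Algebras"
begin

class cvector = ab_group_add +
  fixes scaleC :: "complex \<Rightarrow> 'a \<Rightarrow> 'a" (infixr "*\<^sub>C" 75)
  assumes scaleC_add_right: "a *\<^sub>C (x + y) = a *\<^sub>C x + a *\<^sub>C y"
    and scaleC_add_left: "(a + b) *\<^sub>C x = a *\<^sub>C x + b *\<^sub>C x"
    and scaleC_scaleC: "a *\<^sub>C (b *\<^sub>C x) = (a * b) *\<^sub>C x"
    and scaleC_one: "1 *\<^sub>C x = x"

instantiation "fun" :: (type, cvector) cvector
begin
definition scaleC_fun :: "complex \<Rightarrow> ('a \<Rightarrow> 'b) \<Rightarrow> 'a \<Rightarrow> 'b" where
  "scaleC_fun c f = (\<lambda>x. c *\<^sub>C f x)"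
instance
  by standard (auto simp: scaleC_fun_def fun_eq_iff scaleC_add_right scaleC_add_left scaleC_scaleC scaleC_one)
end

definition hnorm :: "('a \<Rightarrow> 'a \<Rightarrow> complex) \<Rightarrow> 'a \<Rightarrow> real" where
  "hnorm ip x = sqrt (Re (ip x x))"

definition hilbert_space :: "'a::cvector set \<Rightarrow> ('a \<Rightarrow> 'a \<Rightarrow> complex) \<Rightarrow> bool" where
  "hilbert_space V ip \<longleftrightarrow>
     0 \<in> V \<and> (\<forall>x\<in>V. \<forall>y\<in>V. x + y \<in> V) \<and> (\<forall>c. \<forall>x\<in>V. c *\<^sub>C x \<in> V) \<and>
     (\<forall>x\<in>V. \<forall>y\<in>V. \<forall>z\<in>V. ip (x + y) z = ip x z + ip y z) \<and>
     (\<forall>c. \<forall>x\<in>V. \<forall>y\<in>V. ip (c *\<^sub>C x) y = c * ip x y) \<and>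
     (\<forall>x\<in>V. \<forall>y\<in>V. ip y x = cnj (ip x y)) \<and>
     (\<forall>x\<in>V. x \<noteq> 0 \<longrightarrow> 0 < Re (ip x x)) \<and>
     (\<forall>s. (\<forall>n. s n \<in> V) \<and> (\<forall>e>0. \<exists>N. \<forall>m\<ge>N. \<forall>n\<ge>N. hnorm ip (s m - s n) < e) \<longrightarrow>
          (\<exists>l\<in>V. (\<lambda>n. hnorm ip (s n - l)) \<longlonglongrightarrow> 0))"

definition bounded_op :: "'a::cvector set \<Rightarrow> ('a \<Rightarrow> 'a \<Rightarrow> complex) \<Rightarrow>
    'b::cvector set \<Rightarrow> ('b \<Rightarrow> 'b \<Rightarrow> complex) \<Rightarrow> ('a \<Rightarrow> 'b) \<Rightarrow> bool" where
  "bounded_op V ipV W ipW T \<longleftrightarrow>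
     (\<forall>x\<in>V. T x \<in> W) \<and> (\<forall>x\<in>V. \<forall>y\<in>V. T (x + y) = T x + T y) \<and>
     (\<forall>c. \<forall>x\<in>V. T (c *\<^sub>C x) = c *\<^sub>C T x) \<and>
     (\<exists>K. \<forall>x\<in>V. hnorm ipW (T x) \<le> K * hnorm ipV x)"

definition hadj :: "'a::cvector set \<Rightarrow> ('a \<Rightarrow> 'a \<Rightarrow> complex) \<Rightarrow>
    'b::cvector set \<Rightarrow> ('b \<Rightarrow> 'b \<Rightarrow> complex) \<Rightarrow> ('a \<Rightarrow> 'b) \<Rightarrow> ('b \<Rightarrow> 'a)" where
  "hadj V ipV W ipW T = (SOME T'. (\<forall>y\<in>W. T' y \<in> V) \<and>
       (\<forall>x\<in>V. \<forall>y\<in>W. ipW (T x) y = ipV x (T' y)))"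

definition inv_I_minus :: "'a::cvector set \<Rightarrow> ('a \<Rightarrow> 'a) \<Rightarrow> ('a \<Rightarrow> 'a)" where
  "inv_I_minus V T = (SOME R. \<forall>x\<in>V. R x \<in> V \<and> R x - T (R x) = x \<and> R (x - T x) = x)"

definition cinner_d :: "complex^'d \<Rightarrow> complex^'d \<Rightarrow> complex" where
  "cinner_d l z = (\<Sum>j\<in>UNIV. l$j * cnj (z$j))"

definition ball_d :: "(complex^'d) set" where
  "ball_d = {l. Re (cinner_d l l) < 1}"

definition kd :: "complex^'d \<Rightarrow> complex^'d \<Rightarrow> complex" where
  "kd l z = 1 / (1 - cinner_d l z)"

text \<open>For a Y-valued function f on the ball, the pairing of f with the kernel element
  g = \<Sum>i k_d(\<cdot>,\<zeta>_i) y_i is \<Sum>i <f(\<zeta>_i), y_i>, and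
  ||g||^2 = \<Sum>i,j k_d(\<zeta>_j,\<zeta>_i) <y_i,y_j>.  f belongs to H_Y(k_d) iff this functional is
  bounded on the (dense) span of the kernel functions, and ||f||^2 is the least bound
  (Aronszajn's construction of the RKHS).\<close>

definition rk_bound :: "'y::cvector set \<Rightarrow> ('y \<Rightarrow> 'y \<Rightarrow> complex) \<Rightarrow>
    (complex^'d \<Rightarrow> 'y) \<Rightarrow> real \<Rightarrow> bool" where
  "rk_bound Y ipY f M \<longleftrightarrow>
     (\<forall>(n::nat) (\<zeta>::nat \<Rightarrow> complex^'d) (y::nat \<Rightarrow> 'y).
        (\<forall>i<n. \<zeta> i \<in> ball_d \<and> y i \<in> Y) \<longrightarrow>
        (cmod (\<Sum>i<n. ipY (f (\<zeta> i)) (y i)))\<^sup>2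
          \<le> M * Re (\<Sum>i<n. \<Sum>j<n. kd (\<zeta> j) (\<zeta> i) * ipY (y i) (y j)))"

definition in_Hkd :: "'y::cvector set \<Rightarrow> ('y \<Rightarrow> 'y \<Rightarrow> complex) \<Rightarrow>
    (complex^'d \<Rightarrow> 'y) \<Rightarrow> bool" where
  "in_Hkd Y ipY f \<longleftrightarrow> (\<forall>l\<in>ball_d. f l \<in> Y) \<and> (\<exists>M. rk_bound Y ipY f M)"

definition Hkd_norm :: "'y::cvector set \<Rightarrow> ('y \<Rightarrow> 'y \<Rightarrow> complex) \<Rightarrow>
    (complex^'d \<Rightarrow> 'y) \<Rightarrow> real" where
  "Hkd_norm Y ipY f = sqrt (Inf {M. 0 \<le> M \<and> rk_bound Y ipY f M})"

text \<open>Inner product of H_Y(k_d) via the polarization identity.\<close>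

definition Hkd_inner :: "'y::cvector set \<Rightarrow> ('y \<Rightarrow> 'y \<Rightarrow> complex) \<Rightarrow>
    (complex^'d \<Rightarrow> 'y) \<Rightarrow> (complex^'d \<Rightarrow> 'y) \<Rightarrow> complex" where
  "Hkd_inner Y ipY f g = (1/4) * (\<Sum>k<(4::nat).
      \<i>^k * complex_of_real ((Hkd_norm Y ipY (\<lambda>z. f z + (\<i>^k) *\<^sub>C g z))\<^sup>2))"

definition holomorphic_d :: "(complex^'d \<Rightarrow> complex) \<Rightarrow> (complex^'d) set \<Rightarrow> bool" where
  "holomorphic_d f A \<longleftrightarrow> (\<forall>l\<in>A. \<exists>L. (f has_derivative L) (at l) \<and>
       (\<forall>c v. L (\<chi> j. c * v$j) = c * L v))"

definition op_holomorphic :: "'u::cvector set \<Rightarrow> ('u \<Rightarrow> 'u \<Rightarrow> complex) \<Rightarrow>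
    'y::cvector set \<Rightarrow> ('y \<Rightarrow> 'y \<Rightarrow> complex) \<Rightarrow> (complex^'d \<Rightarrow> 'u \<Rightarrow> 'y) \<Rightarrow> bool" where
  "op_holomorphic U ipU Y ipY S \<longleftrightarrow>
     (\<forall>l\<in>ball_d. bounded_op U ipU Y ipY (S l)) \<and>
     (\<forall>u\<in>U. \<forall>y\<in>Y. holomorphic_d (\<lambda>l. ipY (S l u) y) ball_d)"

definition mult_op :: "(complex^'d \<Rightarrow> 'u \<Rightarrow> 'y) \<Rightarrow> (complex^'d \<Rightarrow> 'u) \<Rightarrow> (complex^'d \<Rightarrow> 'y)" where
  "mult_op S f = (\<lambda>l. S l (f l))"

definition schur_class :: "'u::cvector set \<Rightarrow> ('u \<Rightarrow> 'u \<Rightarrow> complex) \<Rightarrow>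
    'y::cvector set \<Rightarrow> ('y \<Rightarrow> 'y \<Rightarrow> complex) \<Rightarrow> (complex^'d \<Rightarrow> 'u \<Rightarrow> 'y) \<Rightarrow> bool" where
  "schur_class U ipU Y ipY S \<longleftrightarrow>
     op_holomorphic U ipU Y ipY S \<and>
     (\<forall>f. in_Hkd U ipU f \<longrightarrow>
        in_Hkd Y ipY (mult_op S f) \<and> Hkd_norm Y ipY (mult_op S f) \<le> Hkd_norm U ipU f)"

text \<open>Inner multiplier: additionally M_S is a partial isometry, i.e. isometric on the
  orthogonal complement of its kernel.\<close>

definition inner_multiplier :: "'u::cvector set \<Rightarrow> ('u \<Rightarrow> 'u \<Rightarrow> complex) \<Rightarrow>
    'y::cvector set \<Rightarrow> ('y \<Rightarrow> 'y \<Rightarrow> complex) \<Rightarrow> (complex^'d \<Rightarrow> 'u \<Rightarrow> 'y) \<Rightarrow> bool" where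
  "inner_multiplier U ipU Y ipY S \<longleftrightarrow>
     schur_class U ipU Y ipY S \<and>
     (\<forall>f. in_Hkd U ipU f \<and>
          (\<forall>g. in_Hkd U ipU g \<and> (\<forall>l\<in>ball_d. S l (g l) = 0) \<longrightarrow> Hkd_inner U ipU f g = 0)
        \<longrightarrow> Hkd_norm Y ipY (mult_op S f) = Hkd_norm U ipU f)"

definition hnorm_d :: "('x \<Rightarrow> 'x \<Rightarrow> complex) \<Rightarrow> ('d::finite \<Rightarrow> 'x) \<Rightarrow> real" where
  "hnorm_d ip w = sqrt (\<Sum>j\<in>UNIV. (hnorm ip (w j))\<^sup>2)"

text \<open>The subspace D = closed span { Z(\<zeta>)^* (I - A^* Z(\<zeta>)^* )^{-1} C^* y } of X^d.\<close>

definition D_gen :: "'x::cvector set \<Rightarrow> ('x \<Rightarrow> 'x \<Rightarrow> complex) \<Rightarrow>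
    'y::cvector set \<Rightarrow> ('y \<Rightarrow> 'y \<Rightarrow> complex) \<Rightarrow>
    ('d::finite \<Rightarrow> 'x \<Rightarrow> 'x) \<Rightarrow> ('x \<Rightarrow> 'y) \<Rightarrow> complex^'d \<Rightarrow> 'y \<Rightarrow> ('d \<Rightarrow> 'x)" where
  "D_gen X ipX Y ipY A C z y =
     (let Cs = hadj X ipX Y ipY C;
          AsZs = (\<lambda>x. \<Sum>j\<in>UNIV. cnj (z$j) *\<^sub>C hadj X ipX X ipX (A j) x)
      in (\<lambda>j. cnj (z$j) *\<^sub>C inv_I_minus X AsZs (Cs y)))"

definition D_space :: "'x::cvector set \<Rightarrow> ('x \<Rightarrow> 'x \<Rightarrow> complex) \<Rightarrow>
    'y::cvector set \<Rightarrow> ('y \<Rightarrow> 'y \<Rightarrow> complex) \<Rightarrow>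
    ('d::finite \<Rightarrow> 'x \<Rightarrow> 'x) \<Rightarrow> ('x \<Rightarrow> 'y) \<Rightarrow> ('d \<Rightarrow> 'x) set" where
  "D_space X ipX Y ipY A C =
     {w. (\<forall>j. w j \<in> X) \<and>
         (\<forall>e>0. \<exists>(n::nat) (c::nat \<Rightarrow> complex) (\<zeta>::nat \<Rightarrow> complex^'d) (y::nat \<Rightarrow> 'y).
            (\<forall>i<n. \<zeta> i \<in> ball_d \<and> y i \<in> Y) \<and>
            hnorm_d ipX (w - (\<Sum>i<n. c i *\<^sub>C D_gen X ipX Y ipY A C (\<zeta> i) (y i))) < e)}"

text \<open>The connecting operator U = [A B; C D] : X \<oplus> U \<rightarrow> X^d \<oplus> Y is a contraction, and
  U^* (w, y) = (\<Sum>j A_j^* w_j + C^* y, \<Sum>j B_j^* w_j + D^* y) is isometric on D \<oplus> Y.\<close>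

definition weakly_coisometric :: "'x::cvector set \<Rightarrow> ('x \<Rightarrow> 'x \<Rightarrow> complex) \<Rightarrow>
    'u::cvector set \<Rightarrow> ('u \<Rightarrow> 'u \<Rightarrow> complex) \<Rightarrow>
    'y::cvector set \<Rightarrow> ('y \<Rightarrow> 'y \<Rightarrow> complex) \<Rightarrow>
    ('d::finite \<Rightarrow> 'x \<Rightarrow> 'x) \<Rightarrow> ('d \<Rightarrow> 'u \<Rightarrow> 'x) \<Rightarrow> ('x \<Rightarrow> 'y) \<Rightarrow> ('u \<Rightarrow> 'y) \<Rightarrow> bool" where
  "weakly_coisometric X ipX U ipU Y ipY A B C D \<longleftrightarrow>
     (\<forall>x\<in>X. \<forall>u\<in>U.
        (\<Sum>j\<in>UNIV. (hnorm ipX (A j x + B j u))\<^sup>2) + (hnorm ipY (C x + D u))\<^sup>2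
          \<le> (hnorm ipX x)\<^sup>2 + (hnorm ipU u)\<^sup>2) \<and>
     (\<forall>w\<in>D_space X ipX Y ipY A C. \<forall>y\<in>Y.
        (hnorm ipX ((\<Sum>j\<in>UNIV. hadj X ipX X ipX (A j) (w j)) + hadj X ipX Y ipY C y))\<^sup>2
        + (hnorm ipU ((\<Sum>j\<in>UNIV. hadj U ipU X ipX (B j) (w j)) + hadj U ipU Y ipY D y))\<^sup>2
        = (hnorm_d ipX w)\<^sup>2 + (hnorm ipY y)\<^sup>2)"

definition realizes :: "'x::cvector set \<Rightarrow> 'u set \<Rightarrow>
    ('d::finite \<Rightarrow> 'x \<Rightarrow> 'x) \<Rightarrow> ('d \<Rightarrow> 'u \<Rightarrow> 'x) \<Rightarrow> ('x \<Rightarrow> 'y::cvector) \<Rightarrow> ('u \<Rightarrow> 'y) \<Rightarrow>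
    (complex^'d \<Rightarrow> 'u \<Rightarrow> 'y) \<Rightarrow> bool" where
  "realizes X U A B C D S \<longleftrightarrow>
     (\<forall>l\<in>ball_d. \<forall>u\<in>U.
        S l u = D u + C (inv_I_minus X (\<lambda>x. \<Sum>j\<in>UNIV. (l$j) *\<^sub>C A j x)
                                         (\<Sum>j\<in>UNIV. (l$j) *\<^sub>C B j u)))"

definition mpow :: "('d::{finite,enum} \<Rightarrow> 'x \<Rightarrow> 'x) \<Rightarrow> ('d \<Rightarrow> nat) \<Rightarrow> 'x \<Rightarrow> 'x" where
  "mpow A n = foldr (\<lambda>j acc. (A j ^^ n j) \<circ> acc) enum_class.enum id"

definition commutative_tuple :: "'x set \<Rightarrow> ('d \<Rightarrow> 'x \<Rightarrow> 'x) \<Rightarrow> bool" where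
  "commutative_tuple X A \<longleftrightarrow> (\<forall>i j. \<forall>x\<in>X. A i (A j x) = A j (A i x))"

definition strongly_stable :: "'x set \<Rightarrow> ('x \<Rightarrow> 'x \<Rightarrow> complex) \<Rightarrow>
    ('d::{finite,enum} \<Rightarrow> 'x \<Rightarrow> 'x) \<Rightarrow> bool" where
  "strongly_stable X ipX A \<longleftrightarrow>
     (\<forall>x\<in>X. (\<lambda>N. \<Sum>n\<in>{n::'d \<Rightarrow> nat. (\<Sum>j\<in>UNIV. n j) = N}.
                real (fact N) / real (\<Prod>j\<in>UNIV. fact (n j)) * (hnorm ipX (mpow A n x))\<^sup>2)
             \<longlonglongrightarrow> 0)"

definition isometric_output_pair :: "'x::cvector set \<Rightarrow> ('x \<Rightarrow> 'x \<Rightarrow> complex) \<Rightarrow>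
    'y::cvector set \<Rightarrow> ('y \<Rightarrow> 'y \<Rightarrow> complex) \<Rightarrow> ('d::finite \<Rightarrow> 'x \<Rightarrow> 'x) \<Rightarrow> ('x \<Rightarrow> 'y) \<Rightarrow> bool" where
  "isometric_output_pair X ipX Y ipY A C \<longleftrightarrow>
     (\<forall>x\<in>X. (\<Sum>j\<in>UNIV. hadj X ipX X ipX (A j) (A j x)) + hadj X ipX Y ipY C (C x) = x)"

definition good_realization :: "'x::cvector set \<Rightarrow> ('x \<Rightarrow> 'x \<Rightarrow> complex) \<Rightarrow>
    'u::cvector set \<Rightarrow> ('u \<Rightarrow> 'u \<Rightarrow> complex) \<Rightarrow>
    'y::cvector set \<Rightarrow> ('y \<Rightarrow> 'y \<Rightarrow> complex) \<Rightarrow>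
    ('d::{finite,enum} \<Rightarrow> 'x \<Rightarrow> 'x) \<Rightarrow> ('d \<Rightarrow> 'u \<Rightarrow> 'x) \<Rightarrow> ('x \<Rightarrow> 'y) \<Rightarrow> ('u \<Rightarrow> 'y) \<Rightarrow>
    (complex^'d::_ \<Rightarrow> 'u \<Rightarrow> 'y) \<Rightarrow> bool" where
  "good_realization X ipX U ipU Y ipY A B C D S \<longleftrightarrow>
     hilbert_space X ipX \<and>
     (\<forall>j. bounded_op X ipX X ipX (A j)) \<and> (\<forall>j. bounded_op U ipU X ipX (B j)) \<and>
     bounded_op X ipX Y ipY C \<and> bounded_op U ipU Y ipY D \<and>
     weakly_coisometric X ipX U ipU Y ipY A B C D \<and>
     realizes X U A B C D S \<and>
     commutative_tuple X A \<and> strongly_stable X ipX A \<and>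
     isometric_output_pair X ipX Y ipY A C"

end

theory Submission
  imports Defs "HOL-Combinatorics.Multiset_Permutations"
begin

text \<open>
  \<open>H\<^sub>Y(k\<^sub>d)\<close> is realised as the space of \<open>\<ell>\<^sup>2\<close> families indexed by words over the \<open>d\<close> letters that
  are invariant under permuting letters: the family \<open>g\<close> stands for the function
  \<open>z \<mapsto> \<Sum>\<^sub>w z\<^sup>w g\<^sub>w\<close>, the kernel function at \<open>z\<close> is \<open>w \<mapsto> cnj (z\<^sup>w) y\<close>, and the backward shift
  \<open>g \<mapsto> g (j # _)\<close> is the adjoint of multiplication by \<open>\<lambda>\<^sub>j\<close>.

  If \<open>(C, A)\<close> is isometric and \<open>A\<close> is commutative and strongly stable, then
  \<open>obs x = (C A\<^sup>w x)\<^sub>w\<close> maps the state space isometrically into this space. Both directions of the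
  theorem go through the identity \<open>mult mult\<^sup>* + obs obs\<^sup>* = I\<close>, where \<open>mult\<close> is multiplication by
  \<open>S\<close>. It gives \<open>mult\<^sup>* obs = 0\<close>, so that \<open>mult\<close> is a partial isometry; conversely, if \<open>mult\<close> is a
  partial isometry, the identity holds for the state space \<open>ker mult\<^sup>*\<close> with the backward shifts and
  evaluation at the origin.

  Tested on kernel functions, with \<open>state_kernel z y = (I - A\<^sup>* Z(z)\<^sup>*)\<^sup>-\<^sup>1 C\<^sup>* y\<close>, the identity says
  that \<open>(Z(z)\<^sup>* (state_kernel z y), y) \<mapsto> (state_kernel z y, S(z)\<^sup>* y)\<close> preserves inner products. For a
  realization of \<open>S\<close> this map is the adjoint of the connecting operator restricted to \<open>D \<oplus> Y\<close>, so
  weak coisometry is the same statement. Conversely, the adjoint of the isometry so defined is a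
  connecting operator realizing \<open>S\<close>; its restriction to the state space is \<open>col(A, C)\<close> because the
  range of the latter lies in \<open>D \<oplus> Y\<close>.
\<close>

section \<open>Hilbert spaces on carrier sets\<close>

lemma scaleC_zero_left [simp]: "0 *\<^sub>C (x::'a::cvector) = 0"
  using scaleC_add_left[of 0 0 x] by simp

lemma scaleC_zero_right [simp]: "c *\<^sub>C (0::'a::cvector) = 0"
  using scaleC_add_right[of c 0 "0::'a"] by simp

lemma scaleC_minus_right: "c *\<^sub>C (- (x::'a::cvector)) = - (c *\<^sub>C x)"
  using scaleC_add_right[of c "-x" x] by (simp add: eq_neg_iff_add_eq_0)

lemma scaleC_minus_one: "(- 1) *\<^sub>C (x::'a::cvector) = - x"
  using scaleC_add_left[of "-1" 1 x] by (simp add: eq_neg_iff_add_eq_0 scaleC_one)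

lemma scaleC_diff_right: "c *\<^sub>C ((x::'a::cvector) - y) = c *\<^sub>C x - c *\<^sub>C y"
  using scaleC_add_right[of c x "-y"] by (simp add: scaleC_minus_right)

lemma scaleC_sum_right: "c *\<^sub>C (\<Sum>i\<in>I. f i) = (\<Sum>i\<in>I. c *\<^sub>C (f i :: 'a::cvector))"
  by (induction I rule: infinite_finite_induct) (auto simp: scaleC_add_right)

lemma scaleC_fun_apply [simp]: "(c *\<^sub>C f) i = c *\<^sub>C f i"
  by (simp add: scaleC_fun_def)

definition csubspace :: "'a::cvector set \<Rightarrow> bool" where
  "csubspace P \<longleftrightarrow> 0 \<in> P \<and> (\<forall>x\<in>P. \<forall>y\<in>P. x + y \<in> P) \<and> (\<forall>c. \<forall>x\<in>P. c *\<^sub>C x \<in> P)"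

lemma csubspace_0: "csubspace P \<Longrightarrow> 0 \<in> P"
  and csubspace_add: "csubspace P \<Longrightarrow> x \<in> P \<Longrightarrow> y \<in> P \<Longrightarrow> x + y \<in> P"
  and csubspace_scaleC: "csubspace P \<Longrightarrow> x \<in> P \<Longrightarrow> c *\<^sub>C x \<in> P"
  by (auto simp: csubspace_def)

lemma csubspace_uminus: "csubspace P \<Longrightarrow> x \<in> P \<Longrightarrow> - x \<in> P"
  using csubspace_scaleC[of P x "-1"] by (simp add: scaleC_minus_one)

lemma csubspace_diff: "csubspace P \<Longrightarrow> x \<in> P \<Longrightarrow> y \<in> P \<Longrightarrow> x - y \<in> P"
  using csubspace_add[of P x "-y"] by (simp add: csubspace_uminus)

lemma csubspace_sum: "csubspace P \<Longrightarrow> (\<And>i. i \<in> I \<Longrightarrow> f i \<in> P) \<Longrightarrow> sum f I \<in> P"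
  by (induction I rule: infinite_finite_induct) (auto simp: csubspace_0 csubspace_add)

definition strong_limit :: "('a::cvector \<Rightarrow> 'a \<Rightarrow> complex) \<Rightarrow> (nat \<Rightarrow> 'a) \<Rightarrow> 'a \<Rightarrow> bool" where
  "strong_limit ip s l \<longleftrightarrow> (\<lambda>n. hnorm ip (s n - l)) \<longlonglongrightarrow> 0"

definition cauchy_in :: "('a::cvector \<Rightarrow> 'a \<Rightarrow> complex) \<Rightarrow> (nat \<Rightarrow> 'a) \<Rightarrow> bool" where
  "cauchy_in ip s \<longleftrightarrow> (\<forall>e>0. \<exists>N. \<forall>m\<ge>N. \<forall>n\<ge>N. hnorm ip (s m - s n) < e)"

definition closure_in :: "'a::cvector set \<Rightarrow> ('a \<Rightarrow> 'a \<Rightarrow> complex) \<Rightarrow> 'a set \<Rightarrow> 'a set" where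
  "closure_in V ip P = {l \<in> V. \<exists>s. (\<forall>n. s n \<in> P) \<and> strong_limit ip s l}"

lemma closure_inI: "l \<in> V \<Longrightarrow> (\<And>n. s n \<in> P) \<Longrightarrow> strong_limit ip s l \<Longrightarrow> l \<in> closure_in V ip P"
  by (auto simp: closure_in_def)

lemma hilbert_space_iff:
  "hilbert_space V ip \<longleftrightarrow> csubspace V \<and>
     (\<forall>x\<in>V. \<forall>y\<in>V. \<forall>z\<in>V. ip (x + y) z = ip x z + ip y z) \<and>
     (\<forall>c. \<forall>x\<in>V. \<forall>y\<in>V. ip (c *\<^sub>C x) y = c * ip x y) \<and>
     (\<forall>x\<in>V. \<forall>y\<in>V. ip y x = cnj (ip x y)) \<and>
     (\<forall>x\<in>V. x \<noteq> 0 \<longrightarrow> 0 < Re (ip x x)) \<and>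
     (\<forall>s. (\<forall>n. s n \<in> V) \<and> cauchy_in ip s \<longrightarrow> (\<exists>l\<in>V. strong_limit ip s l))"
  unfolding hilbert_space_def csubspace_def cauchy_in_def strong_limit_def
  by (simp only: conj_assoc)

lemma hilbert_spaceI:
  assumes "csubspace V"
    and "\<And>x y z. x \<in> V \<Longrightarrow> y \<in> V \<Longrightarrow> z \<in> V \<Longrightarrow> ip (x + y) z = ip x z + ip y z"
    and "\<And>c x y. x \<in> V \<Longrightarrow> y \<in> V \<Longrightarrow> ip (c *\<^sub>C x) y = c * ip x y"
    and "\<And>x y. x \<in> V \<Longrightarrow> y \<in> V \<Longrightarrow> ip y x = cnj (ip x y)"
    and "\<And>x. x \<in> V \<Longrightarrow> x \<noteq> 0 \<Longrightarrow> 0 < Re (ip x x)"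
    and "\<And>s. (\<And>n. s n \<in> V) \<Longrightarrow> cauchy_in ip s \<Longrightarrow> \<exists>l\<in>V. strong_limit ip s l"
  shows "hilbert_space V ip"
  unfolding hilbert_space_iff by (intro conjI ballI allI impI assms) auto

locale hilbert =
  fixes V :: "'a::cvector set" and ip :: "'a \<Rightarrow> 'a \<Rightarrow> complex"
  assumes hilbert_space: "hilbert_space V ip"
begin

abbreviation nrm :: "'a \<Rightarrow> real" where "nrm \<equiv> hnorm ip"

lemma csubspace: "csubspace V"
  using hilbert_space by (simp add: hilbert_space_iff)

lemmas zero_mem [simp] = csubspace_0[OF csubspace]
  and add_mem [simp] = csubspace_add[OF csubspace]
  and scale_mem [simp] = csubspace_scaleC[OF csubspace]
  and uminus_mem [simp] = csubspace_uminus[OF csubspace]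
  and diff_mem [simp] = csubspace_diff[OF csubspace]
  and sum_mem = csubspace_sum[OF csubspace]

lemma ip_add_left: "x \<in> V \<Longrightarrow> y \<in> V \<Longrightarrow> z \<in> V \<Longrightarrow> ip (x + y) z = ip x z + ip y z"
  and ip_scale_left: "x \<in> V \<Longrightarrow> y \<in> V \<Longrightarrow> ip (c *\<^sub>C x) y = c * ip x y"
  and ip_sym: "x \<in> V \<Longrightarrow> y \<in> V \<Longrightarrow> ip y x = cnj (ip x y)"
  and ip_pos: "x \<in> V \<Longrightarrow> x \<noteq> 0 \<Longrightarrow> 0 < Re (ip x x)"
  using hilbert_space unfolding hilbert_space_iff by (elim conjE; blast)+

lemma complete:
  assumes "\<And>n. s n \<in> V" "cauchy_in ip s"
  obtains l where "l \<in> V" "strong_limit ip s l"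
proof -
  have "(\<forall>n. s n \<in> V) \<and> cauchy_in ip s \<longrightarrow> (\<exists>l\<in>V. strong_limit ip s l)"
    using hilbert_space unfolding hilbert_space_iff by (elim conjE) (erule spec)
  with assms that show thesis by (metis (no_types))
qed

lemma ip_add_right: "x \<in> V \<Longrightarrow> y \<in> V \<Longrightarrow> z \<in> V \<Longrightarrow> ip x (y + z) = ip x y + ip x z"
  using ip_sym[of "y + z" x] ip_sym[of y x] ip_sym[of z x] by (simp add: ip_add_left)

lemma ip_scale_right: "x \<in> V \<Longrightarrow> y \<in> V \<Longrightarrow> ip x (c *\<^sub>C y) = cnj c * ip x y"
  using ip_sym[of "c *\<^sub>C y" x] ip_sym[of y x] by (simp add: ip_scale_left)

lemma ip_minus_left: "x \<in> V \<Longrightarrow> y \<in> V \<Longrightarrow> ip (- x) y = - ip x y"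
  using ip_scale_left[of x y "-1"] by (simp add: scaleC_minus_one)

lemma ip_minus_right: "x \<in> V \<Longrightarrow> y \<in> V \<Longrightarrow> ip x (- y) = - ip x y"
  using ip_scale_right[of x y "-1"] by (simp add: scaleC_minus_one)

lemma ip_diff_left: "x \<in> V \<Longrightarrow> y \<in> V \<Longrightarrow> z \<in> V \<Longrightarrow> ip (x - y) z = ip x z - ip y z"
  using ip_add_left[of x "-y" z] by (simp add: ip_minus_left)

lemma ip_diff_right: "x \<in> V \<Longrightarrow> y \<in> V \<Longrightarrow> z \<in> V \<Longrightarrow> ip x (y - z) = ip x y - ip x z"
  using ip_add_right[of x y "-z"] by (simp add: ip_minus_right)

lemma ip_zero_left [simp]: "y \<in> V \<Longrightarrow> ip 0 y = 0"
  using ip_scale_left[of 0 y 0] by simp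

lemma ip_zero_right [simp]: "y \<in> V \<Longrightarrow> ip y 0 = 0"
  using ip_scale_right[of y 0 0] by simp

lemma ip_sum_left:
  "(\<And>i. i \<in> I \<Longrightarrow> f i \<in> V) \<Longrightarrow> y \<in> V \<Longrightarrow> ip (\<Sum>i\<in>I. f i) y = (\<Sum>i\<in>I. ip (f i) y)"
  by (induction I rule: infinite_finite_induct) (auto simp: ip_add_left sum_mem)

lemma ip_sum_right:
  "(\<And>i. i \<in> I \<Longrightarrow> f i \<in> V) \<Longrightarrow> y \<in> V \<Longrightarrow> ip y (\<Sum>i\<in>I. f i) = (\<Sum>i\<in>I. ip y (f i))"
  by (induction I rule: infinite_finite_induct) (auto simp: ip_add_right sum_mem)

lemma ip_self_nonneg: "x \<in> V \<Longrightarrow> 0 \<le> Re (ip x x)"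
  using ip_pos[of x] by (cases "x = 0") auto

lemma ip_self: "x \<in> V \<Longrightarrow> ip x x = of_real ((nrm x)\<^sup>2)"
  using ip_sym[of x x] ip_self_nonneg[of x]
  by (auto simp: hnorm_def complex_eq_iff)

lemma ip_self_eq_0: "x \<in> V \<Longrightarrow> ip x x = 0 \<Longrightarrow> x = 0"
  using ip_pos[of x] by fastforce

lemma nrm_sq: "x \<in> V \<Longrightarrow> (nrm x)\<^sup>2 = Re (ip x x)"
  using ip_self_nonneg[of x] by (simp add: hnorm_def)

lemma nrm_nonneg [simp]: "x \<in> V \<Longrightarrow> 0 \<le> nrm x"
  using ip_self_nonneg[of x] by (simp add: hnorm_def)

lemma nrm_zero [simp]: "nrm 0 = 0"
  by (simp add: hnorm_def)

lemma nrm_eq_0: "x \<in> V \<Longrightarrow> nrm x = 0 \<longleftrightarrow> x = 0"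
  using ip_pos[of x] nrm_sq[of x] by (cases "x = 0") auto

lemma nrm_scale:
  assumes x: "x \<in> V"
  shows "nrm (c *\<^sub>C x) = cmod c * nrm x"
proof (rule power2_eq_imp_eq)
  have "(nrm (c *\<^sub>C x))\<^sup>2 = Re (c * cnj c * ip x x)"
    using x by (simp add: nrm_sq ip_scale_left ip_scale_right algebra_simps)
  also have "c * cnj c = of_real ((cmod c)\<^sup>2)"
    by (simp only: complex_norm_square)
  finally show "(nrm (c *\<^sub>C x))\<^sup>2 = (cmod c * nrm x)\<^sup>2"
    using x by (simp add: nrm_sq power_mult_distrib)
qed (use x in auto)

lemma nrm_minus: "x \<in> V \<Longrightarrow> nrm (- x) = nrm x"
  using nrm_scale[of x "-1"] by (simp add: scaleC_minus_one)

lemma nrm_minus_commute: "x \<in> V \<Longrightarrow> y \<in> V \<Longrightarrow> nrm (x - y) = nrm (y - x)"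
  using nrm_minus[of "x - y"] by simp

lemma nrm_add_sq:
  "x \<in> V \<Longrightarrow> y \<in> V \<Longrightarrow> (nrm (x + y))\<^sup>2 = (nrm x)\<^sup>2 + 2 * Re (ip x y) + (nrm y)\<^sup>2"
  using ip_sym[of x y] by (simp add: nrm_sq ip_add_left ip_add_right)

lemma nrm_diff_sq:
  "x \<in> V \<Longrightarrow> y \<in> V \<Longrightarrow> (nrm (x - y))\<^sup>2 = (nrm x)\<^sup>2 - 2 * Re (ip x y) + (nrm y)\<^sup>2"
  using ip_sym[of x y] by (simp add: nrm_sq ip_diff_left ip_diff_right)

lemma parallelogram:
  "x \<in> V \<Longrightarrow> y \<in> V \<Longrightarrow> (nrm (x + y))\<^sup>2 + (nrm (x - y))\<^sup>2 = 2 * (nrm x)\<^sup>2 + 2 * (nrm y)\<^sup>2"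
  by (simp add: nrm_add_sq nrm_diff_sq)

lemma cauchy_schwarz:
  assumes x: "x \<in> V" and y: "y \<in> V"
  shows "cmod (ip x y) \<le> nrm x * nrm y"
proof (cases "y = 0")
  case True then show ?thesis using x by simp
next
  case False
  then have pos: "nrm y > 0" using y nrm_eq_0 nrm_nonneg by (metis less_eq_real_def)
  define c where "c = ip x y / of_real ((nrm y)\<^sup>2)"
  have "0 \<le> (nrm (x - c *\<^sub>C y))\<^sup>2" by simp
  also have "\<dots> = (nrm x)\<^sup>2 - 2 * Re (cnj c * ip x y) + (cmod c * nrm y)\<^sup>2"
    using x y by (simp add: nrm_diff_sq ip_scale_right nrm_scale)
  also have "cnj c * ip x y = of_real ((cmod (ip x y))\<^sup>2 / (nrm y)\<^sup>2)"
    by (simp add: c_def complex_norm_square mult.commute del: of_real_power)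
  also have "(cmod c * nrm y)\<^sup>2 = (cmod (ip x y))\<^sup>2 / (nrm y)\<^sup>2"
    using pos by (simp add: c_def norm_divide power_mult_distrib power_divide norm_power
        field_simps flip: power_add)
  finally have "(cmod (ip x y))\<^sup>2 / (nrm y)\<^sup>2 \<le> (nrm x)\<^sup>2" by simp
  then have "(cmod (ip x y))\<^sup>2 \<le> (nrm x * nrm y)\<^sup>2"
    using pos by (simp add: divide_le_eq power_mult_distrib)
  then show ?thesis using x y by (auto intro: power2_le_imp_le)
qed

lemma re_cauchy_schwarz: "x \<in> V \<Longrightarrow> y \<in> V \<Longrightarrow> Re (ip x y) \<le> nrm x * nrm y"
  using cauchy_schwarz[of x y] complex_Re_le_cmod[of "ip x y"] by linarith

lemma nrm_triangle:
  assumes "x \<in> V" "y \<in> V"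
  shows "nrm (x + y) \<le> nrm x + nrm y"
proof (rule power2_le_imp_le)
  show "(nrm (x + y))\<^sup>2 \<le> (nrm x + nrm y)\<^sup>2"
    using assms re_cauchy_schwarz[of x y] by (simp add: nrm_add_sq power2_sum)
qed (use assms in auto)

lemma nrm_diff_le: "x \<in> V \<Longrightarrow> y \<in> V \<Longrightarrow> \<bar>nrm x - nrm y\<bar> \<le> nrm (x - y)"
  using nrm_triangle[of "x - y" y] nrm_triangle[of "y - x" x] nrm_minus_commute[of x y] by auto

lemma nrm_sum_le: "(\<And>i. i \<in> I \<Longrightarrow> f i \<in> V) \<Longrightarrow> nrm (\<Sum>i\<in>I. f i) \<le> (\<Sum>i\<in>I. nrm (f i))"
proof (induction I rule: infinite_finite_induct)
  case (insert a I)
  then have "nrm (f a + sum f I) \<le> nrm (f a) + nrm (sum f I)"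
    by (intro nrm_triangle sum_mem) auto
  also have "\<dots> \<le> nrm (f a) + (\<Sum>i\<in>I. nrm (f i))" using insert by simp
  finally show ?case using insert by simp
qed auto

lemma eq_if_ip_right_eq:
  assumes "x \<in> V" "y \<in> V" "\<And>z. z \<in> V \<Longrightarrow> ip x z = ip y z"
  shows "x = y"
  using ip_self_eq_0[of "x - y"] assms by (simp add: ip_diff_left)

lemma eq_if_ip_left_eq:
  assumes "x \<in> V" "y \<in> V" "\<And>z. z \<in> V \<Longrightarrow> ip z x = ip z y"
  shows "x = y"
  using ip_self_eq_0[of "x - y"] assms by (simp add: ip_diff_right)

lemma polarization:
  assumes "x \<in> V" "y \<in> V"
  shows "ip x y = (1/4) * (\<Sum>k<(4::nat). \<i>^k * complex_of_real ((nrm (x + (\<i>^k) *\<^sub>C y))\<^sup>2))"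
proof -
  have expand: "complex_of_real ((nrm (x + c *\<^sub>C y))\<^sup>2) =
     ip x x + cnj c * ip x y + c * ip y x + c * cnj c * ip y y" for c
    using assms by (subst ip_self[symmetric])
      (simp_all add: ip_add_left ip_add_right ip_scale_left ip_scale_right algebra_simps)
  have "\<i> ^ 3 = - \<i>" by (simp add: power3_eq_cube)
  moreover have "{..<4::nat} = {0, 1, 2, 3}" by auto
  ultimately show ?thesis
    unfolding expand by (simp add: algebra_simps)
qed

lemma strong_limit_if_dominated:
  assumes s: "\<And>n. s n \<in> V" and b: "b \<longlonglongrightarrow> 0" and dom: "\<And>n k. nrm (s (n + k) - s n) \<le> b n"
  obtains l where "l \<in> V" "strong_limit ip s l"
proof -
  have "cauchy_in ip s"
    unfolding cauchy_in_def
  proof (intro allI impI)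
    fix e :: real assume "e > 0"
    then obtain N where N: "\<And>n. n \<ge> N \<Longrightarrow> b n < e"
      using order_tendstoD(2)[OF b] by (auto simp: eventually_sequentially)
    have less: "nrm (s m - s n) < e" if "n \<ge> N" "m \<ge> n" for m n
      using dom[of n "m - n"] N[OF that(1)] that by simp
    have "nrm (s m - s n) < e" if "n \<ge> N" "m \<ge> N" for m n
      using less[of m n] less[of n m] nrm_minus_commute[OF s[of m] s[of n]] that
      by (cases "m \<ge> n") auto
    then show "\<exists>N. \<forall>m\<ge>N. \<forall>n\<ge>N. nrm (s m - s n) < e" by blast
  qed
  then show thesis using complete s that by blast
qed

lemma tendsto_ip_left:
  assumes "\<And>n. s n \<in> V" "l \<in> V" "strong_limit ip s l" "y \<in> V"
  shows "(\<lambda>n. ip (s n) y) \<longlonglongrightarrow> ip l y"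
proof -
  have "(\<lambda>n. ip (s n) y - ip l y) \<longlonglongrightarrow> 0"
  proof (rule Lim_null_comparison)
    show "\<forall>\<^sub>F n in sequentially. norm (ip (s n) y - ip l y) \<le> nrm (s n - l) * nrm y"
      using assms cauchy_schwarz by (auto simp: ip_diff_left[symmetric])
    show "(\<lambda>n. nrm (s n - l) * nrm y) \<longlonglongrightarrow> 0"
      using assms(3) tendsto_mult_left_zero unfolding strong_limit_def by blast
  qed
  then show ?thesis by (simp add: LIM_zero_iff)
qed

lemma tendsto_nrm:
  assumes "\<And>n. s n \<in> V" "l \<in> V" "strong_limit ip s l"
  shows "(\<lambda>n. nrm (s n)) \<longlonglongrightarrow> nrm l"
proof -
  have "(\<lambda>n. nrm (s n) - nrm l) \<longlonglongrightarrow> 0"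
  proof (rule Lim_null_comparison)
    show "\<forall>\<^sub>F n in sequentially. norm (nrm (s n) - nrm l) \<le> nrm (s n - l)"
      using assms nrm_diff_le by auto
    show "(\<lambda>n. nrm (s n - l)) \<longlonglongrightarrow> 0" using assms(3) by (simp add: strong_limit_def)
  qed
  then show ?thesis by (simp add: LIM_zero_iff)
qed

lemma strong_limit_unique:
  assumes "\<And>n. s n \<in> V" "l \<in> V" "l' \<in> V" "strong_limit ip s l" "strong_limit ip s l'"
  shows "l = l'"
proof (rule eq_if_ip_right_eq)
  show "ip l z = ip l' z" if "z \<in> V" for z
    using tendsto_ip_left[of s l z] tendsto_ip_left[of s l' z] assms that LIMSEQ_unique by blast
qed (use assms in auto)

lemma strong_limit_add:
  assumes s: "\<And>n. s n \<in> V" "l \<in> V" "strong_limit ip s l"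
    and t: "\<And>n. t n \<in> V" "m \<in> V" "strong_limit ip t m"
  shows "strong_limit ip (\<lambda>n. s n + t n) (l + m)"
  unfolding strong_limit_def
proof (rule Lim_null_comparison)
  have "nrm (s n + t n - (l + m)) \<le> nrm (s n - l) + nrm (t n - m)" for n
    using nrm_triangle[of "s n - l" "t n - m"] s(1,2) t(1,2) by (simp add: algebra_simps)
  then show "\<forall>\<^sub>F n in sequentially. norm (nrm (s n + t n - (l + m))) \<le>
      nrm (s n - l) + nrm (t n - m)"
    using s t by simp
  show "(\<lambda>n. nrm (s n - l) + nrm (t n - m)) \<longlonglongrightarrow> 0"
    using s(3) t(3) tendsto_add_zero unfolding strong_limit_def by blast
qed

lemma strong_limit_scale:
  assumes "\<And>n. s n \<in> V" "l \<in> V" "strong_limit ip s l"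
  shows "strong_limit ip (\<lambda>n. c *\<^sub>C s n) (c *\<^sub>C l)"
  using tendsto_mult_right_zero[of _ _ "cmod c"] assms
  by (simp add: strong_limit_def scaleC_diff_right[symmetric] nrm_scale)

lemma strong_limit_const: "strong_limit ip (\<lambda>_. l) l"
  by (simp add: strong_limit_def)

lemma csubspace_closure_in:
  assumes P: "csubspace P" "P \<subseteq> V"
  shows "csubspace (closure_in V ip P)"
  unfolding csubspace_def
proof (intro conjI ballI allI)
  show "0 \<in> closure_in V ip P"
    using csubspace_0[OF P(1)] by (intro closure_inI[of _ _ "\<lambda>_. 0"] strong_limit_const) auto
next
  fix x y assume x: "x \<in> closure_in V ip P" and y: "y \<in> closure_in V ip P"
  obtain s where s: "x \<in> V" "\<And>n. s n \<in> P" "strong_limit ip s x"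
    using x unfolding closure_in_def by blast
  obtain t where t: "y \<in> V" "\<And>n. t n \<in> P" "strong_limit ip t y"
    using y unfolding closure_in_def by blast
  show "x + y \<in> closure_in V ip P"
    using s t P by (intro closure_inI[of _ _ "\<lambda>n. s n + t n"] strong_limit_add)
      (auto simp: csubspace_add)
next
  fix c x assume x: "x \<in> closure_in V ip P"
  obtain s where "x \<in> V" "\<And>n. s n \<in> P" "strong_limit ip s x"
    using x unfolding closure_in_def by blast
  then show "c *\<^sub>C x \<in> closure_in V ip P"
    using P by (intro closure_inI[of _ _ "\<lambda>n. c *\<^sub>C s n"] strong_limit_scale)
      (auto simp: csubspace_scaleC)
qed

lemma mem_closure_in_iff:
  assumes P: "P \<subseteq> V"
  shows "x \<in> closure_in V ip P \<longleftrightarrow> x \<in> V \<and> (\<forall>e>0. \<exists>p\<in>P. nrm (x - p) < e)"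
proof
  assume "x \<in> closure_in V ip P"
  then obtain s where x: "x \<in> V" and s: "\<And>n. s n \<in> P" "(\<lambda>n. nrm (s n - x)) \<longlonglongrightarrow> 0"
    unfolding closure_in_def strong_limit_def by blast
  have "\<exists>p\<in>P. nrm (x - p) < e" if e: "e > 0" for e
  proof -
    obtain n where "nrm (s n - x) < e"
      using order_tendstoD(2)[OF s(2) e] by (auto simp: eventually_sequentially)
    moreover have "nrm (x - s n) = nrm (s n - x)"
      using s(1)[of n] x P by (intro nrm_minus_commute) auto
    ultimately show ?thesis using s(1)[of n] by (intro bexI[of _ "s n"]) simp_all
  qed
  with x show "x \<in> V \<and> (\<forall>e>0. \<exists>p\<in>P. nrm (x - p) < e)" by blast
next
  assume x: "x \<in> V \<and> (\<forall>e>0. \<exists>p\<in>P. nrm (x - p) < e)"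
  then have "\<forall>n. \<exists>p\<in>P. nrm (x - p) < 1 / Suc n" by simp
  then obtain s where s: "\<And>n. s n \<in> P" "\<And>n. nrm (x - s n) < 1 / Suc n" by metis
  have "(\<lambda>n. nrm (s n - x)) \<longlonglongrightarrow> 0"
  proof (rule Lim_null_comparison)
    have "norm (nrm (s n - x)) \<le> 1 / Suc n" for n
      using s(1,2)[of n] x P nrm_minus_commute[of x "s n"] by (auto simp: subset_iff)
    then show "\<forall>\<^sub>F n in sequentially. norm (nrm (s n - x)) \<le> 1 / Suc n" by simp
    show "(\<lambda>n. 1 / real (Suc n)) \<longlonglongrightarrow> 0"
      using LIMSEQ_inverse_real_of_nat by (simp add: inverse_eq_divide)
  qed
  then show "x \<in> closure_in V ip P"
    using s(1) x by (intro closure_inI) (auto simp: strong_limit_def)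
qed

lemma hilbert_space_closed_subspace:
  assumes W: "W \<subseteq> V" "csubspace W"
    and closed: "\<And>s l. (\<And>n. s n \<in> W) \<Longrightarrow> l \<in> V \<Longrightarrow> strong_limit ip s l \<Longrightarrow> l \<in> W"
  shows "hilbert_space W ip"
proof (rule hilbert_spaceI)
  fix s assume "\<And>n. s n \<in> W" "cauchy_in ip s"
  then show "\<exists>l\<in>W. strong_limit ip s l"
    using complete[of s] closed W(1) by (metis subsetD)
qed (use W in \<open>auto intro: ip_add_left ip_scale_left ip_pos ip_sym\<close>)

lemma hilbert_space_orthogonal_complement:
  assumes "S \<subseteq> V"
  shows "hilbert_space {x \<in> V. \<forall>y\<in>S. ip x y = 0} ip"
proof (rule hilbert_space_closed_subspace)
  fix s l
  assume s: "\<And>n. s n \<in> {x \<in> V. \<forall>y\<in>S. ip x y = 0}" and l: "l \<in> V" "strong_limit ip s l"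
  have "ip l y = 0" if "y \<in> S" for y
    using tendsto_ip_left[of s l y] s l that assms by (auto simp: LIMSEQ_const_iff)
  then show "l \<in> {x \<in> V. \<forall>y\<in>S. ip x y = 0}" using l(1) by simp
qed (use assms in \<open>auto simp: csubspace_def ip_add_left ip_scale_left subset_iff\<close>)


end

lemma hilbert_space_pullback:
  assumes W: "hilbert_space W ip" and X: "csubspace X" and J: "bij_betw J X W"
    and add: "\<And>x y. x \<in> X \<Longrightarrow> y \<in> X \<Longrightarrow> J (x + y) = J x + J y"
    and scale: "\<And>c x. x \<in> X \<Longrightarrow> J (c *\<^sub>C x) = c *\<^sub>C J x"
  shows "hilbert_space X (\<lambda>x y. ip (J x) (J y))"
proof -
  interpret hilbert W ip by unfold_locales (rule W)
  have J_mem: "J x \<in> W" if "x \<in> X" for x using J that by (auto simp: bij_betw_def)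
  have J_diff: "J (x - y) = J x - J y" if "x \<in> X" "y \<in> X" for x y
    using add[of x "- y"] scale[of y "-1"] csubspace_uminus[OF X] that
    by (simp add: scaleC_minus_one)
  show ?thesis
  proof (rule hilbert_spaceI[OF X])
    fix x y assume xy: "x \<in> X" "y \<in> X"
    show "ip (J y) (J x) = cnj (ip (J x) (J y))" using xy J_mem by (intro ip_sym)
    show "ip (J (c *\<^sub>C x)) (J y) = c * ip (J x) (J y)" for c
      using xy J_mem by (simp add: scale ip_scale_left)
    show "ip (J (x + y)) (J z) = ip (J x) (J z) + ip (J y) (J z)" if "z \<in> X" for z
      using xy that J_mem by (simp add: add ip_add_left)
  next
    fix x assume x: "x \<in> X" "x \<noteq> 0"
    have "J 0 = 0" using scale[OF csubspace_0[OF X], of 0] by simp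
    then have "J x \<noteq> 0"
      using J x csubspace_0[OF X] by (metis bij_betw_def inj_on_def)
    then show "0 < Re (ip (J x) (J x))" using J_mem[OF x(1)] by (simp add: ip_pos)
  next
    fix s assume s: "\<And>n. s n \<in> X" and cauchy: "cauchy_in (\<lambda>x y. ip (J x) (J y)) s"
    have hnorm_diff: "hnorm (\<lambda>x y. ip (J x) (J y)) (x - y) = nrm (J x - J y)"
      if "x \<in> X" "y \<in> X" for x y
      using that by (simp add: hnorm_def J_diff)
    have "cauchy_in ip (\<lambda>n. J (s n))"
      using cauchy by (simp add: cauchy_in_def hnorm_diff s)
    then obtain l where l: "l \<in> W" "strong_limit ip (\<lambda>n. J (s n)) l"
      using complete[of "\<lambda>n. J (s n)"] J_mem[OF s] by metis
    then obtain x where x: "x \<in> X" "J x = l"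
      using J by (metis bij_betw_def imageE)
    then have "strong_limit (\<lambda>x y. ip (J x) (J y)) s x"
      using l(2) by (simp add: strong_limit_def hnorm_diff s)
    with x(1) show "\<exists>x\<in>X. strong_limit (\<lambda>x y. ip (J x) (J y)) s x" by blast
  qed
qed

section \<open>Riesz representation and closed spans\<close>

lemma quadratic_nonneg_imp_linear_zero:
  fixes b c :: real
  assumes "\<And>t. 0 \<le> 2 * t * b + t\<^sup>2 * c" "0 \<le> c"
  shows "b = 0"
proof (rule ccontr)
  assume "b \<noteq> 0"
  define t where "t = - b / (c + 1)"
  have t: "t * (c + 1) = - b" using assms(2) by (simp add: t_def)
  have "(2 * t * b + t\<^sup>2 * c) * (c + 1)\<^sup>2 = 2 * (t * (c + 1)) * b * (c + 1) + (t * (c + 1))\<^sup>2 * c"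
    by (simp add: power2_eq_square algebra_simps)
  also have "\<dots> = - (b\<^sup>2 * (c + 2))"
    unfolding t by (simp add: power2_eq_square algebra_simps)
  finally have "(2 * t * b + t\<^sup>2 * c) * (c + 1)\<^sup>2 < 0"
    using assms(2) \<open>b \<noteq> 0\<close> by (simp add: mult_pos_pos)
  then show False
    using assms(1)[of t] by (metis linorder_not_less mult_nonneg_nonneg zero_le_power2)
qed

text \<open>The subspace need not be closed: the representing vector minimises \<open>\<Parallel>x\<Parallel>\<^sup>2 - 2 Re (\<phi> x)\<close> over
  the closure, and the parallelogram law makes every minimising sequence Cauchy.\<close>

locale subspace_functional = hilbert V ip for V :: "'a::cvector set" and ip +
  fixes P :: "'a set" and \<phi> :: "'a \<Rightarrow> complex" and K :: real
  assumes P_subset: "P \<subseteq> V" and P_subspace: "csubspace P"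
    and \<phi>_add: "x \<in> P \<Longrightarrow> y \<in> P \<Longrightarrow> \<phi> (x + y) = \<phi> x + \<phi> y"
    and \<phi>_scale: "x \<in> P \<Longrightarrow> \<phi> (c *\<^sub>C x) = c * \<phi> x"
    and K_nonneg: "0 \<le> K" and \<phi>_bound: "x \<in> P \<Longrightarrow> cmod (\<phi> x) \<le> K * nrm x"
begin

lemma P_mem [simp]: "x \<in> P \<Longrightarrow> x \<in> V"
  using P_subset by blast

definition energy :: "'a \<Rightarrow> real" where
  "energy x = (nrm x)\<^sup>2 - 2 * Re (\<phi> x)"

definition min_energy :: real where
  "min_energy = Inf (energy ` P)"

lemma energy_ge: "x \<in> P \<Longrightarrow> - K\<^sup>2 \<le> energy x"
  using \<phi>_bound[of x] complex_Re_le_cmod[of "\<phi> x"] zero_le_power2[of "nrm x - K"]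
  by (simp add: energy_def power2_diff algebra_simps)

lemma bdd_below_energy: "bdd_below (energy ` P)"
  using energy_ge by (auto intro!: bdd_belowI2)

lemma min_energy_le: "x \<in> P \<Longrightarrow> min_energy \<le> energy x"
  unfolding min_energy_def using bdd_below_energy by (intro cInf_lower) auto

lemma nrm_diff_sq_le_energy:
  assumes x: "x \<in> P" and y: "y \<in> P"
  shows "(nrm (x - y))\<^sup>2 \<le> 2 * (energy x + energy y - 2 * min_energy)"
proof -
  define h where "h = (1/2) *\<^sub>C (x + y)"
  have h: "h \<in> P" using x y P_subspace by (simp add: h_def csubspace_add csubspace_scaleC)
  have "energy h = (nrm (x + y))\<^sup>2 / 4 - Re (\<phi> (x + y))"
    using x y P_subspace by (simp add: energy_def h_def nrm_scale \<phi>_scale csubspace_add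
        power_mult_distrib power_divide field_simps)
  then show ?thesis
    using parallelogram[of x y] min_energy_le[OF h] x y by (simp add: energy_def \<phi>_add)
qed

lemma minimising_sequence:
  obtains s z where "\<And>n. s n \<in> P" "z \<in> V" "strong_limit ip s z" "(\<lambda>n. energy (s n)) \<longlonglongrightarrow> min_energy"
proof -
  have "\<exists>x\<in>P. energy x < min_energy + 1 / Suc n" for n
  proof -
    have "Inf (energy ` P) < min_energy + 1 / Suc n" by (simp add: min_energy_def)
    then show ?thesis
      using csubspace_0[OF P_subspace] bdd_below_energy by (subst (asm) cInf_less_iff) auto
  qed
  then obtain s where s: "\<And>n. s n \<in> P" "\<And>n. energy (s n) < min_energy + 1 / Suc n" by metis
  have "nrm (s (n + k) - s n) \<le> sqrt (4 / Suc n)" for n k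
  proof (rule real_le_rsqrt)
    have "(nrm (s (n + k) - s n))\<^sup>2 \<le> 2 * (1 / Suc (n + k) + 1 / Suc n)"
      using nrm_diff_sq_le_energy[OF s(1) s(1), of "n + k" n] s(2)[of "n + k"] s(2)[of n] by simp
    also have "\<dots> \<le> 2 * (1 / Suc n + 1 / Suc n)"
      by (intro mult_left_mono add_mono divide_left_mono) auto
    finally show "(nrm (s (n + k) - s n))\<^sup>2 \<le> 4 / Suc n" by simp
  qed
  moreover have "(\<lambda>n. sqrt (4 / Suc n)) \<longlonglongrightarrow> 0"
    by real_asymp
  ultimately obtain z where z: "z \<in> V" "strong_limit ip s z"
    using strong_limit_if_dominated[of s] s(1) by (metis P_mem)
  have "(\<lambda>n. energy (s n)) \<longlonglongrightarrow> min_energy"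
  proof (rule real_tendsto_sandwich)
    show "\<forall>\<^sub>F n in sequentially. min_energy \<le> energy (s n)" using min_energy_le s by auto
    show "\<forall>\<^sub>F n in sequentially. energy (s n) \<le> min_energy + 1 / Suc n"
      using s(2) by (intro always_eventually allI less_imp_le)
    show "(\<lambda>n. min_energy + 1 / Suc n) \<longlonglongrightarrow> min_energy"
      using tendsto_add[OF tendsto_const[of min_energy] LIMSEQ_inverse_real_of_nat]
      by (simp add: inverse_eq_divide)
  qed auto
  with s(1) z show thesis by (rule that)
qed

lemma first_variation:
  assumes s: "\<And>n. s n \<in> P" "z \<in> V" "strong_limit ip s z" "(\<lambda>n. energy (s n)) \<longlonglongrightarrow> min_energy"
    and a: "a \<in> P"
  shows "Re (ip z a) = Re (\<phi> a)"
proof -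
  have "0 \<le> 2 * t * (Re (ip z a) - Re (\<phi> a)) + t\<^sup>2 * (nrm a)\<^sup>2" for t
  proof -
    have "min_energy \<le> energy (s n) + (2 * t * (Re (ip (s n) a) - Re (\<phi> a)) + t\<^sup>2 * (nrm a)\<^sup>2)"
      for n
    proof -
      have ta: "of_real t *\<^sub>C a \<in> P" using a P_subspace by (simp add: csubspace_scaleC)
      have "min_energy \<le> energy (s n + of_real t *\<^sub>C a)"
        using s(1) ta P_subspace by (intro min_energy_le csubspace_add)
      also have "\<dots> = energy (s n) + (2 * t * (Re (ip (s n) a) - Re (\<phi> a)) + t\<^sup>2 * (nrm a)\<^sup>2)"
        using s(1) a ta by (simp add: energy_def nrm_add_sq \<phi>_add \<phi>_scale ip_scale_right nrm_scale
            power_mult_distrib algebra_simps)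
      finally show ?thesis .
    qed
    moreover have "(\<lambda>n. energy (s n) + (2 * t * (Re (ip (s n) a) - Re (\<phi> a)) + t\<^sup>2 * (nrm a)\<^sup>2))
        \<longlonglongrightarrow> min_energy + (2 * t * (Re (ip z a) - Re (\<phi> a)) + t\<^sup>2 * (nrm a)\<^sup>2)"
      using s a by (intro tendsto_intros tendsto_ip_left) auto
    ultimately have "min_energy \<le> min_energy + (2 * t * (Re (ip z a) - Re (\<phi> a)) + t\<^sup>2 * (nrm a)\<^sup>2)"
      by (intro LIMSEQ_le_const) auto
    then show ?thesis by simp
  qed
  then have "Re (ip z a) - Re (\<phi> a) = 0"
    by (rule quadratic_nonneg_imp_linear_zero) simp
  then show ?thesis by simp
qed

lemma riesz_representation:
  obtains z where "z \<in> closure_in V ip P" "\<And>a. a \<in> P \<Longrightarrow> ip a z = \<phi> a" "nrm z \<le> K"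
proof -
  obtain s z where s: "\<And>n. s n \<in> P" "z \<in> V" "strong_limit ip s z"
    "(\<lambda>n. energy (s n)) \<longlonglongrightarrow> min_energy"
    using minimising_sequence by metis
  have rep: "ip a z = \<phi> a" if a: "a \<in> P" for a
  proof (rule complex_eqI)
    have sym: "ip a z = cnj (ip z a)" using s a by (intro ip_sym) auto
    then show "Re (ip a z) = Re (\<phi> a)" using first_variation[OF s a] by simp
    have "Re (ip z (\<i> *\<^sub>C a)) = Re (\<phi> (\<i> *\<^sub>C a))"
      using first_variation[OF s] csubspace_scaleC[OF P_subspace a] .
    then show "Im (ip a z) = Im (\<phi> a)"
      using a s(2) by (simp add: sym ip_scale_right \<phi>_scale)
  qed
  have "(nrm z)\<^sup>2 \<le> K * nrm z"
  proof (rule LIMSEQ_le)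
    show "(\<lambda>n. Re (ip (s n) z)) \<longlonglongrightarrow> (nrm z)\<^sup>2"
      unfolding nrm_sq[OF s(2)] using s by (intro tendsto_intros tendsto_ip_left) auto
    show "(\<lambda>n. K * nrm (s n)) \<longlonglongrightarrow> K * nrm z"
      using s by (intro tendsto_intros tendsto_nrm) auto
    have "Re (ip (s n) z) \<le> K * nrm (s n)" for n
      using rep[OF s(1)] \<phi>_bound[OF s(1)] complex_Re_le_cmod order_trans by metis
    then show "\<exists>N. \<forall>n\<ge>N. Re (ip (s n) z) \<le> K * nrm (s n)" by blast
  qed
  then have "nrm z \<le> K"
    using K_nonneg nrm_nonneg[OF s(2)] by (cases "nrm z = 0") (auto simp: power2_eq_square)
  moreover have "z \<in> closure_in V ip P" using s by (intro closure_inI)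
  ultimately show thesis using rep that by blast
qed

end

instantiation complex :: cvector
begin
definition scaleC_complex :: "complex \<Rightarrow> complex \<Rightarrow> complex" where "scaleC_complex = (*)"
instance by standard (auto simp: scaleC_complex_def algebra_simps)
end

definition lincomb :: "('i \<Rightarrow> 'a::cvector) \<Rightarrow> (complex \<times> 'i) list \<Rightarrow> 'a" where
  "lincomb a xs = (\<Sum>(c, i)\<leftarrow>xs. c *\<^sub>C a i)"

definition scale_coeffs :: "complex \<Rightarrow> (complex \<times> 'i) list \<Rightarrow> (complex \<times> 'i) list" where
  "scale_coeffs c = map (map_prod ((*) c) id)"

definition lin_span :: "('i \<Rightarrow> 'a::cvector) \<Rightarrow> 'i set \<Rightarrow> 'a set" where
  "lin_span a I = lincomb a ` lists (UNIV \<times> I)"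

definition closed_span ::
  "'a::cvector set \<Rightarrow> ('a \<Rightarrow> 'a \<Rightarrow> complex) \<Rightarrow> ('i \<Rightarrow> 'a) \<Rightarrow> 'i set \<Rightarrow> 'a set" where
  "closed_span V ip a I = closure_in V ip (lin_span a I)"

lemma lincomb_Nil [simp]: "lincomb a [] = 0"
  and lincomb_Cons [simp]: "lincomb a ((c, i) # xs) = c *\<^sub>C a i + lincomb a xs"
  and lincomb_append: "lincomb a (xs @ ys) = lincomb a xs + lincomb a ys"
  by (simp_all add: lincomb_def)

lemma lincomb_scale_coeffs: "lincomb a (scale_coeffs c xs) = c *\<^sub>C lincomb a xs"
  by (induction xs) (auto simp: scale_coeffs_def scaleC_add_right scaleC_scaleC)

lemma scale_coeffs_in_lists: "xs \<in> lists (UNIV \<times> I) \<Longrightarrow> scale_coeffs c xs \<in> lists (UNIV \<times> I)"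
  by (induction xs) (auto simp: scale_coeffs_def)

lemma lincomb_nth: "lincomb a xs = (\<Sum>i<length xs. fst (xs ! i) *\<^sub>C a (snd (xs ! i)))"
  unfolding lincomb_def by (simp add: sum_list_sum_nth case_prod_beta atLeast0LessThan)

lemma lin_span_iff:
  "x \<in> lin_span a I \<longleftrightarrow> (\<exists>n c i. (\<forall>k<(n::nat). i k \<in> I) \<and> x = (\<Sum>k<n. c k *\<^sub>C a (i k)))"
proof
  assume "x \<in> lin_span a I"
  then obtain xs where xs: "xs \<in> lists (UNIV \<times> I)" "x = lincomb a xs" by (auto simp: lin_span_def)
  have "snd (xs ! k) \<in> I" if "k < length xs" for k
    using xs(1) nth_mem[OF that] by (auto simp: in_lists_conv_set mem_Times_iff)
  then have "(\<forall>k<length xs. snd (xs ! k) \<in> I) \<and> x =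
      (\<Sum>k<length xs. fst (xs ! k) *\<^sub>C a (snd (xs ! k)))"
    by (simp add: xs(2) lincomb_nth)
  then show "\<exists>n c i. (\<forall>k<(n::nat). i k \<in> I) \<and> x = (\<Sum>k<n. c k *\<^sub>C a (i k))"
    by - (rule exI)+
next
  assume "\<exists>n c i. (\<forall>k<(n::nat). i k \<in> I) \<and> x = (\<Sum>k<n. c k *\<^sub>C a (i k))"
  then obtain n :: nat and c i where x: "\<forall>k<n. i k \<in> I" "x = (\<Sum>k<n. c k *\<^sub>C a (i k))" by blast
  have "x = lincomb a (map (\<lambda>k. (c k, i k)) [0..<n])"
    using x(2) by (simp add: lincomb_nth)
  moreover have "map (\<lambda>k. (c k, i k)) [0..<n] \<in> lists (UNIV \<times> I)"
    using x(1) by (simp add: in_lists_conv_set)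
  ultimately show "x \<in> lin_span a I" unfolding lin_span_def by blast
qed

lemma bex_lin_span_Times_iff:
  "(\<exists>p\<in>lin_span (\<lambda>(z, y). f z y) (A \<times> B). Q p) \<longleftrightarrow>
    (\<exists>n c z y. (\<forall>k<(n::nat). z k \<in> A \<and> y k \<in> B) \<and> Q (\<Sum>k<n. c k *\<^sub>C f (z k) (y k)))"
proof
  assume "\<exists>p\<in>lin_span (\<lambda>(z, y). f z y) (A \<times> B). Q p"
  then obtain p where p: "p \<in> lin_span (\<lambda>(z, y). f z y) (A \<times> B)" "Q p" by (rule bexE)
  then obtain n :: nat and c i where "\<forall>k<n. i k \<in> A \<times> B"
    "p = (\<Sum>k<n. c k *\<^sub>C (case i k of (z, y) \<Rightarrow> f z y))"
    unfolding lin_span_iff by blast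
  with p(2) have "(\<forall>k<n. fst (i k) \<in> A \<and> snd (i k) \<in> B) \<and>
      Q (\<Sum>k<n. c k *\<^sub>C f (fst (i k)) (snd (i k)))"
    by (auto simp: case_prod_beta mem_Times_iff)
  then show "\<exists>n c z y. (\<forall>k<(n::nat). z k \<in> A \<and> y k \<in> B) \<and> Q (\<Sum>k<n. c k *\<^sub>C f (z k) (y k))"
    by - (rule exI[of _ n], rule exI[of _ c], rule exI[of _ "\<lambda>k. fst (i k)"],
      rule exI[of _ "\<lambda>k. snd (i k)"])
next
  assume "\<exists>n c z y. (\<forall>k<(n::nat). z k \<in> A \<and> y k \<in> B) \<and> Q (\<Sum>k<n. c k *\<^sub>C f (z k) (y k))"
  then obtain n :: nat and c z y where mem: "\<forall>k<n. z k \<in> A \<and> y k \<in> B"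
    and Q: "Q (\<Sum>k<n. c k *\<^sub>C f (z k) (y k))" by blast
  show "\<exists>p\<in>lin_span (\<lambda>(z, y). f z y) (A \<times> B). Q p"
  proof (rule bexI[of Q, OF Q])
    show "(\<Sum>k<n. c k *\<^sub>C f (z k) (y k)) \<in> lin_span (\<lambda>(z, y). f z y) (A \<times> B)"
      unfolding lin_span_iff using mem
      by (auto intro!: exI[of _ n] exI[of _ c] exI[of _ "\<lambda>k. (z k, y k)"])
  qed
qed

lemma csubspace_lin_span: "csubspace (lin_span a I)"
  unfolding csubspace_def
proof (intro conjI ballI allI)
  show "0 \<in> lin_span a I" unfolding lin_span_def by (force intro: image_eqI[of _ _ "[]"])
next
  fix x y assume "x \<in> lin_span a I" "y \<in> lin_span a I"
  then obtain xs ys where "x = lincomb a xs" "y = lincomb a ys"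
    and mem: "xs \<in> lists (UNIV \<times> I)" "ys \<in> lists (UNIV \<times> I)" by (auto simp: lin_span_def)
  then have "x + y = lincomb a (xs @ ys)" by (simp add: lincomb_append)
  then show "x + y \<in> lin_span a I"
    unfolding lin_span_def using mem by (intro image_eqI[of _ _ "xs @ ys"]) simp_all
next
  fix c x assume "x \<in> lin_span a I"
  then obtain xs where "x = lincomb a xs" and mem: "xs \<in> lists (UNIV \<times> I)"
    by (auto simp: lin_span_def)
  then have "c *\<^sub>C x = lincomb a (scale_coeffs c xs)" by (simp add: lincomb_scale_coeffs)
  then show "c *\<^sub>C x \<in> lin_span a I"
    unfolding lin_span_def using scale_coeffs_in_lists[OF mem] by (intro image_eqI)
qed

lemma generator_in_lin_span: "i \<in> I \<Longrightarrow> a i \<in> lin_span a I"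
  unfolding lin_span_def by (intro image_eqI[of _ _ "[(1, i)]"]) (auto simp: scaleC_one)

context hilbert
begin

lemma lincomb_mem: "\<forall>i\<in>I. a i \<in> V \<Longrightarrow> xs \<in> lists (UNIV \<times> I) \<Longrightarrow> lincomb a xs \<in> V"
  by (induction xs) auto

lemma lin_span_subset: "\<forall>i\<in>I. a i \<in> V \<Longrightarrow> lin_span a I \<subseteq> V"
  using lincomb_mem by (auto simp: lin_span_def)

lemma closed_span_subset: "closed_span V ip a I \<subseteq> V"
  by (auto simp: closed_span_def closure_in_def)

lemma csubspace_closed_span: "\<forall>i\<in>I. a i \<in> V \<Longrightarrow> csubspace (closed_span V ip a I)"
  unfolding closed_span_def by (intro csubspace_closure_in csubspace_lin_span lin_span_subset)

lemma generator_in_closed_span: "\<forall>i\<in>I. a i \<in> V \<Longrightarrow> i \<in> I \<Longrightarrow> a i \<in> closed_span V ip a I"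
  unfolding closed_span_def
  by (intro closure_inI[of _ _ "\<lambda>_. a i"] strong_limit_const generator_in_lin_span) auto

lemma ip_lincomb_left:
  assumes "\<forall>i\<in>I. a i \<in> V" "xs \<in> lists (UNIV \<times> I)" "z \<in> V"
  shows "ip (lincomb a xs) z = lincomb (\<lambda>i. ip (a i) z) xs"
  using assms(2)
proof (induction xs)
  case (Cons x xs)
  then show ?case
    using assms(1,3) lincomb_mem[OF assms(1)]
    by (cases x) (auto simp: ip_add_left ip_scale_left scaleC_complex_def)
qed (use assms in simp)

lemma ip_closed_span_eq_0:
  assumes a: "\<forall>i\<in>I. a i \<in> V" and x: "x \<in> closed_span V ip a I" and z: "z \<in> V"
    and perp: "\<And>i. i \<in> I \<Longrightarrow> ip (a i) z = 0"
  shows "ip x z = 0"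
proof -
  obtain s where s: "x \<in> V" "\<And>n. s n \<in> lin_span a I" "strong_limit ip s x"
    using x unfolding closed_span_def closure_in_def by blast
  have "lincomb (\<lambda>i. ip (a i) z) xs = 0" if "xs \<in> lists (UNIV \<times> I)" for xs
    using that perp by (induction xs) auto
  then have "ip p z = 0" if "p \<in> lin_span a I" for p
    using that ip_lincomb_left[OF a _ z] by (auto simp: lin_span_def)
  moreover have "(\<lambda>n. ip (s n) z) \<longlonglongrightarrow> ip x z"
    using s z lin_span_subset[OF a] by (intro tendsto_ip_left) auto
  ultimately show ?thesis using s(2) by (simp add: LIMSEQ_const_iff)
qed

lemma closed_span_eqI:
  assumes a: "\<forall>i\<in>I. a i \<in> V" and v: "v \<in> closed_span V ip a I" and w: "w \<in> closed_span V ip a I"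
    and eq: "\<And>i. i \<in> I \<Longrightarrow> ip (a i) v = ip (a i) w"
  shows "v = w"
proof -
  have diff: "v - w \<in> closed_span V ip a I"
    using csubspace_diff[OF csubspace_closed_span[OF a] v w] .
  have V: "v \<in> V" "w \<in> V" using v w closed_span_subset by blast+
  have "ip (v - w) (v - w) = 0"
  proof (rule ip_closed_span_eq_0[OF a diff])
    show "ip (a i) (v - w) = 0" if "i \<in> I" for i
      using a that V eq[OF that] by (auto simp: ip_diff_right)
  qed (use V in simp)
  then show ?thesis using ip_self_eq_0[of "v - w"] V by simp
qed

lemma lincomb_eq_if_dominated:
  fixes \<phi> :: "'i \<Rightarrow> complex"
  assumes bound: "\<And>xs. xs \<in> lists (UNIV \<times> I) \<Longrightarrow> cmod (lincomb \<phi> xs) \<le> K * nrm (lincomb a xs)"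
    and xs: "xs \<in> lists (UNIV \<times> I)" and ys: "ys \<in> lists (UNIV \<times> I)"
    and eq: "lincomb a xs = lincomb a ys"
  shows "lincomb \<phi> xs = lincomb \<phi> ys"
  using bound[of "xs @ scale_coeffs (-1) ys"] xs scale_coeffs_in_lists[OF ys, of "-1"] eq
  by (simp add: lincomb_append lincomb_scale_coeffs scaleC_minus_one)

lemma riesz_closed_span:
  fixes \<phi> :: "'i \<Rightarrow> complex"
  assumes a: "\<forall>i\<in>I. a i \<in> V" and K: "0 \<le> K"
    and bound: "\<And>xs. xs \<in> lists (UNIV \<times> I) \<Longrightarrow> cmod (lincomb \<phi> xs) \<le> K * nrm (lincomb a xs)"
  obtains z where "z \<in> closed_span V ip a I" "\<And>i. i \<in> I \<Longrightarrow> ip (a i) z = \<phi> i" "nrm z \<le> K"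
proof -
  let ?L = "lists (UNIV \<times> I)"
  define f where "f p = lincomb \<phi> (inv_into ?L (lincomb a) p)" for p
  have f: "f (lincomb a xs) = lincomb \<phi> xs" if "xs \<in> ?L" for xs
  proof -
    have "lincomb a xs \<in> lincomb a ` ?L" using that by (rule imageI)
    from inv_into_into[OF this] f_inv_into_f[OF this] show ?thesis
      unfolding f_def using that lincomb_eq_if_dominated[of I \<phi> K a] bound by blast
  qed
  interpret subspace_functional V ip "lin_span a I" f K
  proof
    fix x y assume "x \<in> lin_span a I" "y \<in> lin_span a I"
    then obtain xs ys where xy: "x = lincomb a xs" "y = lincomb a ys" "xs \<in> ?L" "ys \<in> ?L"
      by (auto simp: lin_span_def)
    then have "f (lincomb a (xs @ ys)) = f x + f y"
      using f[of "xs @ ys"] by (simp add: f lincomb_append)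
    then show "f (x + y) = f x + f y" using xy by (simp add: lincomb_append)
  next
    fix x c assume "x \<in> lin_span a I"
    then obtain xs where x: "x = lincomb a xs" "xs \<in> ?L" by (auto simp: lin_span_def)
    then have "f (lincomb a (scale_coeffs c xs)) = c * f x"
      using f[OF scale_coeffs_in_lists] by (simp add: f lincomb_scale_coeffs scaleC_complex_def)
    then show "f (c *\<^sub>C x) = c * f x" using x by (simp add: lincomb_scale_coeffs)
    show "cmod (f x) \<le> K * nrm x" using x by (simp add: f bound)
  qed (use a K in \<open>auto intro!: csubspace_lin_span lin_span_subset\<close>)
  obtain z where z: "z \<in> closed_span V ip a I" "\<And>p. p \<in> lin_span a I \<Longrightarrow> ip p z = f p" "nrm z \<le> K"
    using riesz_representation unfolding closed_span_def by blast
  have "ip (a i) z = \<phi> i" if "i \<in> I" for i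
    using z(2)[OF generator_in_lin_span[OF that]] f[of "[(1, i)]"] that by (simp add: scaleC_one)
  with z(1,3) show thesis using that by blast
qed

lemma mem_closed_span_if_perp_perp:
  fixes a :: "'i \<Rightarrow> 'a"
  assumes a: "\<forall>i\<in>I. a i \<in> V" and v: "v \<in> V"
    and perp: "\<And>e. e \<in> V \<Longrightarrow> \<forall>i\<in>I. ip (a i) e = 0 \<Longrightarrow> ip v e = 0"
  shows "v \<in> closed_span V ip a I"
proof -
  obtain p where p: "p \<in> closed_span V ip a I" "\<And>i. i \<in> I \<Longrightarrow> ip (a i) p = ip (a i) v"
  proof (rule riesz_closed_span[OF a, of "nrm v" "\<lambda>i. ip (a i) v"])
    fix xs :: "(complex \<times> 'i) list" assume xs: "xs \<in> lists (UNIV \<times> I)"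
    show "cmod (lincomb (\<lambda>i. ip (a i) v) xs) \<le> nrm v * nrm (lincomb a xs)"
      using cauchy_schwarz[OF lincomb_mem[OF a xs] v]
      by (simp add: ip_lincomb_left[OF a xs v] mult.commute)
  qed (use v in auto)
  define e where "e = v - p"
  have pV: "p \<in> V" using p(1) closed_span_subset by blast
  then have e: "e \<in> V" using v by (simp add: e_def)
  have ae: "ip (a i) e = 0" if "i \<in> I" for i
    using p(2)[OF that] a that v pV by (auto simp: e_def ip_diff_right)
  have "ip e e = ip v e - ip p e" using v pV e by (simp add: e_def ip_diff_left)
  also have "\<dots> = 0" using perp[OF e] ae ip_closed_span_eq_0[OF a p(1) e ae] by simp
  finally have "e = 0" using ip_self_eq_0 e by blast
  then show ?thesis using p(1) by (simp add: e_def)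
qed

end

lemma lincomb_gram_eq:
  assumes "hilbert H ipH" "hilbert K ipK" and f: "\<forall>i\<in>I. f i \<in> H" and g: "\<forall>i\<in>I. g i \<in> K"
    and gram: "\<And>i k. i \<in> I \<Longrightarrow> k \<in> I \<Longrightarrow> ipH (f i) (f k) = ipK (g i) (g k)"
    and xs: "xs \<in> lists (UNIV \<times> I)"
  shows "hnorm ipH (lincomb f xs) = hnorm ipK (lincomb g xs)"
proof -
  interpret H: hilbert H ipH by fact
  interpret K: hilbert K ipK by fact
  have left: "ipH (lincomb f xs) (f k) = ipK (lincomb g xs) (g k)" if "k \<in> I" for k
    using xs
  proof (induction xs)
    case (Cons x xs)
    then show ?case
      using that f g gram H.lincomb_mem[OF f] K.lincomb_mem[OF g]
      by (cases x) (auto simp: H.ip_add_left K.ip_add_left H.ip_scale_left K.ip_scale_left)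
  qed (use that f g in simp)
  have "ipH (lincomb f xs) (lincomb f ys) = ipK (lincomb g xs) (lincomb g ys)"
    if "ys \<in> lists (UNIV \<times> I)" for ys
    using that
  proof (induction ys)
    case (Cons y ys)
    then show ?case
      using left f g H.lincomb_mem[OF f] K.lincomb_mem[OF g] xs
      by (cases y) (auto simp: H.ip_add_right K.ip_add_right H.ip_scale_right K.ip_scale_right)
  qed (use xs H.lincomb_mem[OF f] K.lincomb_mem[OF g] in auto)
  then show ?thesis using xs by (simp add: hnorm_def)
qed

section \<open>Bounded operators and adjoints\<close>

lemma bounded_opI:
  assumes "\<And>x. x \<in> V \<Longrightarrow> T x \<in> W" "\<And>x y. x \<in> V \<Longrightarrow> y \<in> V \<Longrightarrow> T (x + y) = T x + T y"
    and "\<And>c x. x \<in> V \<Longrightarrow> T (c *\<^sub>C x) = c *\<^sub>C T x"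
    and "\<And>x. x \<in> V \<Longrightarrow> hnorm ipW (T x) \<le> K * hnorm ipV x"
  shows "bounded_op V ipV W ipW T"
  unfolding bounded_op_def using assms by blast

locale bounded_operator = V: hilbert V ipV + W: hilbert W ipW
  for V :: "'a::cvector set" and ipV and W :: "'b::cvector set" and ipW +
  fixes T :: "'a \<Rightarrow> 'b"
  assumes bounded: "bounded_op V ipV W ipW T"
begin

lemma mem [simp]: "x \<in> V \<Longrightarrow> T x \<in> W"
  and add: "x \<in> V \<Longrightarrow> y \<in> V \<Longrightarrow> T (x + y) = T x + T y"
  and scale: "x \<in> V \<Longrightarrow> T (c *\<^sub>C x) = c *\<^sub>C T x"
  using bounded by (simp_all add: bounded_op_def)

lemma bound:
  obtains K where "0 \<le> K" "\<And>x. x \<in> V \<Longrightarrow> W.nrm (T x) \<le> K * V.nrm x"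
proof -
  obtain K where K: "\<And>x. x \<in> V \<Longrightarrow> W.nrm (T x) \<le> K * V.nrm x"
    using bounded unfolding bounded_op_def by metis
  have "W.nrm (T x) \<le> max K 0 * V.nrm x" if "x \<in> V" for x
    using K[OF that] mult_right_mono[of K "max K 0" "V.nrm x"] that by simp
  then show thesis using that[of "max K 0"] by simp
qed

lemma zero [simp]: "T 0 = 0"
  using scale[of 0 0] by simp

lemma uminus: "x \<in> V \<Longrightarrow> T (- x) = - T x"
  using scale[of x "-1"] by (simp add: scaleC_minus_one)

lemma diff: "x \<in> V \<Longrightarrow> y \<in> V \<Longrightarrow> T (x - y) = T x - T y"
  using add[of x "-y"] by (simp add: uminus)

lemma sum: "(\<And>i. i \<in> I \<Longrightarrow> f i \<in> V) \<Longrightarrow> T (\<Sum>i\<in>I. f i) = (\<Sum>i\<in>I. T (f i))"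
  by (induction I rule: infinite_finite_induct) (auto simp: add V.sum_mem)

abbreviation adj :: "'b \<Rightarrow> 'a" where "adj \<equiv> hadj V ipV W ipW T"

lemma adj_exists:
  assumes y: "y \<in> W"
  shows "\<exists>z\<in>V. \<forall>x\<in>V. ipW (T x) y = ipV x z"
proof -
  obtain K where K: "0 \<le> K" "\<And>x. x \<in> V \<Longrightarrow> W.nrm (T x) \<le> K * V.nrm x"
    using bound by blast
  interpret subspace_functional V ipV V "\<lambda>x. ipW (T x) y" "K * W.nrm y"
  proof
    fix x assume x: "x \<in> V"
    have "cmod (ipW (T x) y) \<le> W.nrm (T x) * W.nrm y"
      using x y by (intro W.cauchy_schwarz) auto
    also have "\<dots> \<le> K * V.nrm x * W.nrm y"
      using K(2)[OF x] y by (intro mult_right_mono) auto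
    finally show "cmod (ipW (T x) y) \<le> K * W.nrm y * V.nrm x"
      by (simp add: mult_ac)
    show "ipW (T (c *\<^sub>C x)) y = c * ipW (T x) y" for c
      using x y by (simp add: scale W.ip_scale_left)
    show "ipW (T (x + x')) y = ipW (T x) y + ipW (T x') y" if "x' \<in> V" for x'
      using x that y by (simp add: add W.ip_add_left)
  qed (use K y in \<open>auto simp: V.csubspace\<close>)
  obtain z where z: "z \<in> closure_in V ipV V" "\<And>x. x \<in> V \<Longrightarrow> ipV x z = ipW (T x) y"
    using riesz_representation by metis
  have "z \<in> V" using z(1) by (simp add: closure_in_def)
  with z(2) show ?thesis by metis
qed

lemma adj_mem [simp]: "y \<in> W \<Longrightarrow> adj y \<in> V"
  and ip_adj_right: "x \<in> V \<Longrightarrow> y \<in> W \<Longrightarrow> ipV x (adj y) = ipW (T x) y"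
proof -
  have "\<exists>T'. (\<forall>y\<in>W. T' y \<in> V) \<and> (\<forall>x\<in>V. \<forall>y\<in>W. ipW (T x) y = ipV x (T' y))"
    using adj_exists by metis
  from someI_ex[OF this] show "y \<in> W \<Longrightarrow> adj y \<in> V"
    "x \<in> V \<Longrightarrow> y \<in> W \<Longrightarrow> ipV x (adj y) = ipW (T x) y"
    unfolding hadj_def by auto
qed

lemma ip_adj_left: "x \<in> V \<Longrightarrow> y \<in> W \<Longrightarrow> ipV (adj y) x = ipW y (T x)"
  using ip_adj_right[of x y] V.ip_sym[of x "adj y"] W.ip_sym[of "T x" y] by simp

lemma adj_eqI: "y \<in> W \<Longrightarrow> z \<in> V \<Longrightarrow> (\<And>x. x \<in> V \<Longrightarrow> ipW (T x) y = ipV x z) \<Longrightarrow> adj y = z"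
  by (rule V.eq_if_ip_left_eq) (auto simp: ip_adj_right)

lemma adj_nrm_le:
  assumes "0 \<le> K" "\<And>x. x \<in> V \<Longrightarrow> W.nrm (T x) \<le> K * V.nrm x" "y \<in> W"
  shows "V.nrm (adj y) \<le> K * W.nrm y"
proof -
  have "(V.nrm (adj y))\<^sup>2 = Re (ipW (T (adj y)) y)"
    using assms by (simp add: V.nrm_sq ip_adj_right)
  also have "\<dots> \<le> W.nrm (T (adj y)) * W.nrm y"
    using assms by (intro W.re_cauchy_schwarz) auto
  also have "\<dots> \<le> K * V.nrm (adj y) * W.nrm y"
    using assms by (intro mult_right_mono) auto
  finally have "V.nrm (adj y) * V.nrm (adj y) \<le> V.nrm (adj y) * (K * W.nrm y)"
    by (simp add: power2_eq_square mult_ac)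
  moreover have "0 \<le> K * W.nrm y" "0 \<le> V.nrm (adj y)" using assms by simp_all
  ultimately show ?thesis by (cases "V.nrm (adj y) = 0") auto
qed

lemma bounded_operator_adj: "bounded_operator W ipW V ipV adj"
proof
  obtain K where K: "0 \<le> K" "\<And>x. x \<in> V \<Longrightarrow> W.nrm (T x) \<le> K * V.nrm x"
    using bound by blast
  show "bounded_op W ipW V ipV adj"
  proof (rule bounded_opI)
    show "adj (x + y) = adj x + adj y" if "x \<in> W" "y \<in> W" for x y
      using that by (intro adj_eqI) (auto simp: V.ip_add_right W.ip_add_right ip_adj_right)
    show "adj (c *\<^sub>C x) = c *\<^sub>C adj x" if "x \<in> W" for x c
      using that by (intro adj_eqI) (auto simp: V.ip_scale_right W.ip_scale_right ip_adj_right)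
    show "V.nrm (adj y) \<le> K * W.nrm y" if "y \<in> W" for y using adj_nrm_le[OF K that] .
  qed auto
qed

lemma isometric_imp_ip_preserving:
  assumes P: "csubspace P" "P \<subseteq> V" and iso: "\<And>x. x \<in> P \<Longrightarrow> W.nrm (T x) = V.nrm x"
    and xy: "x \<in> P" "y \<in> P"
  shows "ipW (T x) (T y) = ipV x y"
proof -
  have V: "x \<in> V" "y \<in> V" using P(2) xy by auto
  have "W.nrm (T x + c *\<^sub>C T y) = V.nrm (x + c *\<^sub>C y)" for c
    using iso[of "x + c *\<^sub>C y"] xy P(1) V by (simp add: add scale csubspace_add csubspace_scaleC)
  then show ?thesis using V by (simp add: W.polarization V.polarization)
qed

lemma adj_comp_self_eq_id_iff:
  "(\<forall>x\<in>V. adj (T x) = x) \<longleftrightarrow> (\<forall>x\<in>V. W.nrm (T x) = V.nrm x)"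
proof (intro iffI ballI)
  fix x assume adj: "\<forall>x\<in>V. adj (T x) = x" and x: "x \<in> V"
  then have "ipW (T x) (T x) = ipV x x" using ip_adj_right[of x "T x"] by simp
  then show "W.nrm (T x) = V.nrm x" by (simp add: hnorm_def)
next
  fix x assume "\<forall>x\<in>V. W.nrm (T x) = V.nrm x" and x: "x \<in> V"
  then show "adj (T x) = x"
    using isometric_imp_ip_preserving[OF V.csubspace] by (intro adj_eqI) auto
qed

definition partial_isometry :: bool where
  "partial_isometry \<longleftrightarrow>
     (\<forall>x\<in>V. (\<forall>k\<in>V. T k = 0 \<longrightarrow> ipV x k = 0) \<longrightarrow> W.nrm (T x) = V.nrm x)"

lemma partial_isometry_iff:
  assumes contr: "\<And>x. x \<in> V \<Longrightarrow> W.nrm (T x) \<le> V.nrm x"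
  shows "partial_isometry \<longleftrightarrow> (\<forall>y\<in>W. adj (T (adj y)) = adj y)"
proof (intro iffI ballI)
  fix y assume pi: partial_isometry and y: "y \<in> W"
  define x where "x = adj y"
  have x: "x \<in> V" using y by (simp add: x_def)
  have eq: "W.nrm (T x) = V.nrm x"
    using pi x y by (simp add: partial_isometry_def x_def ip_adj_left)
  have "(V.nrm (adj (T x) - x))\<^sup>2 = (V.nrm (adj (T x)))\<^sup>2 - 2 * (W.nrm (T x))\<^sup>2 + (V.nrm x)\<^sup>2"
    using x by (simp add: V.nrm_diff_sq ip_adj_left W.nrm_sq)
  also have "(V.nrm (adj (T x)))\<^sup>2 \<le> (W.nrm (T x))\<^sup>2"
    using adj_nrm_le[of 1 "T x"] contr x by (intro power_mono) auto
  finally have "(V.nrm (adj (T x) - x))\<^sup>2 \<le> 0" by (simp add: eq)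
  then have "V.nrm (adj (T x) - x) = 0" by simp
  then show "adj (T (adj y)) = adj y"
    using V.nrm_eq_0[of "adj (T x) - x"] x by (simp add: x_def)
next
  assume adj: "\<forall>y\<in>W. adj (T (adj y)) = adj y"
  show partial_isometry
    unfolding partial_isometry_def
  proof (intro ballI impI)
    fix x assume x: "x \<in> V" and perp: "\<forall>k\<in>V. T k = 0 \<longrightarrow> ipV x k = 0"
    have TT: "T (adj (T x)) = T x"
    proof (rule W.eq_if_ip_right_eq)
      fix y assume y: "y \<in> W"
      have "ipW (T (adj (T x))) y = ipV x (adj (T (adj y)))"
        using x y by (simp add: ip_adj_right[symmetric] ip_adj_left)
      then show "ipW (T (adj (T x))) y = ipW (T x) y" using adj x y by (simp add: ip_adj_right)
    qed (use x in auto)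
    define k where "k = x - adj (T x)"
    have k: "k \<in> V" "T k = 0" using x TT by (auto simp: k_def diff)
    have "ipV k k = ipV x k - ipV (adj (T x)) k" using x k by (simp add: k_def V.ip_diff_left)
    also have "\<dots> = 0" using perp k x by (simp add: ip_adj_left)
    finally have "x = adj (T x)" using V.ip_self_eq_0[OF k(1)] by (simp add: k_def)
    then have "ipV x x = ipW (T x) (T x)" using ip_adj_right[of x "T x"] x by simp
    then show "W.nrm (T x) = V.nrm x" by (simp add: hnorm_def)
  qed
qed

end

lemma bounded_operatorI:
  "hilbert_space V ipV \<Longrightarrow> hilbert_space W ipW \<Longrightarrow> bounded_op V ipV W ipW T \<Longrightarrow>
    bounded_operator V ipV W ipW T"
  by (simp add: bounded_operator_def bounded_operator_axioms_def hilbert_def)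

lemma gram_eq_transfer:
  assumes "hilbert H ipH" "hilbert K ipK" and f: "\<forall>i\<in>I. f i \<in> H" and g: "\<forall>i\<in>I. g i \<in> K"
    and gram: "\<And>i k. i \<in> I \<Longrightarrow> k \<in> I \<Longrightarrow> ipH (f i) (f k) = ipK (g i) (g k)"
    and v: "v \<in> K"
  shows "\<exists>w\<in>closed_span H ipH f I. (\<forall>i\<in>I. ipH (f i) w = ipK (g i) v) \<and>
    hnorm ipH w \<le> hnorm ipK v"
proof -
  interpret H: hilbert H ipH by fact
  interpret K: hilbert K ipK by fact
  show ?thesis
  proof (rule H.riesz_closed_span[OF f, of "K.nrm v" "\<lambda>i. ipK (g i) v"])
    fix xs assume xs: "xs \<in> lists ((UNIV::complex set) \<times> I)"
    have "cmod (lincomb (\<lambda>i. ipK (g i) v) xs) \<le> K.nrm (lincomb g xs) * K.nrm v"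
      using K.cauchy_schwarz[OF K.lincomb_mem[OF g xs] v]
      by (simp add: K.ip_lincomb_left[OF g xs v])
    also have "K.nrm (lincomb g xs) = H.nrm (lincomb f xs)"
      by (rule lincomb_gram_eq[OF assms(1,2) f g gram xs, symmetric])
    finally show "cmod (lincomb (\<lambda>i. ipK (g i) v) xs) \<le> K.nrm v * H.nrm (lincomb f xs)"
      by (simp add: mult.commute)
  qed (use v in auto)
qed

lemma lurking_isometry:
  assumes "hilbert H ipH" "hilbert K ipK" and f: "\<forall>i\<in>I. f i \<in> H" and g: "\<forall>i\<in>I. g i \<in> K"
    and gram: "\<And>i k. i \<in> I \<Longrightarrow> k \<in> I \<Longrightarrow> ipH (f i) (f k) = ipK (g i) (g k)"
  obtains T where "bounded_operator K ipK H ipH T" "\<And>v. v \<in> K \<Longrightarrow> hnorm ipH (T v) \<le> hnorm ipK v"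
    "\<And>v. v \<in> K \<Longrightarrow> T v \<in> closed_span H ipH f I"
    "\<And>i v. i \<in> I \<Longrightarrow> v \<in> K \<Longrightarrow> ipH (f i) (T v) = ipK (g i) v"
    "\<And>w. w \<in> closed_span H ipH f I \<Longrightarrow> T (hadj K ipK H ipH T w) = w"
proof -
  interpret H: hilbert H ipH by fact
  interpret K: hilbert K ipK by fact
  let ?M = "closed_span H ipH f I"
  obtain T where T: "\<And>v. v \<in> K \<Longrightarrow> T v \<in> ?M" "\<And>v. v \<in> K \<Longrightarrow> H.nrm (T v) \<le> K.nrm v"
    and ip_T: "\<And>i v. i \<in> I \<Longrightarrow> v \<in> K \<Longrightarrow> ipH (f i) (T v) = ipK (g i) v"
    using gram_eq_transfer[OF assms] by metis
  have T_mem: "T v \<in> H" if "v \<in> K" for v using T(1)[OF that] H.closed_span_subset by blast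
  note M = H.csubspace_closed_span[OF f]
  interpret T: bounded_operator K ipK H ipH T
  proof (unfold_locales, rule bounded_opI)
    show "T (u + v) = T u + T v" if "u \<in> K" "v \<in> K" for u v
      using that f g T(1) T_mem
      by (intro H.closed_span_eqI[OF f])
        (auto simp: ip_T csubspace_add[OF M] H.ip_add_right K.ip_add_right)
    show "T (c *\<^sub>C v) = c *\<^sub>C T v" if "v \<in> K" for c v
      using that f g T(1) T_mem
      by (intro H.closed_span_eqI[OF f])
        (auto simp: ip_T csubspace_scaleC[OF M] H.ip_scale_right K.ip_scale_right)
    show "H.nrm (T v) \<le> 1 * K.nrm v" if "v \<in> K" for v using T(2)[OF that] by simp
  qed (rule T_mem)
  have T_g: "T (g i) = f i" if "i \<in> I" for i
    using that g T(1) H.generator_in_closed_span[OF f]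
    by (intro H.closed_span_eqI[OF f]) (auto simp: ip_T gram)
  have "T (T.adj w) = w" if w: "w \<in> ?M" for w
  proof (rule H.closed_span_eqI[OF f _ w])
    have wH: "w \<in> H" using w H.closed_span_subset by blast
    then show "T (T.adj w) \<in> ?M" by (simp add: T(1))
    show "ipH (f i) (T (T.adj w)) = ipH (f i) w" if "i \<in> I" for i
      using that wH g by (simp add: ip_T T.ip_adj_right T_g)
  qed
  with T.bounded_operator_axioms T ip_T show thesis using that by blast
qed

locale strict_contraction = bounded_operator V ip V ip T
  for V :: "'a::cvector set" and ip and T +
  fixes r :: real
  assumes r: "0 \<le> r" "r < 1" and nrm_le: "x \<in> V \<Longrightarrow> V.nrm (T x) \<le> r * V.nrm x"
begin

definition picard :: "'a \<Rightarrow> nat \<Rightarrow> 'a" where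
  "picard y n = ((\<lambda>x. y + T x) ^^ n) 0"

lemma picard_0: "picard y 0 = 0"
  and picard_Suc: "picard y (Suc n) = y + T (picard y n)"
  by (auto simp: picard_def)

lemma picard_mem: "y \<in> V \<Longrightarrow> picard y n \<in> V"
  by (induction n) (auto simp: picard_0 picard_Suc)

lemma picard_nrm_le:
  assumes y: "y \<in> V"
  shows "V.nrm (picard y n) \<le> V.nrm y / (1 - r)"
proof (induction n)
  case (Suc n)
  have "V.nrm (picard y (Suc n)) \<le> V.nrm y + V.nrm (T (picard y n))"
    unfolding picard_Suc using y picard_mem by (intro V.nrm_triangle) auto
  also have "\<dots> \<le> V.nrm y + r * (V.nrm y / (1 - r))"
    using nrm_le[OF picard_mem[OF y, of n]] mult_left_mono[OF Suc r(1)] by linarith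
  also have "\<dots> = V.nrm y / (1 - r)" using r by (simp add: field_simps)
  finally show ?case .
qed (use y r in \<open>simp add: picard_0\<close>)

lemma picard_diff_nrm_le:
  assumes y: "y \<in> V"
  shows "V.nrm (picard y (n + k) - picard y n) \<le> r ^ n * (V.nrm y / (1 - r))"
proof (induction n)
  case (Suc n)
  have "picard y (Suc n + k) - picard y (Suc n) = T (picard y (n + k) - picard y n)"
    using picard_mem[OF y] by (simp add: picard_Suc diff)
  then have "V.nrm (picard y (Suc n + k) - picard y (Suc n)) \<le>
      r * V.nrm (picard y (n + k) - picard y n)"
    using nrm_le[of "picard y (n + k) - picard y n"] picard_mem[OF y] by simp
  also have "\<dots> \<le> r * (r ^ n * (V.nrm y / (1 - r)))" using Suc r by (intro mult_left_mono)
  finally show ?case by (simp add: mult.assoc)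
qed (use picard_nrm_le[OF y] in \<open>simp add: picard_0\<close>)

lemma fixed_point_exists:
  assumes y: "y \<in> V"
  shows "\<exists>x\<in>V. x - T x = y"
proof -
  let ?s = "picard y"
  have s_mem: "?s n \<in> V" for n by (rule picard_mem[OF y])
  have "(\<lambda>n. r ^ n * (V.nrm y / (1 - r))) \<longlonglongrightarrow> 0"
    using r by (intro tendsto_mult_left_zero LIMSEQ_realpow_zero)
  then obtain l where l: "l \<in> V" "strong_limit ip ?s l"
    using V.strong_limit_if_dominated[of ?s] s_mem picard_diff_nrm_le[OF y] by blast
  have "strong_limit ip (\<lambda>n. ?s (Suc n)) (y + T l)"
    unfolding strong_limit_def
  proof (rule Lim_null_comparison)
    show "\<forall>\<^sub>F n in sequentially. norm (V.nrm (?s (Suc n) - (y + T l))) \<le> r * V.nrm (?s n - l)"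
      using nrm_le[of "?s _ - l"] s_mem l y
      by (intro always_eventually) (simp add: picard_Suc diff[symmetric])
    show "(\<lambda>n. r * V.nrm (?s n - l)) \<longlonglongrightarrow> 0"
      using l(2) unfolding strong_limit_def by (rule tendsto_mult_right_zero)
  qed
  moreover have "strong_limit ip (\<lambda>n. ?s (Suc n)) l"
    using l(2) unfolding strong_limit_def by (rule LIMSEQ_Suc)
  ultimately have "l = y + T l"
    using V.strong_limit_unique[of "\<lambda>n. ?s (Suc n)" l "y + T l"] s_mem l y by simp
  then show ?thesis using l(1) by (intro bexI[of _ l]) (auto simp: diff_eq_eq)
qed

lemma fixed_point_unique:
  assumes "x \<in> V" "x' \<in> V" "x - T x = x' - T x'"
  shows "x = x'"
proof -
  have "x - x' = T (x - x')" using assms by (simp add: diff algebra_simps)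
  then have "V.nrm (x - x') \<le> r * V.nrm (x - x')" using nrm_le[of "x - x'"] assms by simp
  then have "(1 - r) * V.nrm (x - x') \<le> 0" by (simp add: algebra_simps)
  then have "V.nrm (x - x') = 0"
    using r assms by (intro order_antisym) (auto simp: mult_le_0_iff)
  then show ?thesis using V.nrm_eq_0[of "x - x'"] assms by simp
qed

lemma inv_I_minus_mem: "y \<in> V \<Longrightarrow> inv_I_minus V T y \<in> V"
  and inv_I_minus_right: "y \<in> V \<Longrightarrow> inv_I_minus V T y - T (inv_I_minus V T y) = y"
proof -
  obtain R where R: "\<And>y. y \<in> V \<Longrightarrow> R y \<in> V" "\<And>y. y \<in> V \<Longrightarrow> R y - T (R y) = y"
    using fixed_point_exists by metis
  have "\<forall>x\<in>V. R x \<in> V \<and> R x - T (R x) = x \<and> R (x - T x) = x"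
    using R fixed_point_unique[OF R(1) _ R(2)] by auto
  then have "\<exists>R. \<forall>x\<in>V. R x \<in> V \<and> R x - T (R x) = x \<and> R (x - T x) = x" by blast
  from someI_ex[OF this] show "y \<in> V \<Longrightarrow> inv_I_minus V T y \<in> V"
    "y \<in> V \<Longrightarrow> inv_I_minus V T y - T (inv_I_minus V T y) = y"
    unfolding inv_I_minus_def by blast+
qed

end

section \<open>Direct sums and block operators\<close>

definition ltwo :: "'y::cvector set \<Rightarrow> ('y \<Rightarrow> 'y \<Rightarrow> complex) \<Rightarrow> ('i \<Rightarrow> 'y) set" where
  "ltwo Y ip = {g. (\<forall>i. g i \<in> Y) \<and> (\<lambda>i. (hnorm ip (g i))\<^sup>2) summable_on UNIV}"

definition ltwo_ip :: "('y::cvector \<Rightarrow> 'y \<Rightarrow> complex) \<Rightarrow> ('i \<Rightarrow> 'y) \<Rightarrow> ('i \<Rightarrow> 'y) \<Rightarrow> complex" where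
  "ltwo_ip ip g h = (\<Sum>\<^sub>\<infinity>i. ip (g i) (h i))"

context hilbert
begin

lemma ltwo_coord: "g \<in> ltwo V ip \<Longrightarrow> g i \<in> V"
  and ltwo_summable: "g \<in> ltwo V ip \<Longrightarrow> (\<lambda>i. (nrm (g i))\<^sup>2) summable_on UNIV"
  by (auto simp: ltwo_def)

lemma ltwo_add:
  assumes g: "g \<in> ltwo V ip" and h: "h \<in> ltwo V ip"
  shows "g + h \<in> ltwo V ip"
proof -
  have "(\<lambda>i. (nrm (g i + h i))\<^sup>2) summable_on UNIV"
  proof (rule summable_on_comparison_test)
    show "(\<lambda>i. 2 * (nrm (g i))\<^sup>2 + 2 * (nrm (h i))\<^sup>2) summable_on UNIV"
      using g h by (intro summable_on_add summable_on_cmult_right ltwo_summable)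
    show "(nrm (g i + h i))\<^sup>2 \<le> 2 * (nrm (g i))\<^sup>2 + 2 * (nrm (h i))\<^sup>2" for i
      using parallelogram[of "g i" "h i"] ltwo_coord[OF g, of i] ltwo_coord[OF h, of i]
        zero_le_power2[of "nrm (g i - h i)"] by linarith
  qed simp
  then show ?thesis using g h by (auto simp: ltwo_def)
qed

lemma csubspace_ltwo: "csubspace (ltwo V ip :: ('i \<Rightarrow> 'a) set)"
  unfolding csubspace_def
proof (intro conjI ballI allI)
  show "c *\<^sub>C g \<in> ltwo V ip" if "g \<in> ltwo V ip" for c and g :: "'i \<Rightarrow> 'a"
    using that by (auto simp: ltwo_def nrm_scale power_mult_distrib intro!: summable_on_cmult_right)
qed (auto simp: ltwo_add, simp add: ltwo_def)

lemmas ltwo_diff = csubspace_diff[OF csubspace_ltwo]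

lemma ltwo_ip_summable:
  assumes g: "g \<in> ltwo V ip" and h: "h \<in> ltwo V ip"
  shows "(\<lambda>i. ip (g i) (h i)) summable_on UNIV"
proof (rule abs_summable_summable, rule summable_on_comparison_test)
  show "(\<lambda>i. (nrm (g i))\<^sup>2 + (nrm (h i))\<^sup>2) summable_on UNIV"
    using g h by (intro summable_on_add ltwo_summable)
  show "cmod (ip (g i) (h i)) \<le> (nrm (g i))\<^sup>2 + (nrm (h i))\<^sup>2" for i
  proof -
    have "cmod (ip (g i) (h i)) \<le> nrm (g i) * nrm (h i)" "0 \<le> nrm (g i) * nrm (h i)"
      using g h by (simp_all add: cauchy_schwarz ltwo_coord)
    then show ?thesis using sum_squares_bound[of "nrm (g i)" "nrm (h i)"] by linarith
  qed
qed simp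

lemma ltwo_ip_self:
  assumes g: "g \<in> ltwo V ip"
  shows "ltwo_ip ip g g = of_real (\<Sum>\<^sub>\<infinity>i. (nrm (g i))\<^sup>2)"
proof -
  have "((\<lambda>i. complex_of_real ((nrm (g i))\<^sup>2)) has_sum of_real (\<Sum>\<^sub>\<infinity>i. (nrm (g i))\<^sup>2)) UNIV"
    by (intro has_sum_of_real has_sum_infsum ltwo_summable g)
  then show ?thesis
    unfolding ltwo_ip_def using ltwo_coord[OF g] by (simp add: ip_self infsumI)
qed

lemma ltwo_nrm_sq: "g \<in> ltwo V ip \<Longrightarrow> (hnorm (ltwo_ip ip) g)\<^sup>2 = (\<Sum>\<^sub>\<infinity>i. (nrm (g i))\<^sup>2)"
  and ltwo_nrm_nonneg: "g \<in> ltwo V ip \<Longrightarrow> 0 \<le> hnorm (ltwo_ip ip) g"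
  by (simp_all add: hnorm_def[of "ltwo_ip ip"] ltwo_ip_self infsum_nonneg)

lemma ltwo_if_finite_sums_le:
  assumes "\<And>i. g i \<in> V" "\<And>F. finite F \<Longrightarrow> (\<Sum>i\<in>F. (nrm (g i))\<^sup>2) \<le> b"
  shows "g \<in> ltwo V ip" "(hnorm (ltwo_ip ip) g)\<^sup>2 \<le> b"
proof -
  have "(\<lambda>i. (nrm (g i))\<^sup>2) summable_on UNIV"
    using assms(2) by (intro nonneg_bdd_above_summable_on) (auto intro!: bdd_aboveI2)
  then show g: "g \<in> ltwo V ip" using assms(1) by (simp add: ltwo_def)
  show "(hnorm (ltwo_ip ip) g)\<^sup>2 \<le> b"
    unfolding ltwo_nrm_sq[OF g] using assms(2) by (intro infsum_le_finite_sums ltwo_summable g)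
qed

lemma ltwo_finite_sum_le:
  assumes "g \<in> ltwo V ip" "finite F"
  shows "(\<Sum>i\<in>F. (nrm (g i))\<^sup>2) \<le> (hnorm (ltwo_ip ip) g)\<^sup>2"
  unfolding ltwo_nrm_sq[OF assms(1)] using assms by (intro finite_sum_le_infsum ltwo_summable) auto

lemma ltwo_coord_le:
  assumes "g \<in> ltwo V ip"
  shows "nrm (g i) \<le> hnorm (ltwo_ip ip) g"
  using ltwo_finite_sum_le[OF assms, of "{i}"] ltwo_nrm_nonneg[OF assms]
  by (auto intro: power2_le_imp_le)

lemma ltwo_coordinatewise_limit:
  assumes s: "\<And>n. s n \<in> ltwo V ip" and l: "\<And>i. l i \<in> V" "\<And>i. strong_limit ip (\<lambda>n. s n i) (l i)"
    and bound: "\<And>n. n \<ge> N \<Longrightarrow> hnorm (ltwo_ip ip) (s n) \<le> b" and b: "0 \<le> b"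
  shows "l \<in> ltwo V ip" "hnorm (ltwo_ip ip) l \<le> b"
proof -
  have "(\<Sum>i\<in>F. (nrm (l i))\<^sup>2) \<le> b\<^sup>2" if F: "finite F" for F
  proof (rule LIMSEQ_le_const2)
    show "(\<lambda>n. \<Sum>i\<in>F. (nrm (s n i))\<^sup>2) \<longlonglongrightarrow> (\<Sum>i\<in>F. (nrm (l i))\<^sup>2)"
      using s l by (intro tendsto_intros tendsto_nrm) (auto simp: ltwo_coord)
    have "(\<Sum>i\<in>F. (nrm (s n i))\<^sup>2) \<le> b\<^sup>2" if "n \<ge> N" for n
      using ltwo_finite_sum_le[OF s F, of n]
        power_mono[OF bound[OF that] ltwo_nrm_nonneg[OF s], of 2]
      by linarith
    then show "\<exists>N. \<forall>n\<ge>N. (\<Sum>i\<in>F. (nrm (s n i))\<^sup>2) \<le> b\<^sup>2" by blast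
  qed
  note le = ltwo_if_finite_sums_le[OF l(1) this]
  show "l \<in> ltwo V ip" by (rule le(1))
  show "hnorm (ltwo_ip ip) l \<le> b" using le(2) b by (rule power2_le_imp_le)
qed

lemma ltwo_cauchy_coord_limit:
  assumes s: "\<And>n. s n \<in> ltwo V ip" and cauchy: "cauchy_in (ltwo_ip ip) s"
  shows "\<exists>l\<in>V. strong_limit ip (\<lambda>n. s n i) l"
proof -
  have "nrm (s m i - s n i) \<le> hnorm (ltwo_ip ip) (s m - s n)" for m n
    using ltwo_coord_le[OF ltwo_diff[OF s s], of m n i] by simp
  then have "cauchy_in ip (\<lambda>n. s n i)"
    using cauchy unfolding cauchy_in_def by (meson order_le_less_trans)
  then show ?thesis using complete[of "\<lambda>n. s n i"] ltwo_coord[OF s] by metis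
qed

lemma ltwo_complete:
  assumes s: "\<And>n. s n \<in> ltwo V ip" and cauchy: "cauchy_in (ltwo_ip ip) s"
  shows "\<exists>l\<in>ltwo V ip. strong_limit (ltwo_ip ip) s l"
proof -
  have s_mem: "s n i \<in> V" for n i using s by (rule ltwo_coord)
  obtain l where l: "\<And>i. l i \<in> V" "\<And>i. strong_limit ip (\<lambda>n. s n i) (l i)"
    using ltwo_cauchy_coord_limit[OF assms] by metis
  have tail: "\<exists>N. \<forall>n\<ge>N. s n - l \<in> ltwo V ip \<and> hnorm (ltwo_ip ip) (s n - l) < e" if e: "e > 0" for e
  proof -
    obtain N where N: "\<And>m n. m \<ge> N \<Longrightarrow> n \<ge> N \<Longrightarrow> hnorm (ltwo_ip ip) (s m - s n) < e / 2"
      using cauchy e unfolding cauchy_in_def by (meson half_gt_zero)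
    have "s n - l \<in> ltwo V ip" "hnorm (ltwo_ip ip) (s n - l) \<le> e / 2" if n: "n \<ge> N" for n
    proof -
      have "strong_limit ip (\<lambda>m. (s n - s m) i) ((s n - l) i)" for i
        using l(2)[of i] nrm_minus_commute[OF l(1)[of i] s_mem] by (simp add: strong_limit_def)
      then show "s n - l \<in> ltwo V ip" "hnorm (ltwo_ip ip) (s n - l) \<le> e / 2"
        using ltwo_coordinatewise_limit[of "\<lambda>m. s n - s m" "s n - l" N "e / 2"]
          s_mem l(1) ltwo_diff[OF s s] N[OF n] e by (simp_all add: less_imp_le)
    qed
    then show ?thesis using e by (intro exI[of _ N]) force
  qed
  obtain n where "s n - l \<in> ltwo V ip" using tail[of 1] by auto
  then have "l \<in> ltwo V ip" using ltwo_diff[OF s[of n], of "s n - l"] by simp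
  moreover have "strong_limit (ltwo_ip ip) s l"
    unfolding strong_limit_def
  proof (rule LIMSEQ_I)
    fix e :: real assume "0 < e"
    then obtain N where "\<forall>n\<ge>N. s n - l \<in> ltwo V ip \<and> hnorm (ltwo_ip ip) (s n - l) < e"
      using tail by blast
    then have "norm (hnorm (ltwo_ip ip) (s n - l) - 0) < e" if "n \<ge> N" for n
      using that ltwo_nrm_nonneg[of "s n - l"] by auto
    then show "\<exists>N. \<forall>n\<ge>N. norm (hnorm (ltwo_ip ip) (s n - l) - 0) < e" by blast
  qed
  ultimately show ?thesis by blast
qed

lemma hilbert_space_ltwo: "hilbert_space (ltwo V ip :: ('i \<Rightarrow> 'a) set) (ltwo_ip ip)"
proof (rule hilbert_spaceI[OF csubspace_ltwo _ _ _ _ ltwo_complete])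
  fix g h :: "'i \<Rightarrow> 'a" assume g: "g \<in> ltwo V ip" and h: "h \<in> ltwo V ip"
  show "ltwo_ip ip h g = cnj (ltwo_ip ip g h)"
    unfolding ltwo_ip_def infsum_cnj[symmetric]
    using ltwo_coord[OF g] ltwo_coord[OF h] by (intro infsum_cong ip_sym)
  show "ltwo_ip ip (c *\<^sub>C g) h = c * ltwo_ip ip g h" for c
    unfolding ltwo_ip_def infsum_cmult_right[OF ltwo_ip_summable[OF g h], symmetric]
    using ltwo_coord[OF g] ltwo_coord[OF h] by (intro infsum_cong) (simp add: ip_scale_left)
  fix k :: "'i \<Rightarrow> 'a" assume k: "k \<in> ltwo V ip"
  show "ltwo_ip ip (g + h) k = ltwo_ip ip g k + ltwo_ip ip h k"
    unfolding ltwo_ip_def infsum_add[OF ltwo_ip_summable[OF g k] ltwo_ip_summable[OF h k],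
      symmetric]
    using ltwo_coord[OF g] ltwo_coord[OF h] ltwo_coord[OF k]
    by (intro infsum_cong) (simp add: ip_add_left)
next
  fix g :: "'i \<Rightarrow> 'a" assume g: "g \<in> ltwo V ip" "g \<noteq> 0"
  then obtain i where "g i \<noteq> 0" by (auto simp: fun_eq_iff)
  then have "0 < nrm (g i)"
    using ltwo_coord[OF g(1), of i] nrm_eq_0 nrm_nonneg by (metis less_eq_real_def)
  then have "0 < hnorm (ltwo_ip ip) g" using ltwo_coord_le[OF g(1), of i] by linarith
  then show "0 < Re (ltwo_ip ip g g)" by (simp add: hnorm_def[of "ltwo_ip ip"])
qed

lemma ltwo_strong_limit_coord:
  assumes "\<And>n. s n \<in> ltwo V ip" "l \<in> ltwo V ip" "strong_limit (ltwo_ip ip) s l"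
  shows "strong_limit ip (\<lambda>n. s n i) (l i)"
  unfolding strong_limit_def
proof (rule Lim_null_comparison)
  have "norm (nrm (s n i - l i)) \<le> hnorm (ltwo_ip ip) (s n - l)" for n
    using ltwo_coord_le[OF ltwo_diff, of "s n" l i] ltwo_coord[OF ltwo_diff, of "s n" l i]
      assms(1,2)
    by simp
  then show "\<forall>\<^sub>F n in sequentially. norm (nrm (s n i - l i)) \<le> hnorm (ltwo_ip ip) (s n - l)" by simp
  show "(\<lambda>n. hnorm (ltwo_ip ip) (s n - l)) \<longlonglongrightarrow> 0" using assms(3) by (simp add: strong_limit_def)
qed

lemma ltwo_finite_index: "w \<in> ltwo V ip \<longleftrightarrow> (\<forall>j::'d::finite. w j \<in> V)"
  by (simp add: ltwo_def)

lemma hnorm_d_eq_ltwo: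
  assumes "w \<in> ltwo V ip"
  shows "hnorm_d ip w = hnorm (ltwo_ip ip) w"
  using ltwo_nrm_sq[OF assms] ltwo_nrm_nonneg[OF assms]
  by (simp add: hnorm_d_def real_sqrt_unique)

end

lemma ltwo_ip_finite_index: "ltwo_ip ip w v = (\<Sum>j::'d::finite\<in>UNIV. ip (w j) (v j))"
  by (simp add: ltwo_ip_def)

instantiation prod :: (cvector, cvector) cvector
begin
definition scaleC_prod :: "complex \<Rightarrow> 'a \<times> 'b \<Rightarrow> 'a \<times> 'b" where
  "scaleC_prod c p = (c *\<^sub>C fst p, c *\<^sub>C snd p)"
instance
  by standard (auto simp: scaleC_prod_def prod_eq_iff scaleC_add_right scaleC_add_left
      scaleC_scaleC scaleC_one)
end

lemma fst_scaleC [simp]: "fst (c *\<^sub>C p) = c *\<^sub>C fst p"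
  and snd_scaleC [simp]: "snd (c *\<^sub>C p) = c *\<^sub>C snd p"
  by (simp_all add: scaleC_prod_def)

definition prod_ip ::
  "('v \<Rightarrow> 'v \<Rightarrow> complex) \<Rightarrow> ('w \<Rightarrow> 'w \<Rightarrow> complex) \<Rightarrow> 'v \<times> 'w \<Rightarrow> 'v \<times> 'w \<Rightarrow> complex" where
  "prod_ip ipV ipW p q = ipV (fst p) (fst q) + ipW (snd p) (snd q)"

locale hilbert_sum = V: hilbert V ipV + W: hilbert W ipW
  for V :: "'v::cvector set" and ipV and W :: "'w::cvector set" and ipW
begin

lemma csubspace_Times: "csubspace P \<Longrightarrow> csubspace Q \<Longrightarrow> csubspace (P \<times> Q)"
  by (auto simp: csubspace_def mem_Times_iff)

lemma hnorm_prod_ip_sq: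
  "p \<in> V \<times> W \<Longrightarrow> (hnorm (prod_ip ipV ipW) p)\<^sup>2 = (V.nrm (fst p))\<^sup>2 + (W.nrm (snd p))\<^sup>2"
  using V.ip_self_nonneg[of "fst p"] W.ip_self_nonneg[of "snd p"]
  by (auto simp: hnorm_def prod_ip_def)

lemma hnorm_fst_le: "p \<in> V \<times> W \<Longrightarrow> V.nrm (fst p) \<le> hnorm (prod_ip ipV ipW) p"
  and hnorm_snd_le: "p \<in> V \<times> W \<Longrightarrow> W.nrm (snd p) \<le> hnorm (prod_ip ipV ipW) p"
  using V.ip_self_nonneg[of "fst p"] W.ip_self_nonneg[of "snd p"]
  by (auto simp: hnorm_def prod_ip_def)

lemma hilbert_space_Times: "hilbert_space (V \<times> W) (prod_ip ipV ipW)"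
proof (rule hilbert_spaceI)
  fix p q assume "p \<in> V \<times> W" "q \<in> V \<times> W"
  then show "prod_ip ipV ipW q p = cnj (prod_ip ipV ipW p q)"
    using V.ip_sym[of "fst p" "fst q"] W.ip_sym[of "snd p" "snd q"]
    by (simp add: prod_ip_def mem_Times_iff)
next
  fix p assume p: "p \<in> V \<times> W" "p \<noteq> 0"
  then have "0 < Re (ipV (fst p) (fst p)) \<or> 0 < Re (ipW (snd p) (snd p))"
    using V.ip_pos[of "fst p"] W.ip_pos[of "snd p"] by (auto simp: prod_eq_iff)
  then show "0 < Re (prod_ip ipV ipW p p)"
    using p V.ip_self_nonneg[of "fst p"] W.ip_self_nonneg[of "snd p"]
    by (auto simp: prod_ip_def mem_Times_iff)
next
  fix s assume s: "\<And>n::nat. s n \<in> V \<times> W" and cauchy: "cauchy_in (prod_ip ipV ipW) s"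
  have diff: "s m - s n \<in> V \<times> W" for m n using s[of m] s[of n] by (simp add: mem_Times_iff)
  have "cauchy_in ipV (\<lambda>n. fst (s n))"
    using cauchy hnorm_fst_le[OF diff] unfolding cauchy_in_def fst_diff[symmetric]
    by (meson order_le_less_trans)
  then obtain a where a: "a \<in> V" "strong_limit ipV (\<lambda>n. fst (s n)) a"
    using V.complete[of "\<lambda>n. fst (s n)"] s by (metis mem_Times_iff)
  have "cauchy_in ipW (\<lambda>n. snd (s n))"
    using cauchy hnorm_snd_le[OF diff] unfolding cauchy_in_def snd_diff[symmetric]
    by (meson order_le_less_trans)
  then obtain b where b: "b \<in> W" "strong_limit ipW (\<lambda>n. snd (s n)) b"
    using W.complete[of "\<lambda>n. snd (s n)"] s by (metis mem_Times_iff)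
  have "hnorm (prod_ip ipV ipW) (s n - (a, b)) =
      sqrt ((V.nrm (fst (s n) - a))\<^sup>2 + (W.nrm (snd (s n) - b))\<^sup>2)" for n
    using s[of n] a(1) b(1) hnorm_prod_ip_sq[of "s n - (a, b)"]
    by (intro real_sqrt_unique[symmetric])
      (auto simp: mem_Times_iff hnorm_def prod_ip_def V.ip_self_nonneg W.ip_self_nonneg)
  moreover have "(\<lambda>n. sqrt ((V.nrm (fst (s n) - a))\<^sup>2 + (W.nrm (snd (s n) - b))\<^sup>2)) \<longlonglongrightarrow>
      sqrt (0\<^sup>2 + 0\<^sup>2)"
    using a(2) b(2) unfolding strong_limit_def by (intro tendsto_intros)
  ultimately show "\<exists>l\<in>V \<times> W. strong_limit (prod_ip ipV ipW) s l"
    using a(1) b(1) by (intro bexI[of _ "(a, b)"]) (auto simp: strong_limit_def)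
qed (auto simp: prod_ip_def mem_Times_iff csubspace_Times V.csubspace W.csubspace V.ip_add_left
    W.ip_add_left V.ip_scale_left W.ip_scale_left distrib_left)

sublocale hilbert "V \<times> W" "prod_ip ipV ipW"
  by unfold_locales (rule hilbert_space_Times)

end

definition col :: "('d \<Rightarrow> 'v \<Rightarrow> 'x) \<Rightarrow> ('v \<Rightarrow> 'y) \<Rightarrow> 'v \<Rightarrow> ('d \<Rightarrow> 'x) \<times> 'y" where
  "col A C x = ((\<lambda>j. A j x), C x)"

definition row :: "('v \<Rightarrow> 'w::plus) \<Rightarrow> ('v' \<Rightarrow> 'w) \<Rightarrow> 'v \<times> 'v' \<Rightarrow> 'w" where
  "row S T p = S (fst p) + T (snd p)"

locale operator_column = X: hilbert X ipX + V: hilbert V ipV + Y: hilbert Y ipY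
  for V :: "'v::cvector set" and ipV and X :: "'x::cvector set" and ipX
    and Y :: "'y::cvector set" and ipY +
  fixes A :: "'d::finite \<Rightarrow> 'v \<Rightarrow> 'x" and C :: "'v \<Rightarrow> 'y"
  assumes A_bounded: "bounded_op V ipV X ipX (A j)" and C_bounded: "bounded_op V ipV Y ipY C"
begin

abbreviation Xd :: "('d \<Rightarrow> 'x) set" where "Xd \<equiv> ltwo X ipX"
abbreviation ipd :: "('d \<Rightarrow> 'x) \<Rightarrow> ('d \<Rightarrow> 'x) \<Rightarrow> complex" where "ipd \<equiv> ltwo_ip ipX"

sublocale A: bounded_operator V ipV X ipX "A j" for j
  by unfold_locales (rule A_bounded)

sublocale C: bounded_operator V ipV Y ipY C
  by unfold_locales (rule C_bounded)

sublocale Xd: hilbert Xd ipd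
  by unfold_locales (rule X.hilbert_space_ltwo)

sublocale XdY: hilbert_sum Xd ipd Y ipY ..

lemma col_nrm_sq:
  "x \<in> V \<Longrightarrow> (XdY.nrm (col A C x))\<^sup>2 = (\<Sum>j\<in>UNIV. (X.nrm (A j x))\<^sup>2) + (Y.nrm (C x))\<^sup>2"
  by (simp add: XdY.hnorm_prod_ip_sq X.ltwo_finite_index X.ltwo_nrm_sq col_def)

sublocale col: bounded_operator V ipV "Xd \<times> Y" "prod_ip ipd ipY" "col A C"
proof
  have "\<exists>K. 0 \<le> K \<and> (\<forall>x\<in>V. X.nrm (A j x) \<le> K * V.nrm x)" for j
    using A.bound[of j] by metis
  then obtain K where K: "\<And>j. 0 \<le> K j" "\<And>j x. x \<in> V \<Longrightarrow> X.nrm (A j x) \<le> K j * V.nrm x" by metis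
  obtain L where L: "0 \<le> L" "\<And>x. x \<in> V \<Longrightarrow> Y.nrm (C x) \<le> L * V.nrm x"
    using C.bound by blast
  show "bounded_op V ipV (Xd \<times> Y) (prod_ip ipd ipY) (col A C)"
  proof (rule bounded_opI)
    fix x assume x: "x \<in> V"
    show "XdY.nrm (col A C x) \<le> sqrt ((\<Sum>j\<in>UNIV. (K j)\<^sup>2) + L\<^sup>2) * V.nrm x"
    proof (rule power2_le_imp_le)
      have "(XdY.nrm (col A C x))\<^sup>2 \<le> (\<Sum>j\<in>UNIV. (K j * V.nrm x)\<^sup>2) + (L * V.nrm x)\<^sup>2"
        unfolding col_nrm_sq[OF x] using x K L by (intro add_mono sum_mono power_mono) auto
      then show "(XdY.nrm (col A C x))\<^sup>2 \<le> (sqrt ((\<Sum>j\<in>UNIV. (K j)\<^sup>2) + L\<^sup>2) * V.nrm x)\<^sup>2"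
        by (simp add: power_mult_distrib sum_nonneg distrib_right sum_distrib_right)
    qed (use x in \<open>simp add: sum_nonneg\<close>)
  qed (auto simp: col_def X.ltwo_finite_index A.add A.scale C.add C.scale fun_eq_iff prod_eq_iff)
qed

lemma col_adj:
  assumes w: "w \<in> Xd" and y: "y \<in> Y"
  shows "col.adj (w, y) = (\<Sum>j\<in>UNIV. A.adj j (w j)) + C.adj y"
proof (rule col.adj_eqI)
  have sum: "(\<Sum>j\<in>UNIV. A.adj j (w j)) \<in> V"
    using w by (intro V.sum_mem) (simp add: X.ltwo_finite_index)
  then show "(\<Sum>j\<in>UNIV. A.adj j (w j)) + C.adj y \<in> V" using y by simp
  show "prod_ip ipd ipY (col A C x) (w, y) = ipV x ((\<Sum>j\<in>UNIV. A.adj j (w j)) + C.adj y)"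
    if "x \<in> V" for x
    using w y sum that by (simp add: X.ltwo_finite_index prod_ip_def col_def ltwo_ip_finite_index
        V.ip_add_right V.ip_sum_right A.ip_adj_right C.ip_adj_right)
qed (use w y in simp)

end

locale operator_row = S: bounded_operator V ipV W ipW S + T: bounded_operator V' ipV' W ipW T
  for V :: "'v::cvector set" and ipV and V' :: "'v'::cvector set" and ipV'
    and W :: "'w::cvector set" and ipW and S and T
begin

sublocale dom: hilbert_sum V ipV V' ipV' ..

sublocale row: bounded_operator "V \<times> V'" "prod_ip ipV ipV'" W ipW "row S T"
proof
  obtain K where K: "0 \<le> K" "\<And>x. x \<in> V \<Longrightarrow> S.W.nrm (S x) \<le> K * S.V.nrm x"
    using S.bound by blast
  obtain L where L: "0 \<le> L" "\<And>x. x \<in> V' \<Longrightarrow> S.W.nrm (T x) \<le> L * T.V.nrm x"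
    using T.bound by blast
  show "bounded_op (V \<times> V') (prod_ip ipV ipV') W ipW (row S T)"
  proof (rule bounded_opI)
    fix p assume p: "p \<in> V \<times> V'"
    then have mem: "fst p \<in> V" "snd p \<in> V'" by auto
    have "S.W.nrm (row S T p) \<le> S.W.nrm (S (fst p)) + S.W.nrm (T (snd p))"
      unfolding row_def using mem by (intro S.W.nrm_triangle) auto
    also have "\<dots> \<le> K * S.V.nrm (fst p) + L * T.V.nrm (snd p)"
      using K(2)[OF mem(1)] L(2)[OF mem(2)] by (rule add_mono)
    also have "\<dots> \<le> K * dom.nrm p + L * dom.nrm p"
      using K(1) L(1) p by (intro add_mono mult_left_mono dom.hnorm_fst_le dom.hnorm_snd_le)
    finally show "S.W.nrm (row S T p) \<le> (K + L) * dom.nrm p" by (simp add: distrib_right)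
  qed (auto simp: row_def S.add T.add S.scale T.scale scaleC_add_right)
qed

lemma row_adj: "w \<in> W \<Longrightarrow> row.adj w = (S.adj w, T.adj w)"
  by (rule row.adj_eqI)
    (auto simp: row_def prod_ip_def S.W.ip_add_left S.ip_adj_right T.ip_adj_right)

end

section \<open>Words and homogeneous polynomials\<close>

lemma finite_words_eq [simp]: "finite {w::'d::finite list. length w = N}"
  using finite_lists_length_eq[of "UNIV::'d set" N] by simp

lemma finite_words_less [simp]: "finite {w::'d::finite list. length w < N}"
proof -
  have "{w::'d list. length w < N} = (\<Union>n<N. {w. length w = n})" by auto
  then show ?thesis by simp
qed

lemma sum_words_Suc:
  "(\<Sum>w | length (w::'d::finite list) = Suc N. f w) = (\<Sum>j\<in>UNIV. \<Sum>w | length w = N. f (j # w))"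
proof -
  have "(\<Sum>j\<in>UNIV. \<Sum>w | length w = N. f (j # w)) =
      (\<Sum>(j, w)\<in>UNIV \<times> {w. length w = N}. f (j # w))"
    by (simp add: sum.cartesian_product)
  also have "\<dots> = (\<Sum>w | length (w::'d list) = Suc N. f w)"
    by (rule sum.reindex_bij_witness[of _ "\<lambda>w. (hd w, tl w)" "\<lambda>(j, w). j # w"])
      (auto simp: length_Suc_conv)
  finally show ?thesis by simp
qed

lemma sum_words_less_Suc:
  "(\<Sum>w | length (w::'d::finite list) < Suc N. f w) =
    (\<Sum>w | length w < N. f w) + (\<Sum>w | length w = N. f w)"
proof -
  have "{w::'d list. length w < Suc N} = {w. length w < N} \<union> {w. length w = N}" by auto
  then show ?thesis by (simp add: sum.union_disjoint disjoint_iff)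
qed

lemma sum_words_less_Suc_Cons:
  "(\<Sum>w | length (w::'d::finite list) < Suc N. f w) =
    f [] + (\<Sum>j\<in>UNIV. \<Sum>w | length w < N. f (j # w))"
proof (induction N)
  case (Suc N)
  show ?case
    by (subst sum_words_less_Suc, subst Suc, subst sum_words_Suc)
      (simp add: sum_words_less_Suc sum.distrib add.assoc)
qed (simp add: sum_words_less_Suc)

lemma sum_words_less_eq_sum_degrees:
  "(\<Sum>w | length (w::'d::finite list) < N. f w) = (\<Sum>n<N. \<Sum>w | length w = n. f w)"
  by (induction N) (auto simp: sum_words_less_Suc)

lemma filterlim_words_less:
  "filterlim (\<lambda>N. {w::'d::finite list. length w < N}) (finite_subsets_at_top UNIV) sequentially"
  unfolding filterlim_finite_subsets_at_top
proof (intro allI impI)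
  fix F :: "'d list set" assume "finite F \<and> F \<subseteq> UNIV"
  then obtain M where M: "\<And>w. w \<in> F \<Longrightarrow> length w < M"
    using finite_nat_set_iff_bounded[of "length ` F"] by auto
  show "\<forall>\<^sub>F N in sequentially. finite {w::'d list. length w < N} \<and> F \<subseteq> {w. length w < N} \<and>
      {w::'d list. length w < N} \<subseteq> UNIV"
    using eventually_ge_at_top[of M] by eventually_elim (use M in force)
qed

lemma infsum_words_limit:
  assumes "f summable_on UNIV"
  shows "(\<lambda>N. \<Sum>w | length (w::'d::finite list) < N. f w) \<longlonglongrightarrow> infsum f UNIV"
  using filterlim_compose[OF _ filterlim_words_less] has_sum_infsum[OF assms]
  unfolding has_sum_def by blast

lemma finite_sum_le_if_sum_words_le:
  fixes f :: "'d::finite list \<Rightarrow> real"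
  assumes "\<And>w. 0 \<le> f w" "\<And>N. (\<Sum>w | length w < N. f w) \<le> b" "finite F"
  shows "sum f F \<le> b"
proof -
  obtain M where M: "\<And>w. w \<in> F \<Longrightarrow> length w < M"
    using assms(3) finite_nat_set_iff_bounded[of "length ` F"] by auto
  have "sum f F \<le> (\<Sum>w | length w < M. f w)"
    using M assms(1) by (intro sum_mono2) auto
  then show ?thesis using assms(2)[of M] by linarith
qed

definition monomial :: "complex^'d \<Rightarrow> 'd list \<Rightarrow> complex" where
  "monomial z w = (\<Prod>j\<leftarrow>w. z $ j)"

lemma monomial_Nil [simp]: "monomial z [] = 1"
  and monomial_Cons [simp]: "monomial z (j # w) = z $ j * monomial z w"
  by (simp_all add: monomial_def)

lemma monomial_mset_cong: "mset v = mset w \<Longrightarrow> monomial z v = monomial z w"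
  unfolding monomial_def by (metis mset_map prod_mset_prod_list)

lemma sum_monomial_mult_cnj:
  "(\<Sum>w | length w = N. monomial l w * cnj (monomial z w)) = cinner_d l z ^ N"
proof (induction N)
  case (Suc N)
  have "(\<Sum>w | length w = Suc N. monomial l w * cnj (monomial z w)) =
      (\<Sum>j\<in>UNIV. l $ j * cnj (z $ j) * (\<Sum>w | length w = N. monomial l w * cnj (monomial z w)))"
    by (simp add: sum_words_Suc sum_distrib_left mult_ac)
  also have "\<dots> = cinner_d l z * cinner_d l z ^ N"
    unfolding Suc cinner_d_def by (simp add: sum_distrib_right)
  finally show ?case by simp
qed simp

lemma cinner_d_self: "cinner_d l l = of_real ((norm l)\<^sup>2)"
  by (simp add: cinner_d_def norm_vec_def L2_set_def sum_nonneg complex_norm_square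
    del: of_real_power)

lemma ball_d_iff: "l \<in> ball_d \<longleftrightarrow> norm l < 1"
  by (simp add: ball_d_def cinner_d_self abs_square_less_1 del: of_real_power)

lemma zero_in_ball_d [simp]: "0 \<in> ball_d"
  by (simp add: ball_d_iff)

lemma open_ball_d: "open (ball_d :: (complex^'d) set)"
proof -
  have "(ball_d :: (complex^'d) set) = ball 0 1" by (auto simp: ball_d_iff)
  then show ?thesis by (metis open_ball)
qed

lemma norm_cinner_d_le: "cmod (cinner_d l z) \<le> norm l * norm z"
proof -
  have "cmod (cinner_d l z) \<le> (\<Sum>j\<in>UNIV. \<bar>cmod (l $ j)\<bar> * \<bar>cmod (z $ j)\<bar>)"
    unfolding cinner_d_def by (rule order.trans[OF norm_sum]) (simp add: norm_mult)
  also have "\<dots> \<le> norm l * norm z"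
    unfolding norm_vec_def by (rule L2_set_mult_ineq)
  finally show ?thesis .
qed

lemma norm_cinner_d_less_1:
  assumes "l \<in> ball_d" "z \<in> ball_d"
  shows "cmod (cinner_d l z) < 1"
proof -
  have "norm l * norm z < 1"
    using assms mult_strict_mono[of "norm l" 1 "norm z" 1]
    by (cases "norm z = 0") (auto simp: ball_d_iff)
  with norm_cinner_d_le[of l z] show ?thesis by linarith
qed

lemma kd_mult_add_eq_iff:
  assumes "l \<in> ball_d" "z \<in> ball_d"
  shows "kd l z * s + x = kd l z * t \<longleftrightarrow> x + s = cinner_d l z * x + t"
proof -
  have "1 - cinner_d l z \<noteq> 0" using norm_cinner_d_less_1[OF assms] by auto
  then have "kd l z * s + x = kd l z * t \<longleftrightarrow> s + x * (1 - cinner_d l z) = t"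
    by (simp add: kd_def divide_simps)
  then show ?thesis by (auto simp: algebra_simps)
qed

lemma kd_self: "z \<in> ball_d \<Longrightarrow> kd z z = of_real (1 / (1 - (norm z)\<^sup>2))"
  by (simp add: kd_def cinner_d_self)

lemma sum_norm_monomial_sq: "(\<Sum>w | length w = N. (cmod (monomial z w))\<^sup>2) = ((norm z)\<^sup>2) ^ N"
proof -
  have "complex_of_real (\<Sum>w | length w = N. (cmod (monomial z w))\<^sup>2) =
      (\<Sum>w | length w = N. monomial z w * cnj (monomial z w))"
    by (simp only: of_real_sum complex_norm_square)
  also have "\<dots> = of_real (((norm z)\<^sup>2) ^ N)"
    by (simp add: sum_monomial_mult_cnj cinner_d_self)
  finally show ?thesis by (simp only: of_real_eq_iff)
qed

lemma powser_eq_0_imp_coeff_eq_0: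
  fixes a :: "nat \<Rightarrow> complex"
  assumes "\<And>t. cmod t < 1 \<Longrightarrow> (\<lambda>n. a n * t ^ n) sums 0"
  shows "a n = 0"
proof (induction n rule: less_induct)
  case (less n)
  have "(\<lambda>k. a (k + n) * t ^ k) sums 0" if t: "t \<noteq> 0" "norm t < 1" for t
  proof -
    have "(\<lambda>k. a (k + n) * t ^ (k + n)) sums 0"
      using assms[OF t(2)] less by (subst sums_iff_shift) simp
    then have "(\<lambda>k. inverse (t ^ n) * (a (k + n) * t ^ (k + n))) sums (inverse (t ^ n) * 0)"
      by (rule sums_mult)
    then show ?thesis using t by (simp add: power_add field_simps)
  qed
  then have "((\<lambda>_. 0) \<longlongrightarrow> a (0 + n)) (at (0::complex))"
    by (intro powser_limit_0_strong[of 1 "\<lambda>k. a (k + n)"]) auto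
  then show ?case by (metis LIM_const_eq add_0)
qed

definition symmetric :: "('d list \<Rightarrow> 'a) \<Rightarrow> bool" where
  "symmetric c \<longleftrightarrow> (\<forall>v w. mset v = mset w \<longrightarrow> c v = c w)"

lemma symmetric_Cons: "symmetric c \<Longrightarrow> symmetric (\<lambda>w. c (j # w))"
  by (auto simp: symmetric_def)

lemma symmetric_swap: "symmetric c \<Longrightarrow> c (j # k # w) = c (k # j # w)"
  by (auto simp: symmetric_def add_mset_commute)

definition homogeneous_poly :: "nat \<Rightarrow> ('d::finite list \<Rightarrow> complex) \<Rightarrow> complex^'d \<Rightarrow> complex" where
  "homogeneous_poly N c z = (\<Sum>w | length w = N. monomial z w * c w)"

lemma homogeneous_poly_0 [simp]: "homogeneous_poly 0 c z = c []"
  by (simp add: homogeneous_poly_def)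

lemma homogeneous_poly_Suc:
  "homogeneous_poly (Suc N) c z = (\<Sum>j\<in>UNIV. z $ j * homogeneous_poly N (\<lambda>w. c (j # w)) z)"
  by (simp add: homogeneous_poly_def sum_words_Suc sum_distrib_left mult.assoc)

lemma sum_words_less_eq_sum_homogeneous_poly:
  "(\<Sum>w | length w < N. monomial z w * c w) = (\<Sum>n<N. homogeneous_poly n c z)"
  by (simp add: sum_words_less_eq_sum_degrees homogeneous_poly_def)

lemma homogeneous_poly_scale:
  "homogeneous_poly N c (t *s z) = t ^ N * homogeneous_poly N c z"
proof -
  have "monomial (t *s z) w = t ^ length w * monomial z w" for w
    by (induction w) auto
  then show ?thesis by (simp add: homogeneous_poly_def sum_distrib_left mult.assoc)
qed

lemma homogeneous_poly_partial_derivative: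
  assumes "symmetric c"
  shows "((\<lambda>t. homogeneous_poly N c (z + axis k t)) has_field_derivative
      of_nat N * homogeneous_poly (N - 1) (\<lambda>w. c (k # w)) (z + axis k t)) (at t)"
  using assms
proof (induction N arbitrary: c)
  case (Suc N)
  let ?z = "\<lambda>t. z + axis k t"
  let ?P = "\<lambda>j. homogeneous_poly N (\<lambda>w. c (j # w))"
  let ?Q = "\<lambda>j. homogeneous_poly (N - 1) (\<lambda>w. c (k # j # w))"
  let ?d = "\<lambda>j. if j = k then 1 else 0 :: complex"
  have coord: "((\<lambda>t. ?z t $ j) has_field_derivative ?d j) (at t)" for j
    by (auto simp: axis_def intro!: derivative_eq_intros)
  have IH: "((\<lambda>t. ?P j (?z t)) has_field_derivative of_nat N * ?Q j (?z t)) (at t)" for j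
    using Suc.IH[OF symmetric_Cons[OF Suc.prems], of j] symmetric_swap[OF Suc.prems, of j k] by simp
  have "((\<lambda>t. homogeneous_poly (Suc N) c (?z t)) has_field_derivative
      (\<Sum>j\<in>UNIV. ?d j * ?P j (?z t) + of_nat N * ?Q j (?z t) * ?z t $ j)) (at t)"
    unfolding homogeneous_poly_Suc by (intro DERIV_sum DERIV_mult coord IH)
  also have "(\<Sum>j\<in>UNIV. ?d j * ?P j (?z t) + of_nat N * ?Q j (?z t) * ?z t $ j) =
      ?P k (?z t) + of_nat N * (\<Sum>j\<in>UNIV. ?z t $ j * ?Q j (?z t))"
    by (simp add: sum.distrib sum_distrib_left if_distrib[of "\<lambda>x. x * _"] mult_ac cong: if_cong)
  also have "\<dots> = of_nat (Suc N) * ?P k (?z t)"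
    by (cases N) (simp_all add: homogeneous_poly_Suc[of _ "\<lambda>w. c (k # w)"] algebra_simps)
  finally show ?case by simp
qed simp

lemma homogeneous_poly_eq_0_imp_coeff_eq_0:
  assumes "symmetric c" "\<And>z. z \<in> ball_d \<Longrightarrow> homogeneous_poly N c z = 0" and "length w = N"
  shows "c w = 0"
  using assms
proof (induction N arbitrary: c w)
  case 0
  then show ?case using "0.prems"(2)[of 0] by simp
next
  case (Suc N)
  then obtain k v where w: "w = k # v" "length v = N" by (auto simp: length_Suc_conv)
  have "homogeneous_poly N (\<lambda>w. c (k # w)) z = 0" if z: "z \<in> ball_d" for z
  proof -
    have z: "z + axis k 0 \<in> ball_d" using z by (simp add: axis_eq_0_iff[THEN iffD2])
    have "((\<lambda>t. z + axis k t) \<longlongrightarrow> z + axis k 0) (nhds 0)"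
    proof (intro vec_tendstoI)
      show "((\<lambda>t. (z + axis k t) $ j) \<longlongrightarrow> (z + axis k 0) $ j) (nhds 0)" for j
        using tendsto_add[OF tendsto_const[of "z $ k"] filterlim_ident[of "nhds 0"]]
        by (cases "j = k") (simp_all add: axis_def)
    qed
    then have "\<forall>\<^sub>F t in nhds 0. z + axis k t \<in> ball_d"
      using open_ball_d z by (rule topological_tendstoD)
    then have zero: "\<forall>\<^sub>F t in nhds 0. homogeneous_poly (Suc N) c (z + axis k t) = 0"
      by eventually_elim (use Suc.prems in simp)
    have "((\<lambda>t. 0) has_field_derivative
        of_nat (Suc N) * homogeneous_poly N (\<lambda>w. c (k # w)) (z + axis k 0)) (at 0)"
      using homogeneous_poly_partial_derivative[OF Suc.prems(1), of "Suc N" z k 0]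
        DERIV_cong_ev[OF refl zero refl] by simp
    then have "of_nat (Suc N) * homogeneous_poly N (\<lambda>w. c (k # w)) (z + axis k 0) = 0"
      using DERIV_unique[OF _ DERIV_const] by blast
    then show ?thesis by (simp add: axis_eq_0_iff[THEN iffD2] del: of_nat_Suc)
  qed
  from Suc.IH[OF symmetric_Cons[OF Suc.prems(1)] this w(2)] w(1) show ?case by simp
qed

section \<open>Column contractions\<close>

locale column_contraction = X: hilbert X ipX
  for X :: "'x::cvector set" and ipX +
  fixes A :: "'d::finite \<Rightarrow> 'x \<Rightarrow> 'x"
  assumes entry_mem: "x \<in> X \<Longrightarrow> A j x \<in> X"
    and entry_add: "x \<in> X \<Longrightarrow> y \<in> X \<Longrightarrow> A j (x + y) = A j x + A j y"
    and entry_scale: "x \<in> X \<Longrightarrow> A j (c *\<^sub>C x) = c *\<^sub>C A j x"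
    and column_contractive: "x \<in> X \<Longrightarrow> (\<Sum>j\<in>UNIV. (X.nrm (A j x))\<^sup>2) \<le> (X.nrm x)\<^sup>2"
begin

lemma entry_nrm_le:
  assumes x: "x \<in> X"
  shows "X.nrm (A j x) \<le> X.nrm x"
proof (rule power2_le_imp_le)
  have "(X.nrm (A j x))\<^sup>2 \<le> (\<Sum>j\<in>UNIV. (X.nrm (A j x))\<^sup>2)"
    by (rule member_le_sum) auto
  then show "(X.nrm (A j x))\<^sup>2 \<le> (X.nrm x)\<^sup>2" using column_contractive[OF x] by linarith
qed (use x in simp)

sublocale A: bounded_operator X ipX X ipX "A j" for j
proof
  show "bounded_op X ipX X ipX (A j)"
    by (rule bounded_opI[where K = 1]) (auto simp: entry_mem entry_add entry_scale entry_nrm_le)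
qed

definition Z :: "complex^'d \<Rightarrow> 'x \<Rightarrow> 'x" where
  "Z l x = (\<Sum>j\<in>UNIV. (l $ j) *\<^sub>C A j x)"

definition Z_adj :: "complex^'d \<Rightarrow> 'x \<Rightarrow> 'x" where
  "Z_adj z x = (\<Sum>j\<in>UNIV. cnj (z $ j) *\<^sub>C A.adj j x)"

definition resolvent :: "complex^'d \<Rightarrow> 'x \<Rightarrow> 'x" where
  "resolvent l = inv_I_minus X (Z l)"

lemma Z_mem [simp]: "x \<in> X \<Longrightarrow> Z l x \<in> X"
  by (auto simp: Z_def intro!: X.sum_mem)

lemma Z_adj_mem [simp]: "x \<in> X \<Longrightarrow> Z_adj z x \<in> X"
  by (auto simp: Z_adj_def intro!: X.sum_mem)

lemma Z_nrm_le:
  assumes x: "x \<in> X"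
  shows "X.nrm (Z l x) \<le> norm l * X.nrm x"
proof -
  have "X.nrm (Z l x) \<le> (\<Sum>j\<in>UNIV. X.nrm ((l $ j) *\<^sub>C A j x))"
    unfolding Z_def using x by (intro X.nrm_sum_le) simp
  also have "\<dots> = (\<Sum>j\<in>UNIV. \<bar>cmod (l $ j)\<bar> * \<bar>X.nrm (A j x)\<bar>)"
    using x by (simp add: X.nrm_scale)
  also have "\<dots> \<le> norm l * L2_set (\<lambda>j. X.nrm (A j x)) UNIV"
    unfolding norm_vec_def by (rule L2_set_mult_ineq)
  also have "L2_set (\<lambda>j. X.nrm (A j x)) UNIV \<le> X.nrm x"
    unfolding L2_set_def using x column_contractive[OF x]
    by (intro real_le_lsqrt) (auto simp: sum_nonneg)
  finally show ?thesis by (simp add: mult_left_mono)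
qed

lemma bounded_operator_Z: "bounded_operator X ipX X ipX (Z l)"
proof (unfold_locales, rule bounded_opI)
  show "Z l (x + y) = Z l x + Z l y" if "x \<in> X" "y \<in> X" for x y
    using that by (simp add: Z_def A.add scaleC_add_right sum.distrib)
  show "Z l (c *\<^sub>C x) = c *\<^sub>C Z l x" if "x \<in> X" for x c
    using that by (simp add: Z_def A.scale scaleC_sum_right scaleC_scaleC mult.commute)
qed (simp, rule Z_nrm_le)

lemma hadj_Z: "x \<in> X \<Longrightarrow> hadj X ipX X ipX (Z z) x = Z_adj z x"
  by (rule bounded_operator.adj_eqI[OF bounded_operator_Z])
    (auto simp: Z_def Z_adj_def X.ip_sum_left X.ip_sum_right X.ip_scale_left X.ip_scale_right
      A.ip_adj_right intro!: X.sum_mem)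

lemma ip_Z_adj_right: "x \<in> X \<Longrightarrow> y \<in> X \<Longrightarrow> ipX x (Z_adj z y) = ipX (Z z x) y"
  using bounded_operator.ip_adj_right[OF bounded_operator_Z] by (simp add: hadj_Z)

lemma strict_contraction_Z: "l \<in> ball_d \<Longrightarrow> strict_contraction X ipX (Z l) (norm l)"
  using bounded_operator_Z Z_nrm_le
  by (auto simp: strict_contraction_def strict_contraction_axioms_def ball_d_iff)

lemma strict_contraction_Z_adj:
  assumes "z \<in> ball_d"
  shows "strict_contraction X ipX (Z_adj z) (norm z)"
proof -
  interpret Z: bounded_operator X ipX X ipX "Z z" by (rule bounded_operator_Z)
  interpret Z_adj: bounded_operator X ipX X ipX Z.adj by (rule Z.bounded_operator_adj)
  have nrm: "X.nrm (Z_adj z x) \<le> norm z * X.nrm x" if "x \<in> X" for x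
    using Z.adj_nrm_le[of "norm z" x] Z_nrm_le[of _ z] hadj_Z[OF that] that by simp
  have "bounded_op X ipX X ipX (Z_adj z)"
  proof (rule bounded_opI)
    fix x y c assume "x \<in> X" "y \<in> X"
    then show "Z_adj z (x + y) = Z_adj z x + Z_adj z y" "Z_adj z (c *\<^sub>C x) = c *\<^sub>C Z_adj z x"
      using Z_adj.add[of x y] Z_adj.scale[of x c] by (simp_all add: hadj_Z)
  qed (simp, rule nrm)
  then show ?thesis
    using nrm assms X.hilbert_space bounded_operatorI
    by (auto simp: strict_contraction_def strict_contraction_axioms_def ball_d_iff)
qed

lemma resolvent_mem [simp]: "l \<in> ball_d \<Longrightarrow> x \<in> X \<Longrightarrow> resolvent l x \<in> X"
  and resolvent_eq: "l \<in> ball_d \<Longrightarrow> x \<in> X \<Longrightarrow> resolvent l x - Z l (resolvent l x) = x"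
  unfolding resolvent_def
  by (simp_all add: strict_contraction.inv_I_minus_mem[OF strict_contraction_Z]
      strict_contraction.inv_I_minus_right[OF strict_contraction_Z])

end

section \<open>The symmetric Fock space\<close>

text \<open>
  A Taylor coefficient is spread evenly over the words with the same letter counts; this turns
  the weighted coefficient norm of \<open>H(k\<^sub>d)\<close> into the unweighted \<open>\<ell>\<^sup>2\<close> norm.
\<close>

definition sym_fock :: "'y::cvector set \<Rightarrow> ('y \<Rightarrow> 'y \<Rightarrow> complex) \<Rightarrow> ('d list \<Rightarrow> 'y) set" where
  "sym_fock Y ip = {g \<in> ltwo Y ip. symmetric g}"

definition kernel_vec :: "complex^'d \<Rightarrow> 'y::cvector \<Rightarrow> 'd list \<Rightarrow> 'y" where
  "kernel_vec z y = (\<lambda>w. cnj (monomial z w) *\<^sub>C y)"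

definition shift :: "'d \<Rightarrow> ('d list \<Rightarrow> 'y) \<Rightarrow> 'd list \<Rightarrow> 'y" where
  "shift j g = (\<lambda>w. g (j # w))"

lemma symmetric_kernel_vec: "symmetric (kernel_vec z y)"
  unfolding symmetric_def kernel_vec_def by (metis monomial_mset_cong)

lemma shift_kernel_vec: "shift j (kernel_vec z y) = cnj (z $ j) *\<^sub>C kernel_vec z y"
  by (simp add: shift_def kernel_vec_def fun_eq_iff scaleC_scaleC)

lemma (in hilbert) hilbert_space_sym_fock:
  "hilbert_space (sym_fock V ip :: ('d list \<Rightarrow> 'a) set) (ltwo_ip ip)"
proof -
  interpret L: hilbert "ltwo V ip :: ('d list \<Rightarrow> 'a) set" "ltwo_ip ip"
    by unfold_locales (rule hilbert_space_ltwo)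
  show ?thesis
  proof (rule L.hilbert_space_closed_subspace)
    show "csubspace (sym_fock V ip :: ('d list \<Rightarrow> 'a) set)"
      unfolding csubspace_def
    proof (intro conjI ballI allI)
      fix f g :: "'d list \<Rightarrow> 'a" and c assume "f \<in> sym_fock V ip" "g \<in> sym_fock V ip"
      then have L: "f \<in> ltwo V ip" "g \<in> ltwo V ip" and S: "symmetric f" "symmetric g"
        by (simp_all add: sym_fock_def)
      have "symmetric (f + g)" using S unfolding symmetric_def plus_fun_def by metis
      moreover have "symmetric (c *\<^sub>C f)" using S unfolding symmetric_def scaleC_fun_def by metis
      ultimately show "f + g \<in> sym_fock V ip" "c *\<^sub>C f \<in> sym_fock V ip"
        using L by (simp_all add: sym_fock_def)
    qed (simp add: sym_fock_def symmetric_def)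
  next
    fix s and l :: "'d list \<Rightarrow> 'a"
    assume s: "\<And>n. s n \<in> sym_fock V ip" and l: "l \<in> ltwo V ip" "strong_limit (ltwo_ip ip) s l"
    have s_ltwo: "s n \<in> ltwo V ip" for n using s by (simp add: sym_fock_def)
    have "l v = l w" if "mset v = mset w" for v w
    proof -
      have "s n v = s n w" for n using s[of n] that unfolding sym_fock_def symmetric_def by blast
      then show ?thesis
        using strong_limit_unique[of "\<lambda>n. s n v" "l v" "l w"]
          ltwo_coord[OF s_ltwo] ltwo_coord[OF l(1)]
          ltwo_strong_limit_coord[OF s_ltwo l, of v] ltwo_strong_limit_coord[OF s_ltwo l, of w]
        by simp
    qed
    then show "l \<in> sym_fock V ip" using l(1) unfolding sym_fock_def symmetric_def by blast
  qed (auto simp: sym_fock_def)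
qed

locale drury_arveson = hilbert V ip for V :: "'a::cvector set" and ip +
  fixes dim :: "'d::finite itself"
begin

abbreviation H :: "('d list \<Rightarrow> 'a) set" where "H \<equiv> sym_fock V ip"
abbreviation ipH :: "('d list \<Rightarrow> 'a) \<Rightarrow> ('d list \<Rightarrow> 'a) \<Rightarrow> complex" where "ipH \<equiv> ltwo_ip ip"

sublocale H: hilbert H ipH
  by unfold_locales (rule hilbert_space_sym_fock)

lemma fock_ltwo: "g \<in> H \<Longrightarrow> g \<in> ltwo V ip"
  and fock_symmetric: "g \<in> H \<Longrightarrow> symmetric g"
  by (simp_all add: sym_fock_def)

lemma fock_coord [simp]: "g \<in> H \<Longrightarrow> g w \<in> V"
  by (rule ltwo_coord[OF fock_ltwo])

lemma mem_fock_if_sum_words_le: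
  assumes "symmetric g" "\<And>w. g w \<in> V" "\<And>N. (\<Sum>w | length w < N. (nrm (g w))\<^sup>2) \<le> b"
  shows "g \<in> H"
proof -
  have "(\<Sum>w\<in>F. (nrm (g w))\<^sup>2) \<le> b" if "finite F" for F
    by (rule finite_sum_le_if_sum_words_le[OF _ assms(3) that]) simp
  then have "g \<in> ltwo V ip" using assms(2) by (rule ltwo_if_finite_sums_le(1)[rotated])
  then show ?thesis using assms(1) by (simp add: sym_fock_def)
qed

lemma fock_nrm_sq_limit:
  "g \<in> H \<Longrightarrow> (\<lambda>N. \<Sum>w | length w < N. (nrm (g w))\<^sup>2) \<longlonglongrightarrow> (H.nrm g)\<^sup>2"
  unfolding ltwo_nrm_sq[OF fock_ltwo] by (intro infsum_words_limit ltwo_summable fock_ltwo)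

lemma kernel_vec_mem [simp]:
  assumes z: "z \<in> ball_d" and y: "y \<in> V"
  shows "kernel_vec z y \<in> H"
proof (rule mem_fock_if_sum_words_le[OF symmetric_kernel_vec])
  define r where "r = (norm z)\<^sup>2"
  have r: "0 \<le> r" "r < 1" using z by (auto simp: r_def ball_d_iff abs_square_less_1)
  fix N
  have "(\<Sum>w | length w < N. (nrm (kernel_vec z y w))\<^sup>2) =
      (\<Sum>w | length w < N. (cmod (monomial z w))\<^sup>2) * (nrm y)\<^sup>2"
    unfolding sum_distrib_right using y by (simp add: kernel_vec_def nrm_scale power_mult_distrib)
  also have "(\<Sum>w | length w < N. (cmod (monomial z w))\<^sup>2) = (\<Sum>n<N. r ^ n)"
    unfolding sum_words_less_eq_sum_degrees by (simp only: sum_norm_monomial_sq r_def)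
  also have "\<dots> \<le> 1 / (1 - r)"
    using r by (simp add: sum_gp_strict divide_right_mono)
  finally show "(\<Sum>w | length w < N. (nrm (kernel_vec z y w))\<^sup>2) \<le> 1 / (1 - r) * (nrm y)\<^sup>2"
    by (simp add: mult_right_mono)
qed (use y in \<open>simp add: kernel_vec_def\<close>)

lemma ip_kernel_vec_limit:
  assumes g: "g \<in> H" and z: "z \<in> ball_d" and y: "y \<in> V"
  shows "(\<lambda>N. \<Sum>w | length w < N. monomial z w * ip (g w) y) \<longlonglongrightarrow> ipH g (kernel_vec z y)"
proof -
  have "(\<lambda>N. \<Sum>w | length w < N. ip (g w) (kernel_vec z y w)) \<longlonglongrightarrow> ipH g (kernel_vec z y)"
    unfolding ltwo_ip_def
    by (rule infsum_words_limit[OF ltwo_ip_summable[OF fock_ltwo[OF g]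
      fock_ltwo[OF kernel_vec_mem[OF z y]]]])
  then show ?thesis using g y by (simp add: kernel_vec_def ip_scale_right)
qed

lemma ip_kernel_vec_kernel_vec:
  assumes z: "z \<in> ball_d" "y \<in> V" and l: "l \<in> ball_d" "x \<in> V"
  shows "ipH (kernel_vec z y) (kernel_vec l x) = kd l z * ip y x"
proof (rule LIMSEQ_unique)
  have "(\<Sum>w | length w < N. monomial l w * ip (kernel_vec z y w) x) =
      (\<Sum>n<N. cinner_d l z ^ n) * ip y x" for N
  proof -
    have "(\<Sum>w | length w < N. monomial l w * ip (kernel_vec z y w) x) =
        (\<Sum>w | length w < N. monomial l w * cnj (monomial z w)) * ip y x"
      unfolding sum_distrib_right using assms by (simp add: kernel_vec_def ip_scale_left mult_ac)
    then show ?thesis unfolding sum_words_less_eq_sum_degrees sum_monomial_mult_cnj .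
  qed
  then show "(\<lambda>N. (\<Sum>n<N. cinner_d l z ^ n) * ip y x) \<longlonglongrightarrow> ipH (kernel_vec z y) (kernel_vec l x)"
    using ip_kernel_vec_limit[of "kernel_vec z y" l x] assms by simp
  show "(\<lambda>N. (\<Sum>n<N. cinner_d l z ^ n) * ip y x) \<longlonglongrightarrow> kd l z * ip y x"
    using geometric_sums[OF norm_cinner_d_less_1[OF l(1) z(1)]]
    by (intro tendsto_mult_right) (simp add: kd_def sums_def)
qed

lemma kernel_vec_nrm:
  assumes "z \<in> ball_d" "y \<in> V"
  shows "H.nrm (kernel_vec z y) = nrm y / sqrt (1 - (norm z)\<^sup>2)"
proof (rule power2_eq_imp_eq)
  have "(norm z)\<^sup>2 \<le> 1" using assms(1) by (auto simp: ball_d_iff abs_square_le_1)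
  then show "(H.nrm (kernel_vec z y))\<^sup>2 = (nrm y / sqrt (1 - (norm z)\<^sup>2))\<^sup>2"
    "0 \<le> nrm y / sqrt (1 - (norm z)\<^sup>2)"
    using assms ip_kernel_vec_kernel_vec[of z y z y]
    by (simp_all add: H.nrm_sq ip_self kd_self power_divide del: of_real_power of_real_divide
        flip: of_real_mult)
qed (use assms in simp)

lemma bounded_operator_kernel_vec:
  assumes z: "z \<in> ball_d"
  shows "bounded_operator V ip H ipH (kernel_vec z)"
proof (unfold_locales, rule bounded_opI)
  show "H.nrm (kernel_vec z y) \<le> 1 / sqrt (1 - (norm z)\<^sup>2) * nrm y" if "y \<in> V" for y
    using kernel_vec_nrm[OF z that] by simp
qed (use z in simp, auto simp: kernel_vec_def fun_eq_iff scaleC_add_right scaleC_scaleC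
  mult.commute)

lemma eq_0_if_ip_kernel_vec_eq_0:
  assumes g: "g \<in> H" and perp: "\<And>z y. z \<in> ball_d \<Longrightarrow> y \<in> V \<Longrightarrow> ipH g (kernel_vec z y) = 0"
  shows "g = 0"
proof
  fix w
  have "ip (g w) y = 0" if y: "y \<in> V" for y
  proof -
    define c where "c w = ip (g w) y" for w
    have sym: "symmetric c"
      using fock_symmetric[OF g] unfolding symmetric_def c_def by metis
    have "homogeneous_poly n c z = 0" if z: "z \<in> ball_d" for z and n
    proof (rule powser_eq_0_imp_coeff_eq_0)
      fix t :: complex assume t: "cmod t < 1"
      have "norm (t *s z) = cmod t * norm z"
        by (simp add: norm_vec_def norm_mult L2_set_right_distrib)
      then have tz: "t *s z \<in> ball_d"
        using z t mult_strict_mono[of "cmod t" 1 "norm z" 1] by (auto simp: ball_d_iff)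
      have "(\<lambda>N. \<Sum>w | length w < N. monomial (t *s z) w * c w) \<longlonglongrightarrow> 0"
        using ip_kernel_vec_limit[OF g tz y] perp[OF tz y] by (simp add: c_def)
      then show "(\<lambda>n. homogeneous_poly n c z * t ^ n) sums 0"
        by (simp add: sums_def sum_words_less_eq_sum_homogeneous_poly homogeneous_poly_scale
            mult.commute[of "homogeneous_poly _ _ _"])
    qed
    then show ?thesis
      using homogeneous_poly_eq_0_imp_coeff_eq_0[OF sym, of "length w" w] by (simp add: c_def)
  qed
  then show "g w = 0 w" using g ip_self_eq_0 by simp
qed

lemma eq_if_ip_kernel_vec_eq:
  assumes "g \<in> H" "h \<in> H"
    and "\<And>z y. z \<in> ball_d \<Longrightarrow> y \<in> V \<Longrightarrow> ipH g (kernel_vec z y) = ipH h (kernel_vec z y)"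
  shows "g = h"
  using eq_0_if_ip_kernel_vec_eq_0[of "g - h"] assms by (simp add: H.ip_diff_left)

lemma shift_mem [simp]:
  assumes g: "g \<in> H"
  shows "shift j g \<in> H"
proof (rule mem_fock_if_sum_words_le)
  show "(\<Sum>w | length w < N. (nrm (shift j g w))\<^sup>2) \<le> (H.nrm g)\<^sup>2" for N
  proof -
    have "(\<Sum>w | length w < N. (nrm (shift j g w))\<^sup>2) =
        (\<Sum>w\<in>(#) j ` {w. length w < N}. (nrm (g w))\<^sup>2)"
      by (subst sum.reindex) (auto simp: shift_def)
    also have "\<dots> \<le> (H.nrm g)\<^sup>2" by (intro ltwo_finite_sum_le fock_ltwo g) simp
    finally show ?thesis .
  qed
qed (use g fock_symmetric[OF g] in \<open>auto simp: shift_def symmetric_Cons\<close>)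

lemma sum_shift_nrm_sq:
  assumes g: "g \<in> H"
  shows "(\<Sum>j\<in>UNIV. (H.nrm (shift j g))\<^sup>2) + (nrm (g []))\<^sup>2 = (H.nrm g)\<^sup>2"
proof (rule LIMSEQ_unique)
  have "(\<lambda>N. (\<Sum>j\<in>UNIV. \<Sum>w | length w < N. (nrm (shift j g w))\<^sup>2) + (nrm (g []))\<^sup>2)
      \<longlonglongrightarrow> (\<Sum>j\<in>UNIV. (H.nrm (shift j g))\<^sup>2) + (nrm (g []))\<^sup>2"
    using g by (intro tendsto_intros fock_nrm_sq_limit shift_mem)
  then show "(\<lambda>N. \<Sum>w | length w < Suc N. (nrm (g w))\<^sup>2)
      \<longlonglongrightarrow> (\<Sum>j\<in>UNIV. (H.nrm (shift j g))\<^sup>2) + (nrm (g []))\<^sup>2"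
    by (simp add: sum_words_less_Suc_Cons shift_def add.commute)
  show "(\<lambda>N. \<Sum>w | length w < Suc N. (nrm (g w))\<^sup>2) \<longlonglongrightarrow> (H.nrm g)\<^sup>2"
    by (rule LIMSEQ_Suc[OF fock_nrm_sq_limit[OF g]])
qed

lemma ip_kernel_vec_shift:
  assumes g: "g \<in> H" and z: "z \<in> ball_d" and y: "y \<in> V"
  shows "ipH g (kernel_vec z y) = ip (g []) y + (\<Sum>j\<in>UNIV. z $ j * ipH (shift j g) (kernel_vec z y))"
proof (rule LIMSEQ_unique)
  show "(\<lambda>N. \<Sum>w | length w < Suc N. monomial z w * ip (g w) y) \<longlonglongrightarrow> ipH g (kernel_vec z y)"
    by (rule LIMSEQ_Suc[OF ip_kernel_vec_limit[OF assms]])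
  have "(\<lambda>N. ip (g []) y + (\<Sum>j\<in>UNIV. z $ j *
      (\<Sum>w | length w < N. monomial z w * ip (shift j g w) y)))
      \<longlonglongrightarrow> ip (g []) y + (\<Sum>j\<in>UNIV. z $ j * ipH (shift j g) (kernel_vec z y))"
    using assms by (intro tendsto_intros ip_kernel_vec_limit shift_mem)
  then show "(\<lambda>N. \<Sum>w | length w < Suc N. monomial z w * ip (g w) y)
      \<longlonglongrightarrow> ip (g []) y + (\<Sum>j\<in>UNIV. z $ j * ipH (shift j g) (kernel_vec z y))"
    by (simp add: sum_words_less_Suc_Cons shift_def sum_distrib_left mult.assoc)
qed

sublocale shift: column_contraction H ipH shift
proof
  show "(\<Sum>j\<in>UNIV. (H.nrm (shift j g))\<^sup>2) \<le> (H.nrm g)\<^sup>2" if "g \<in> H" for g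
    using sum_shift_nrm_sq[OF that] zero_le_power2[of "nrm (g [])"] by linarith
qed (simp, auto simp: shift_def fun_eq_iff)

lemma ip_shift_adj_kernel_vec:
  "g \<in> H \<Longrightarrow> z \<in> ball_d \<Longrightarrow> y \<in> V \<Longrightarrow>
    ipH (shift.A.adj j g) (kernel_vec z y) = z $ j * ipH g (kernel_vec z y)"
  by (simp add: shift.A.ip_adj_left shift_kernel_vec H.ip_scale_right)

end

section \<open>The Drury--Arveson space as a space of functions\<close>

lemma has_derivative_caratheodory:
  fixes f :: "complex^'d::finite \<Rightarrow> complex"
  assumes ev: "\<forall>\<^sub>F x in at l. f x - f l = (\<Sum>j\<in>UNIV. (x $ j - l $ j) * g j x)"
    and lim: "\<And>j. (g j \<longlongrightarrow> g j l) (at l)"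
  shows "(f has_derivative (\<lambda>h. \<Sum>j\<in>UNIV. h $ j * g j l)) (at l)"
  unfolding has_derivative_iff_norm
proof
  show "bounded_linear (\<lambda>h::complex^'d. \<Sum>j\<in>UNIV. h $ j * g j l)"
    by (intro bounded_linear_sum bounded_linear_compose[OF bounded_linear_mult_left]
      bounded_linear_vec_nth)
  show "((\<lambda>x. norm (f x - f l - (\<Sum>j\<in>UNIV. (x - l) $ j * g j l)) / norm (x - l)) \<longlongrightarrow> 0) (at l)"
  proof (rule Lim_null_comparison)
    have "norm (f x - f l - (\<Sum>j\<in>UNIV. (x - l) $ j * g j l)) / norm (x - l) \<le>
        (\<Sum>j\<in>UNIV. norm (g j x - g j l))"
      if x: "f x - f l = (\<Sum>j\<in>UNIV. (x $ j - l $ j) * g j x)" for x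
    proof -
      have "f x - f l - (\<Sum>j\<in>UNIV. (x - l) $ j * g j l) = (\<Sum>j\<in>UNIV. (x - l) $ j * (g j x - g j l))"
        unfolding x by (simp add: sum_subtractf[symmetric] algebra_simps)
      also have "norm \<dots> \<le> (\<Sum>j\<in>UNIV. norm (x - l) * norm (g j x - g j l))"
        by (rule sum_norm_le)
          (simp only: norm_mult mult_right_mono[OF Finite_Cartesian_Product.norm_nth_le]
            norm_ge_zero)
      finally have "norm (f x - f l - (\<Sum>j\<in>UNIV. (x - l) $ j * g j l)) \<le>
          norm (x - l) * (\<Sum>j\<in>UNIV. norm (g j x - g j l))"
        by (simp add: sum_distrib_left)
      then show ?thesis
        by (cases "x = l") (auto simp: divide_le_eq mult.commute sum_nonneg)
    qed
    then show "\<forall>\<^sub>F x in at l. norm (norm (f x - f l - (\<Sum>j\<in>UNIV. (x - l) $ j * g j l)) /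
        norm (x - l))
        \<le> (\<Sum>j\<in>UNIV. norm (g j x - g j l))"
      using ev by (auto elim!: eventually_mono)
    have "((\<lambda>x. \<Sum>j\<in>UNIV. norm (g j x - g j l)) \<longlongrightarrow> (\<Sum>j::'d\<in>UNIV. 0)) (at l)"
      using lim by (intro tendsto_sum tendsto_norm_zero) (simp add: LIM_zero)
    then show "((\<lambda>x. \<Sum>j\<in>UNIV. norm (g j x - g j l)) \<longlongrightarrow> 0) (at l)" by simp
  qed
qed

context drury_arveson
begin

text \<open>With \<open>x = (I - Z(l))\<^sup>-\<^sup>1 g\<close> for the backward shifts,
  \<open>g(m) = x(0) + \<Sum>\<^sub>j (m\<^sub>j - l\<^sub>j) (shift j x)(m)\<close>.\<close>

lemma ip_kernel_vec_diff:
  assumes g: "g \<in> H" and l: "l \<in> ball_d"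
  obtains h where "\<And>j. h j \<in> H"
    "\<And>m y. m \<in> ball_d \<Longrightarrow> y \<in> V \<Longrightarrow>
      ipH g (kernel_vec m y) - ipH g (kernel_vec l y) =
        (\<Sum>j\<in>UNIV. (m $ j - l $ j) * ipH (h j) (kernel_vec m y))"
proof -
  define x where "x = shift.resolvent l g"
  have x: "x \<in> H" using g l by (simp add: x_def)
  have expand: "ipH g (kernel_vec m y) =
      ip (x []) y + (\<Sum>j\<in>UNIV. (m $ j - l $ j) * ipH (shift j x) (kernel_vec m y))"
    if "m \<in> ball_d" "y \<in> V" for m y
  proof -
    have "ipH g (kernel_vec m y) = ipH (x - shift.Z l x) (kernel_vec m y)"
      using shift.resolvent_eq[OF l g] by (simp add: x_def)
    also have "\<dots> = ipH x (kernel_vec m y) - (\<Sum>j\<in>UNIV. l $ j * ipH (shift j x) (kernel_vec m y))"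
      using x that by (simp add: H.ip_diff_left)
        (simp add: shift.Z_def H.ip_sum_left H.ip_scale_left)
    finally show ?thesis
      using ip_kernel_vec_shift[OF x that] by (simp add: sum_subtractf left_diff_distrib)
  qed
  show thesis
  proof (rule that)
    show "shift j x \<in> H" for j using x by simp
    show "ipH g (kernel_vec m y) - ipH g (kernel_vec l y) =
        (\<Sum>j\<in>UNIV. (m $ j - l $ j) * ipH (shift j x) (kernel_vec m y))"
      if "m \<in> ball_d" "y \<in> V" for m y
      using expand[OF that] expand[OF l that(2)] by simp
  qed
qed

lemma eventually_in_ball_d: "l \<in> ball_d \<Longrightarrow> \<forall>\<^sub>F m in at l. m \<in> ball_d"
  using eventually_at_topological open_ball_d by blast

lemma continuous_ip_kernel_vec:
  assumes g: "g \<in> H" and l: "l \<in> ball_d" and y: "y \<in> V"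
  shows "((\<lambda>m. ipH g (kernel_vec m y)) \<longlongrightarrow> ipH g (kernel_vec l y)) (at l)"
proof -
  obtain h where h: "\<And>j. h j \<in> H"
    and diff: "\<And>m y. m \<in> ball_d \<Longrightarrow> y \<in> V \<Longrightarrow> ipH g (kernel_vec m y) - ipH g (kernel_vec l y) =
        (\<Sum>j\<in>UNIV. (m $ j - l $ j) * ipH (h j) (kernel_vec m y))"
    using ip_kernel_vec_diff[OF g l] by blast
  let ?b = "\<lambda>m. \<Sum>j\<in>UNIV. cmod (m $ j - l $ j) * (H.nrm (h j) * (nrm y / sqrt (1 - (norm m)\<^sup>2)))"
  have "((\<lambda>m. ipH g (kernel_vec m y) - ipH g (kernel_vec l y)) \<longlongrightarrow> 0) (at l)"
  proof (rule Lim_null_comparison)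
    show "\<forall>\<^sub>F m in at l. norm (ipH g (kernel_vec m y) - ipH g (kernel_vec l y)) \<le> ?b m"
      using eventually_in_ball_d[OF l]
    proof eventually_elim
      case (elim m)
      have "cmod (ipH (h j) (kernel_vec m y)) \<le> H.nrm (h j) * (nrm y / sqrt (1 - (norm m)\<^sup>2))" for j
        using H.cauchy_schwarz[OF h kernel_vec_mem[OF elim y]] kernel_vec_nrm[OF elim y] by simp
      then show ?case
        unfolding diff[OF elim y] by (intro sum_norm_le)
          (simp only: norm_mult mult_left_mono norm_ge_zero)
    qed
    have "(norm l)\<^sup>2 < 1" using l by (simp add: ball_d_iff abs_square_less_1)
    then have "(?b \<longlongrightarrow> (\<Sum>j\<in>UNIV. cmod (l $ j - l $ j) *
        (H.nrm (h j) * (nrm y / sqrt (1 - (norm l)\<^sup>2))))) (at l)"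
      by (intro tendsto_intros) auto
    then show "(?b \<longlongrightarrow> 0) (at l)" by simp
  qed
  then show ?thesis by (simp add: LIM_zero_iff)
qed

definition fock_fun :: "('d list \<Rightarrow> 'a) \<Rightarrow> complex^'d \<Rightarrow> 'a" where
  "fock_fun g z = (if z \<in> ball_d then hadj V ip H ipH (kernel_vec z) g else 0)"

definition has_coeffs :: "(complex^'d \<Rightarrow> 'a) \<Rightarrow> ('d list \<Rightarrow> 'a) \<Rightarrow> bool" where
  "has_coeffs f g \<longleftrightarrow> g \<in> H \<and> (\<forall>z\<in>ball_d. f z = fock_fun g z)"

definition coeffs :: "(complex^'d \<Rightarrow> 'a) \<Rightarrow> 'd list \<Rightarrow> 'a" where
  "coeffs f = (THE g. has_coeffs f g)"

lemma fock_fun_mem [simp]: "g \<in> H \<Longrightarrow> fock_fun g z \<in> V"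
  by (simp add: fock_fun_def bounded_operator.adj_mem[OF bounded_operator_kernel_vec])

lemma ip_fock_fun:
  "g \<in> H \<Longrightarrow> z \<in> ball_d \<Longrightarrow> y \<in> V \<Longrightarrow> ip (fock_fun g z) y = ipH g (kernel_vec z y)"
  by (simp add: fock_fun_def bounded_operator.ip_adj_left[OF bounded_operator_kernel_vec])

lemma fock_fun_add: "g \<in> H \<Longrightarrow> h \<in> H \<Longrightarrow> fock_fun (g + h) = fock_fun g + fock_fun h"
  and fock_fun_scale: "g \<in> H \<Longrightarrow> fock_fun (c *\<^sub>C g) = c *\<^sub>C fock_fun g"
  using bounded_operator.add
    [OF bounded_operator.bounded_operator_adj[OF bounded_operator_kernel_vec]]
    bounded_operator.scale[OF bounded_operator.bounded_operator_adj[OF bounded_operator_kernel_vec]]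
  by (auto simp: fock_fun_def fun_eq_iff)

lemma has_coeffs_fock_fun: "g \<in> H \<Longrightarrow> has_coeffs (fock_fun g) g"
  by (simp add: has_coeffs_def)

lemma has_coeffsI:
  assumes g: "g \<in> H" and f: "\<And>z. z \<in> ball_d \<Longrightarrow> f z \<in> V"
    and ip: "\<And>z y. z \<in> ball_d \<Longrightarrow> y \<in> V \<Longrightarrow> ip (f z) y = ipH g (kernel_vec z y)"
  shows "has_coeffs f g"
  unfolding has_coeffs_def using g f
  by (auto intro!: eq_if_ip_right_eq simp: ip ip_fock_fun)

lemma has_coeffs_mem [simp]: "has_coeffs f g \<Longrightarrow> g \<in> H"
  and has_coeffs_value: "has_coeffs f g \<Longrightarrow> z \<in> ball_d \<Longrightarrow> f z \<in> V"
  and ip_has_coeffs: "has_coeffs f g \<Longrightarrow> z \<in> ball_d \<Longrightarrow> y \<in> V \<Longrightarrow> ip (f z) y = ipH g (kernel_vec z y)"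
  by (auto simp: has_coeffs_def ip_fock_fun)

lemma has_coeffs_unique: "has_coeffs f g \<Longrightarrow> has_coeffs f h \<Longrightarrow> g = h"
  by (rule eq_if_ip_kernel_vec_eq) (auto simp: ip_has_coeffs[symmetric])

lemma coeffs_eq: "has_coeffs f g \<Longrightarrow> coeffs f = g"
  unfolding coeffs_def using has_coeffs_unique by blast

lemma coeffs_fock_fun: "g \<in> H \<Longrightarrow> coeffs (fock_fun g) = g"
  by (rule coeffs_eq[OF has_coeffs_fock_fun])

lemma has_coeffs_add_scale:
  "has_coeffs f g \<Longrightarrow> has_coeffs f' g' \<Longrightarrow> has_coeffs (\<lambda>z. f z + c *\<^sub>C f' z) (g + c *\<^sub>C g')"
  by (auto simp: has_coeffs_def fock_fun_add fock_fun_scale)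

lemma has_coeffs_const: "u \<in> V \<Longrightarrow> has_coeffs (\<lambda>_. u) (kernel_vec 0 u)"
  by (rule has_coeffsI) (auto simp: ip_kernel_vec_kernel_vec kd_def cinner_d_def)

lemma holomorphic_if_has_coeffs:
  assumes f: "has_coeffs f g" and y: "y \<in> V"
  shows "holomorphic_d (\<lambda>l. ip (f l) y) ball_d"
  unfolding holomorphic_d_def
proof
  fix l :: "complex^'d" assume l: "l \<in> ball_d"
  obtain h where h: "\<And>j. h j \<in> H"
    and diff: "\<And>m y. m \<in> ball_d \<Longrightarrow> y \<in> V \<Longrightarrow> ipH g (kernel_vec m y) - ipH g (kernel_vec l y) =
        (\<Sum>j\<in>UNIV. (m $ j - l $ j) * ipH (h j) (kernel_vec m y))"
    using ip_kernel_vec_diff[OF has_coeffs_mem[OF f] l] by blast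
  let ?L = "\<lambda>v. \<Sum>j\<in>UNIV. v $ j * ipH (h j) (kernel_vec l y)"
  have "((\<lambda>l. ip (f l) y) has_derivative ?L) (at l)"
  proof (rule has_derivative_caratheodory)
    show "\<forall>\<^sub>F m in at l. ip (f m) y - ip (f l) y =
        (\<Sum>j\<in>UNIV. (m $ j - l $ j) * ipH (h j) (kernel_vec m y))"
      using eventually_in_ball_d[OF l]
      by eventually_elim (use diff l y in \<open>simp add: ip_has_coeffs[OF f]\<close>)
  qed (rule continuous_ip_kernel_vec[OF h l y])
  moreover have "\<forall>c v. ?L (\<chi> j. c * v $ j) = c * ?L v"
    by (simp add: sum_distrib_left mult.assoc)
  ultimately show "\<exists>L. ((\<lambda>l. ip (f l) y) has_derivative L) (at l) \<and>
      (\<forall>c v. L (\<chi> j. c * v $ j) = c * L v)"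
    by blast
qed

lemma sum_kernel_vec_mem:
  "\<forall>i<(n::nat). \<zeta> i \<in> ball_d \<and> y i \<in> V \<Longrightarrow> (\<Sum>i<n. kernel_vec (\<zeta> i) (y i)) \<in> H"
  by (intro H.sum_mem) simp

lemma nrm_sum_kernel_vec_sq:
  fixes \<zeta> :: "nat \<Rightarrow> complex^'d"
  assumes mem: "\<forall>i<n. \<zeta> i \<in> ball_d \<and> y i \<in> V"
  shows "(H.nrm (\<Sum>i<n. kernel_vec (\<zeta> i) (y i)))\<^sup>2 =
      Re (\<Sum>i<n. \<Sum>j<n. kd (\<zeta> j) (\<zeta> i) * ip (y i) (y j))"
proof -
  let ?k = "\<lambda>i. kernel_vec (\<zeta> i) (y i)"
  have "ipH (\<Sum>i<n. ?k i) (\<Sum>i<n. ?k i) = (\<Sum>i<n. \<Sum>j<n. ipH (?k i) (?k j))"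
    using sum_kernel_vec_mem[OF mem] mem
    by (subst H.ip_sum_left) (auto intro!: sum.cong H.ip_sum_right)
  also have "\<dots> = (\<Sum>i<n. \<Sum>j<n. kd (\<zeta> j) (\<zeta> i) * ip (y i) (y j))"
    using mem by (intro sum.cong refl ip_kernel_vec_kernel_vec) auto
  finally show ?thesis
    using sum_kernel_vec_mem[OF mem] by (simp add: H.nrm_sq)
qed

lemma rk_bound_if_has_coeffs:
  assumes f: "has_coeffs f g" and M: "(H.nrm g)\<^sup>2 \<le> M"
  shows "rk_bound V ip f M"
  unfolding rk_bound_def
proof (intro allI impI)
  fix n :: nat and \<zeta> :: "nat \<Rightarrow> complex^'d" and y
  assume mem: "\<forall>i<n. \<zeta> i \<in> ball_d \<and> y i \<in> V"
  let ?k = "\<Sum>i<n. kernel_vec (\<zeta> i) (y i)"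
  have "(\<Sum>i<n. ip (f (\<zeta> i)) (y i)) = ipH g ?k"
    using mem f by (subst H.ip_sum_right) (auto intro!: sum.cong simp: ip_has_coeffs)
  then have "(cmod (\<Sum>i<n. ip (f (\<zeta> i)) (y i)))\<^sup>2 \<le> (H.nrm g * H.nrm ?k)\<^sup>2"
    using H.cauchy_schwarz[of g ?k] f sum_kernel_vec_mem[OF mem] by (simp add: power_mono)
  also have "\<dots> \<le> M * (H.nrm ?k)\<^sup>2"
    unfolding power_mult_distrib using M by (intro mult_right_mono) auto
  finally show "(cmod (\<Sum>i<n. ip (f (\<zeta> i)) (y i)))\<^sup>2
      \<le> M * Re (\<Sum>i<n. \<Sum>j<n. kd (\<zeta> j) (\<zeta> i) * ip (y i) (y j))"
    unfolding nrm_sum_kernel_vec_sq[OF mem] .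
qed

lemma rk_bound_lincomb:
  fixes f :: "complex^'d \<Rightarrow> 'a"
  assumes f: "\<And>l. l \<in> ball_d \<Longrightarrow> f l \<in> V" and M: "0 \<le> M" "rk_bound V ip f M"
    and xs: "xs \<in> lists (UNIV \<times> (ball_d \<times> V))"
  shows "cmod (lincomb (\<lambda>(z, y). ip y (f z)) xs) \<le>
      sqrt M * H.nrm (lincomb (\<lambda>(z, y). kernel_vec z y) xs)"
proof (rule power2_le_imp_le)
  define n where "n = length xs"
  define \<zeta> where "\<zeta> i = fst (snd (xs ! i))" for i
  define y where "y i = fst (xs ! i) *\<^sub>C snd (snd (xs ! i))" for i
  have nth: "fst (snd (xs ! i)) \<in> ball_d" "snd (snd (xs ! i)) \<in> V" if "i < n" for i
    using xs that nth_mem[of i xs] by (auto simp: n_def in_lists_conv_set mem_Times_iff)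
  then have mem: "\<forall>i<n. \<zeta> i \<in> ball_d \<and> y i \<in> V" by (simp add: \<zeta>_def y_def)
  have kernel: "lincomb (\<lambda>(z, y). kernel_vec z y) xs = (\<Sum>i<n. kernel_vec (\<zeta> i) (y i))"
    unfolding lincomb_nth n_def[symmetric]
    using nth by (intro sum.cong) (auto simp: case_prod_beta \<zeta>_def y_def
        bounded_operator.scale[OF bounded_operator_kernel_vec])
  have "lincomb (\<lambda>(z, y). ip y (f z)) xs = (\<Sum>i<n. ip (y i) (f (\<zeta> i)))"
    unfolding lincomb_nth n_def[symmetric]
    using nth f by (intro sum.cong)
      (auto simp: case_prod_beta \<zeta>_def y_def ip_scale_left scaleC_complex_def)
  also have "\<dots> = cnj (\<Sum>i<n. ip (f (\<zeta> i)) (y i))"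
    unfolding cnj_sum using mem f by (intro sum.cong ip_sym) auto
  finally have "cmod (lincomb (\<lambda>(z, y). ip y (f z)) xs) = cmod (\<Sum>i<n. ip (f (\<zeta> i)) (y i))"
    by (simp only: complex_mod_cnj)
  then show "(cmod (lincomb (\<lambda>(z, y). ip y (f z)) xs))\<^sup>2
      \<le> (sqrt M * H.nrm (lincomb (\<lambda>(z, y). kernel_vec z y) xs))\<^sup>2"
    using M mem unfolding rk_bound_def kernel power_mult_distrib nrm_sum_kernel_vec_sq[OF mem]
    by simp
  show "0 \<le> sqrt M * H.nrm (lincomb (\<lambda>(z, y). kernel_vec z y) xs)"
    unfolding kernel using M(1) sum_kernel_vec_mem[OF mem] by simp
qed

lemma rk_bound_imp_has_coeffs:
  assumes f: "\<And>l. l \<in> ball_d \<Longrightarrow> f l \<in> V" and M: "0 \<le> M" "rk_bound V ip f M"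
  obtains g where "has_coeffs f g" "(H.nrm g)\<^sup>2 \<le> M"
proof -
  let ?I = "(ball_d :: (complex^'d) set) \<times> V"
  have "\<forall>i\<in>?I. (\<lambda>(z, y). kernel_vec z y) i \<in> H" by auto
  note riesz = H.riesz_closed_span[OF this _ rk_bound_lincomb[OF f M]]
  obtain g where g: "g \<in> closed_span H ipH (\<lambda>(z, y). kernel_vec z y) ?I"
    and ip: "\<And>i. i \<in> ?I \<Longrightarrow> ipH ((\<lambda>(z, y). kernel_vec z y) i) g = (\<lambda>(z, y). ip y (f z)) i"
    and nrm: "H.nrm g \<le> sqrt M"
    by (rule riesz) (use M(1) in simp_all)
  have gH: "g \<in> H" using g H.closed_span_subset by blast
  have "has_coeffs f g"
  proof (rule has_coeffsI[OF gH f])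
    fix z :: "complex^'d" and y assume "z \<in> ball_d" "y \<in> V"
    then show "ip (f z) y = ipH g (kernel_vec z y)"
      using ip[of "(z, y)"] H.ip_sym[of "kernel_vec z y" g] gH ip_sym[of y "f z"] f by simp
  qed
  moreover have "(H.nrm g)\<^sup>2 \<le> M"
    using power_mono[OF nrm, of 2] gH M(1) by simp
  ultimately show thesis using that by blast
qed

lemma rk_bound_iff:
  assumes f: "has_coeffs f g" and M: "0 \<le> M"
  shows "rk_bound V ip f M \<longleftrightarrow> (H.nrm g)\<^sup>2 \<le> M"
proof
  assume "rk_bound V ip f M"
  then obtain h where "has_coeffs f h" "(H.nrm h)\<^sup>2 \<le> M"
    using rk_bound_imp_has_coeffs[of f M] has_coeffs_value[OF f] M by blast
  then show "(H.nrm g)\<^sup>2 \<le> M" using has_coeffs_unique[OF f] by blast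
qed (rule rk_bound_if_has_coeffs[OF f])

lemma rk_bound_max_0:
  fixes f :: "complex^'d \<Rightarrow> 'a"
  assumes "rk_bound V ip f M"
  shows "rk_bound V ip f (max M 0)"
  unfolding rk_bound_def
proof (intro allI impI)
  fix n :: nat and \<zeta> :: "nat \<Rightarrow> complex^'d" and y
  assume mem: "\<forall>i<n. \<zeta> i \<in> ball_d \<and> y i \<in> V"
  let ?G = "Re (\<Sum>i<n. \<Sum>j<n. kd (\<zeta> j) (\<zeta> i) * ip (y i) (y j))"
  have "0 \<le> ?G" unfolding nrm_sum_kernel_vec_sq[OF mem, symmetric] by simp
  then have "M * ?G \<le> max M 0 * ?G" by (intro mult_right_mono) auto
  then show "(cmod (\<Sum>i<n. ip (f (\<zeta> i)) (y i)))\<^sup>2 \<le> max M 0 * ?G"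
    using assms mem unfolding rk_bound_def by (meson order_trans)
qed

lemma in_Hkd_iff: "in_Hkd V ip f \<longleftrightarrow> (\<exists>g. has_coeffs f g)"
proof
  assume f: "in_Hkd V ip f"
  then obtain M where "rk_bound V ip f M" by (auto simp: in_Hkd_def)
  then have "rk_bound V ip f (max M 0)" by (rule rk_bound_max_0)
  moreover have "f l \<in> V" if "l \<in> ball_d" for l using f that by (simp add: in_Hkd_def)
  ultimately show "\<exists>g. has_coeffs f g"
    using rk_bound_imp_has_coeffs[of f "max M 0"] by (metis max.cobounded2)
next
  assume "\<exists>g. has_coeffs f g"
  then show "in_Hkd V ip f"
    using rk_bound_if_has_coeffs has_coeffs_value unfolding in_Hkd_def by blast
qed

lemma Hkd_norm_eq:
  assumes f: "has_coeffs f g"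
  shows "Hkd_norm V ip f = H.nrm g"
proof -
  have "0 \<le> M" if "(H.nrm g)\<^sup>2 \<le> M" for M
    using that by (rule order_trans[OF zero_le_power2])
  then have "{M. 0 \<le> M \<and> rk_bound V ip f M} = {(H.nrm g)\<^sup>2..}"
    using rk_bound_iff[OF f] by auto
  then show ?thesis using f by (simp add: Hkd_norm_def)
qed

lemma Hkd_inner_eq:
  assumes f: "has_coeffs f g" and f': "has_coeffs f' g'"
  shows "Hkd_inner V ip f f' = ipH g g'"
  using H.polarization[of g g'] f f' Hkd_norm_eq[OF has_coeffs_add_scale[OF f f']]
  by (simp add: Hkd_inner_def)

end

section \<open>Multiplication operators\<close>

locale multiplier = U: drury_arveson U ipU "TYPE('d::finite)" + Y: drury_arveson Y ipY "TYPE('d)"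
  for U :: "'u::cvector set" and ipU and Y :: "'y::cvector set" and ipY +
  fixes S :: "complex^'d::finite \<Rightarrow> 'u \<Rightarrow> 'y"
  assumes S_bounded: "l \<in> ball_d \<Longrightarrow> bounded_op U ipU Y ipY (S l)"
begin

abbreviation S_adj :: "complex^'d \<Rightarrow> 'y \<Rightarrow> 'u" where "S_adj l \<equiv> hadj U ipU Y ipY (S l)"

lemma bounded_operator_S: "l \<in> ball_d \<Longrightarrow> bounded_operator U ipU Y ipY (S l)"
  using U.hilbert_space Y.hilbert_space S_bounded by (intro bounded_operatorI)

lemmas S_mem [simp] = bounded_operator.mem[OF bounded_operator_S]
  and S_adj_mem [simp] = bounded_operator.adj_mem[OF bounded_operator_S]
  and ip_S_adj_right = bounded_operator.ip_adj_right[OF bounded_operator_S]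

lemma has_coeffs_mult_op_iff:
  assumes f: "U.has_coeffs f g" and h: "h \<in> Y.H"
  shows "Y.has_coeffs (mult_op S f) h \<longleftrightarrow>
    (\<forall>z\<in>ball_d. \<forall>y\<in>Y. Y.ipH h (kernel_vec z y) = U.ipH g (kernel_vec z (S_adj z y)))"
proof -
  have ip: "ipY (mult_op S f z) y = U.ipH g (kernel_vec z (S_adj z y))"
    if "z \<in> ball_d" "y \<in> Y" for z y
    using that f U.has_coeffs_value[OF f]
    by (simp add: mult_op_def ip_S_adj_right[symmetric] U.ip_has_coeffs[OF f])
  have "mult_op S f z \<in> Y" if "z \<in> ball_d" for z
    using that U.has_coeffs_value[OF f] by (simp add: mult_op_def)
  then show ?thesis
    using Y.has_coeffsI[OF h, of "mult_op S f"] Y.ip_has_coeffs[of "mult_op S f" h] ip by auto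
qed

end

locale contractive_multiplier = multiplier U ipU Y ipY S
  for U :: "'u::cvector set" and ipU and Y :: "'y::cvector set" and ipY
    and S :: "complex^'d::finite \<Rightarrow> 'u \<Rightarrow> 'y" +
  assumes S_contractive: "in_Hkd U ipU f \<Longrightarrow>
    in_Hkd Y ipY (mult_op S f) \<and> Hkd_norm Y ipY (mult_op S f) \<le> Hkd_norm U ipU f"
begin

definition mult :: "('d list \<Rightarrow> 'u) \<Rightarrow> 'd list \<Rightarrow> 'y" where
  "mult g = Y.coeffs (mult_op S (U.fock_fun g))"

lemma has_coeffs_mult:
  assumes f: "U.has_coeffs f g"
  shows "Y.has_coeffs (mult_op S f) (mult g)"
proof -
  have "in_Hkd U ipU (U.fock_fun g)"
    using f U.has_coeffs_fock_fun U.in_Hkd_iff by (metis U.has_coeffs_mem)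
  then obtain h where h: "Y.has_coeffs (mult_op S (U.fock_fun g)) h"
    using S_contractive Y.in_Hkd_iff by blast
  then have "mult g = h" unfolding mult_def by (rule Y.coeffs_eq)
  then show ?thesis
    using h f by (auto simp: Y.has_coeffs_def U.has_coeffs_def mult_op_def)
qed

lemmas has_coeffs_mult_fock_fun = has_coeffs_mult[OF U.has_coeffs_fock_fun]

lemma mult_nrm_le:
  assumes "g \<in> U.H"
  shows "Y.H.nrm (mult g) \<le> U.H.nrm g"
  using S_contractive[of "U.fock_fun g"] U.has_coeffs_fock_fun[OF assms] U.in_Hkd_iff
    Y.Hkd_norm_eq[OF has_coeffs_mult_fock_fun[OF assms]] U.Hkd_norm_eq[of "U.fock_fun g" g] by auto

lemma mult_mem: "g \<in> U.H \<Longrightarrow> mult g \<in> Y.H"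
  using Y.has_coeffs_mem[OF has_coeffs_mult_fock_fun] .

lemma ip_mult_kernel_vec:
  "g \<in> U.H \<Longrightarrow> z \<in> ball_d \<Longrightarrow> y \<in> Y \<Longrightarrow>
    Y.ipH (mult g) (kernel_vec z y) = U.ipH g (kernel_vec z (S_adj z y))"
  using has_coeffs_mult_op_iff[OF U.has_coeffs_fock_fun mult_mem] has_coeffs_mult_fock_fun by blast

sublocale mult: bounded_operator U.H U.ipH Y.H Y.ipH mult
proof (unfold_locales, rule bounded_opI)
  show "mult (x + y) = mult x + mult y" if "x \<in> U.H" "y \<in> U.H" for x y
    using that by (intro Y.eq_if_ip_kernel_vec_eq)
      (auto simp: mult_mem ip_mult_kernel_vec Y.H.ip_add_left U.H.ip_add_left)
  show "mult (c *\<^sub>C x) = c *\<^sub>C mult x" if "x \<in> U.H" for x c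
    using that by (intro Y.eq_if_ip_kernel_vec_eq)
      (auto simp: mult_mem ip_mult_kernel_vec Y.H.ip_scale_left U.H.ip_scale_left)
  show "Y.H.nrm (mult g) \<le> 1 * U.H.nrm g" if "g \<in> U.H" for g using mult_nrm_le[OF that] by simp
qed (rule mult_mem)

lemma mult_adj_kernel_vec:
  "z \<in> ball_d \<Longrightarrow> y \<in> Y \<Longrightarrow> mult.adj (kernel_vec z y) = kernel_vec z (S_adj z y)"
  by (rule mult.adj_eqI) (auto simp: ip_mult_kernel_vec)

lemma mult_shift_adj: "g \<in> U.H \<Longrightarrow> Y.shift.A.adj j (mult g) = mult (U.shift.A.adj j g)"
  by (rule Y.eq_if_ip_kernel_vec_eq)
    (auto simp: Y.ip_shift_adj_kernel_vec U.ip_shift_adj_kernel_vec ip_mult_kernel_vec)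

lemma op_holomorphic_S: "op_holomorphic U ipU Y ipY S"
  unfolding op_holomorphic_def
proof (intro conjI ballI)
  fix u y assume u: "u \<in> U" and y: "y \<in> Y"
  show "holomorphic_d (\<lambda>l. ipY (S l u) y) ball_d"
    using Y.holomorphic_if_has_coeffs[OF has_coeffs_mult[OF U.has_coeffs_const[OF u]] y]
    by (simp add: mult_op_def)
qed (rule S_bounded)

lemma mult_eq_0_iff:
  assumes f: "U.has_coeffs f g"
  shows "mult g = 0 \<longleftrightarrow> (\<forall>l\<in>ball_d. S l (f l) = 0)"
proof -
  have "Y.has_coeffs (mult_op S f) 0 \<longleftrightarrow> (\<forall>l\<in>ball_d. S l (f l) = 0)"
    using Y.fock_fun_scale[of 0 0] by (simp add: Y.has_coeffs_def mult_op_def)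
  moreover have "mult g = 0 \<longleftrightarrow> Y.has_coeffs (mult_op S f) 0"
    using has_coeffs_mult[OF f] Y.has_coeffs_unique by metis
  ultimately show ?thesis by simp
qed

lemma orthogonal_to_kernel_iff:
  assumes f: "U.has_coeffs f g"
  shows "(\<forall>f'. in_Hkd U ipU f' \<and> (\<forall>l\<in>ball_d. S l (f' l) = 0) \<longrightarrow> Hkd_inner U ipU f f' = 0) \<longleftrightarrow>
    (\<forall>k\<in>U.H. mult k = 0 \<longrightarrow> U.ipH g k = 0)"
proof (intro iffI ballI allI impI)
  fix k assume orth: "\<forall>f'. in_Hkd U ipU f' \<and> (\<forall>l\<in>ball_d. S l (f' l) = 0) \<longrightarrow> Hkd_inner U ipU f f' = 0"
    and k: "k \<in> U.H" "mult k = 0"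
  have f': "U.has_coeffs (U.fock_fun k) k" using k(1) by (rule U.has_coeffs_fock_fun)
  then have "Hkd_inner U ipU f (U.fock_fun k) = 0"
    using orth k(2) mult_eq_0_iff[OF f'] U.in_Hkd_iff by blast
  then show "U.ipH g k = 0" using U.Hkd_inner_eq[OF f f'] by simp
next
  fix f' assume orth: "\<forall>k\<in>U.H. mult k = 0 \<longrightarrow> U.ipH g k = 0"
    and f': "in_Hkd U ipU f' \<and> (\<forall>l\<in>ball_d. S l (f' l) = 0)"
  then obtain k where k: "U.has_coeffs f' k" using U.in_Hkd_iff by blast
  then have "U.ipH g k = 0" using orth f' mult_eq_0_iff[OF k] by simp
  then show "Hkd_inner U ipU f f' = 0" using U.Hkd_inner_eq[OF f k] by simp
qed

lemma inner_multiplier_iff_partial_isometry: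
  "inner_multiplier U ipU Y ipY S \<longleftrightarrow> mult.partial_isometry"
proof -
  let ?orth = "\<lambda>f. \<forall>f'. in_Hkd U ipU f' \<and> (\<forall>l\<in>ball_d. S l (f' l) = 0) \<longrightarrow> Hkd_inner U ipU f f' = 0"
  have "schur_class U ipU Y ipY S"
    using op_holomorphic_S S_contractive by (simp add: schur_class_def)
  then have inner_iff: "inner_multiplier U ipU Y ipY S \<longleftrightarrow>
      (\<forall>f. in_Hkd U ipU f \<and> ?orth f \<longrightarrow> Hkd_norm Y ipY (mult_op S f) = Hkd_norm U ipU f)"
    by (simp add: inner_multiplier_def)
  have nrm_iff: "Hkd_norm Y ipY (mult_op S f) = Hkd_norm U ipU f \<longleftrightarrow> Y.H.nrm (mult g) = U.H.nrm g"
    if f: "U.has_coeffs f g" for f g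
    using Y.Hkd_norm_eq[OF has_coeffs_mult[OF f]] U.Hkd_norm_eq[OF f] by simp
  show ?thesis
  proof
    assume inner: "inner_multiplier U ipU Y ipY S"
    show mult.partial_isometry
      unfolding mult.partial_isometry_def
    proof (intro ballI impI)
      fix g assume "g \<in> U.H" and orth: "\<forall>k\<in>U.H. mult k = 0 \<longrightarrow> U.ipH g k = 0"
      then have f: "U.has_coeffs (U.fock_fun g) g" by (intro U.has_coeffs_fock_fun)
      then have "in_Hkd U ipU (U.fock_fun g)" using U.in_Hkd_iff by blast
      moreover have "?orth (U.fock_fun g)" unfolding orthogonal_to_kernel_iff[OF f] by (rule orth)
      ultimately show "Y.H.nrm (mult g) = U.H.nrm g"
        unfolding nrm_iff[OF f, symmetric] using inner[unfolded inner_iff] by blast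
    qed
  next
    assume pi: mult.partial_isometry
    show "inner_multiplier U ipU Y ipY S"
      unfolding inner_iff
    proof (intro allI impI, elim conjE)
      fix f assume "in_Hkd U ipU f" and orth: "?orth f"
      then obtain g where f: "U.has_coeffs f g" using U.in_Hkd_iff by blast
      then show "Hkd_norm Y ipY (mult_op S f) = Hkd_norm U ipU f"
        unfolding nrm_iff[OF f] using pi orth[unfolded orthogonal_to_kernel_iff[OF f]]
        by (simp add: mult.partial_isometry_def)
    qed
  qed
qed

end

section \<open>Powers of commuting tuples\<close>

lemma fold_mset_cong:
  assumes A: "\<And>j x. x \<in> X \<Longrightarrow> A j x \<in> X" and comm: "commutative_tuple X A"
    and x: "x \<in> X" and vw: "mset v = mset w"
  shows "fold A v x = fold A w x"
proof -
  define A' where "A' j x = (if x \<in> X then A j x else x)" for j x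
  have "fold A' v = fold A' w"
    using comm A by (intro fold_multiset_equiv vw)
      (auto simp: A'_def fun_eq_iff commutative_tuple_def)
  moreover have "fold A' u x = fold A u x" for u
    using x by (induction u arbitrary: x) (auto simp: A'_def A)
  ultimately show ?thesis by metis
qed

definition word_of_exponent :: "('d::enum \<Rightarrow> nat) \<Rightarrow> 'd list" where
  "word_of_exponent n = concat (map (\<lambda>j. replicate (n j) j) (rev enum_class.enum))"

lemma count_word_of_exponent: "count (mset (word_of_exponent n)) = n"
proof
  fix j
  have "count (mset (concat (map (\<lambda>j. replicate (n j) j) js))) j = (if j \<in> set js then n j else 0)"
    if "distinct js" for js
    using that by (induction js) auto
  from this[of "rev enum_class.enum"] show "count (mset (word_of_exponent n)) j = n j"
    by (simp add: word_of_exponent_def enum_distinct UNIV_enum[symmetric])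
qed

lemma mpow_eq_fold: "mpow A n x = fold A (word_of_exponent n) x"
proof -
  have replicate: "fold A (replicate m j) x = (A j ^^ m) x" for m j x
    by (induction m arbitrary: x) (auto simp: funpow_swap1)
  have "foldr (\<lambda>j acc. (A j ^^ n j) \<circ> acc) js id x =
      fold A (concat (map (\<lambda>j. replicate (n j) j) (rev js))) x"
    for js by (induction js) (auto simp: replicate)
  then show ?thesis by (simp add: mpow_def word_of_exponent_def)
qed

lemma length_eq_sum_count: "length w = (\<Sum>j\<in>UNIV. count (mset w) (j::'d::finite))"
proof -
  have "length w = size (mset w)" by simp
  also have "\<dots> = (\<Sum>j\<in>set_mset (mset w). count (mset w) j)" by (rule size_multiset_overloaded_eq)
  also have "\<dots> = (\<Sum>j\<in>UNIV. count (mset w) j)"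
    by (rule sum.mono_neutral_left) (auto simp: count_eq_zero_iff)
  finally show ?thesis .
qed

lemma card_words_with_exponent:
  fixes n :: "'d::{finite,enum} \<Rightarrow> nat"
  shows "real (card {w. count (mset w) = n}) = fact (\<Sum>j\<in>UNIV. n j) / real (\<Prod>j\<in>UNIV. fact (n j))"
proof -
  let ?m = "mset (word_of_exponent n)"
  have "{w. count (mset w) = n} = permutations_of_multiset ?m"
    by (auto simp: permutations_of_multiset_def count_word_of_exponent)
      (metis count_inject count_word_of_exponent)
  moreover have "(\<Prod>j\<in>set_mset ?m. fact (count ?m j)) = (\<Prod>j\<in>UNIV. fact (n j) :: nat)"
    by (intro prod.mono_neutral_cong_left)
      (auto simp: count_word_of_exponent not_in_iff[of _ ?m, unfolded count_word_of_exponent]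
        simp del: set_mset_mset)
  moreover have "size ?m = (\<Sum>j\<in>UNIV. n j)"
    using length_eq_sum_count[of "word_of_exponent n"] by (simp add: count_word_of_exponent)
  ultimately have "card {w. count (mset w) = n} * (\<Prod>j\<in>UNIV. fact (n j)) = fact (\<Sum>j\<in>UNIV. n j)"
    using card_permutations_of_multiset_aux[of ?m] by simp
  then have "real (card {w. count (mset w) = n}) * real (\<Prod>j\<in>UNIV. fact (n j)) = fact (\<Sum>j\<in>UNIV. n j)"
    by (metis of_nat_fact of_nat_mult)
  then show ?thesis by (intro eq_divide_imp) simp_all
qed

lemma sum_multinomial_eq_sum_words:
  fixes A :: "'d::{finite,enum} \<Rightarrow> 'x \<Rightarrow> 'x" and h :: "'x \<Rightarrow> real"
  assumes A: "\<And>j x. x \<in> X \<Longrightarrow> A j x \<in> X" and comm: "commutative_tuple X A" and x: "x \<in> X"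
  shows "(\<Sum>n\<in>{n::'d \<Rightarrow> nat. (\<Sum>j\<in>UNIV. n j) = N}.
      real (fact N) / real (\<Prod>j\<in>UNIV. fact (n j)) * h (mpow A n x)) =
      (\<Sum>w | length w = N. h (fold A w x))"
proof -
  let ?W = "{w::'d list. length w = N}" and ?E = "{n::'d \<Rightarrow> nat. (\<Sum>j\<in>UNIV. n j) = N}"
  have "?E \<subseteq> (\<lambda>w. count (mset w)) ` ?W"
  proof
    fix n assume "n \<in> ?E"
    then have "word_of_exponent n \<in> ?W"
      by (simp add: length_eq_sum_count count_word_of_exponent)
    then show "n \<in> (\<lambda>w. count (mset w)) ` ?W"
      using count_word_of_exponent[of n] by (metis image_eqI)
  qed
  then have "finite ?E" by (rule finite_surj[OF finite_words_eq])
  then have "(\<Sum>w\<in>?W. h (fold A w x)) = (\<Sum>n\<in>?E. \<Sum>w\<in>{w \<in> ?W. count (mset w) = n}. h (fold A w x))"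
    by (intro sum.group[symmetric]) (auto simp: length_eq_sum_count[symmetric])
  also have "\<dots> = (\<Sum>n\<in>?E. real (fact N) / real (\<Prod>j\<in>UNIV. fact (n j)) * h (mpow A n x))"
  proof (rule sum.cong[OF refl])
    fix n assume n: "n \<in> ?E"
    have words: "{w \<in> ?W. count (mset w) = n} = {w. count (mset w) = n}"
      using n by (auto simp: length_eq_sum_count)
    have "h (fold A w x) = h (mpow A n x)" if "count (mset w) = n" for w
    proof -
      have mset: "mset w = mset (word_of_exponent n)"
        using that by (metis count_inject count_word_of_exponent)
      have "fold A w x = mpow A n x"
        unfolding mpow_eq_fold using A comm x mset by (rule fold_mset_cong)
      then show ?thesis by simp
    qed
    then have "(\<Sum>w | count (mset w) = n. h (fold A w x)) =
        real (card {w. count (mset w) = n}) * h (mpow A n x)"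
      by simp
    then show "(\<Sum>w\<in>{w \<in> ?W. count (mset w) = n}. h (fold A w x)) =
        real (fact N) / real (\<Prod>j\<in>UNIV. fact (n j)) * h (mpow A n x)"
      using n unfolding words card_words_with_exponent by simp
  qed
  finally show ?thesis by simp
qed

lemma strongly_stable_iff:
  fixes A :: "'d::{finite,enum} \<Rightarrow> 'x \<Rightarrow> 'x"
  assumes "\<And>j x. x \<in> X \<Longrightarrow> A j x \<in> X" "commutative_tuple X A"
  shows "strongly_stable X ipX A \<longleftrightarrow>
    (\<forall>x\<in>X. (\<lambda>N. \<Sum>w | length w = N. (hnorm ipX (fold A w x))\<^sup>2) \<longlonglongrightarrow> 0)"
  unfolding strongly_stable_def
  using sum_multinomial_eq_sum_words[of X A _ _ "\<lambda>v. (hnorm ipX v)\<^sup>2"] assms by simp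

section \<open>Isometric output pairs\<close>

lemma isometric_output_pair_iff:
  assumes "operator_column X ipX X ipX Y ipY A C"
  shows "isometric_output_pair X ipX Y ipY A C \<longleftrightarrow>
    (\<forall>x\<in>X. (\<Sum>j\<in>UNIV. (hnorm ipX (A j x))\<^sup>2) + (hnorm ipY (C x))\<^sup>2 = (hnorm ipX x)\<^sup>2)"
proof -
  interpret operator_column X ipX X ipX Y ipY A C by fact
  have "isometric_output_pair X ipX Y ipY A C \<longleftrightarrow> (\<forall>x\<in>X. col.adj (col A C x) = x)"
    unfolding isometric_output_pair_def
    by (auto simp: col_adj X.ltwo_finite_index col_def[of A C])
  also have "\<dots> \<longleftrightarrow> (\<forall>x\<in>X. (XdY.nrm (col A C x))\<^sup>2 = (X.nrm x)\<^sup>2)"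
    unfolding col.adj_comp_self_eq_id_iff by (auto simp: power2_eq_iff_nonneg)
  finally show ?thesis by (simp add: col_nrm_sq)
qed

locale isometric_pair = operator_column X ipX X ipX Y ipY A C + Y: drury_arveson Y ipY "TYPE('d)"
  for X :: "'x::cvector set" and ipX and Y :: "'y::cvector set" and ipY
    and A :: "'d::finite \<Rightarrow> 'x \<Rightarrow> 'x" and C +
  assumes isometric: "x \<in> X \<Longrightarrow> (\<Sum>j\<in>UNIV. (X.nrm (A j x))\<^sup>2) + (Y.nrm (C x))\<^sup>2 = (X.nrm x)\<^sup>2"

sublocale isometric_pair \<subseteq> column_contraction X ipX A
proof
  show "(\<Sum>j\<in>UNIV. (X.nrm (A j x))\<^sup>2) \<le> (X.nrm x)\<^sup>2" if "x \<in> X" for x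
    using isometric[OF that] zero_le_power2[of "Y.nrm (C x)"] by linarith
qed (auto simp: A.add A.scale)

context isometric_pair
begin

definition state_kernel :: "complex^'d \<Rightarrow> 'y \<Rightarrow> 'x" where
  "state_kernel z y = inv_I_minus X (Z_adj z) (C.adj y)"

abbreviation gen :: "complex^'d \<Rightarrow> 'y \<Rightarrow> 'd \<Rightarrow> 'x" where
  "gen z y \<equiv> D_gen X ipX Y ipY A C z y"

lemma state_kernel_mem [simp]: "z \<in> ball_d \<Longrightarrow> y \<in> Y \<Longrightarrow> state_kernel z y \<in> X"
  and state_kernel_eq: "z \<in> ball_d \<Longrightarrow> y \<in> Y \<Longrightarrow>
      state_kernel z y - Z_adj z (state_kernel z y) = C.adj y"
  unfolding state_kernel_def
  by (simp_all add: strict_contraction.inv_I_minus_mem[OF strict_contraction_Z_adj]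
      strict_contraction.inv_I_minus_right[OF strict_contraction_Z_adj])

lemma gen_eq: "gen z y = (\<lambda>j. cnj (z $ j) *\<^sub>C state_kernel z y)"
  by (simp add: D_gen_def state_kernel_def Z_adj_def[abs_def] Let_def)

lemma gen_mem [simp]: "z \<in> ball_d \<Longrightarrow> y \<in> Y \<Longrightarrow> gen z y \<in> Xd"
  by (simp add: gen_eq X.ltwo_finite_index)

lemma ip_C_resolvent:
  assumes z: "z \<in> ball_d" and x: "x \<in> X" and y: "y \<in> Y"
  shows "ipY (C (resolvent z x)) y = ipX x (state_kernel z y)"
proof -
  have "ipY (C (resolvent z x)) y =
      ipX (resolvent z x) (state_kernel z y - Z_adj z (state_kernel z y))"
    using assms by (simp add: C.ip_adj_right state_kernel_eq)
  also have "\<dots> = ipX (resolvent z x - Z z (resolvent z x)) (state_kernel z y)"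
    using assms by (simp add: X.ip_diff_left X.ip_diff_right ip_Z_adj_right)
  finally show ?thesis using z x by (simp add: resolvent_eq)
qed

lemma ip_gen_gen:
  assumes "z \<in> ball_d" "l \<in> ball_d" "y \<in> Y" "x \<in> Y"
  shows "ipd (gen z y) (gen l x) = cinner_d l z * ipX (state_kernel z y) (state_kernel l x)"
  using assms by (simp add: ltwo_ip_finite_index gen_eq X.ip_scale_left X.ip_scale_right
      cinner_d_def sum_distrib_right mult_ac)

lemma col_adj_gen:
  assumes z: "z \<in> ball_d" and y: "y \<in> Y"
  shows "col.adj (gen z y, y) = state_kernel z y"
proof -
  have "col.adj (gen z y, y) = Z_adj z (state_kernel z y) + C.adj y"
    using z y by (simp add: col_adj)
      (simp add: gen_eq Z_adj_def bounded_operator.scale[OF A.bounded_operator_adj])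
  then show ?thesis using state_kernel_eq[OF z y] by (simp add: algebra_simps)
qed

lemma D_space_eq_closed_span:
  "D_space X ipX Y ipY A C = closed_span Xd ipd (\<lambda>(z, y). gen z y) (ball_d \<times> Y)"
proof (rule set_eqI)
  fix w
  let ?a = "\<lambda>(z, y). gen z y" and ?I = "(ball_d :: (complex^'d) set) \<times> Y"
  have a: "\<forall>i\<in>?I. ?a i \<in> Xd" by auto
  have "hnorm_d ipX (w - p) = Xd.nrm (w - p)" if "w \<in> Xd" "p \<in> lin_span ?a ?I" for p
    using that Xd.lin_span_subset[OF a] by (intro X.hnorm_d_eq_ltwo Xd.diff_mem) auto
  then have "w \<in> closed_span Xd ipd ?a ?I \<longleftrightarrow>
      w \<in> Xd \<and> (\<forall>e>0. \<exists>p\<in>lin_span ?a ?I. hnorm_d ipX (w - p) < e)"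
    unfolding closed_span_def Xd.mem_closure_in_iff[OF Xd.lin_span_subset[OF a]]
    by (auto cong: bex_cong)
  then show "w \<in> D_space X ipX Y ipY A C \<longleftrightarrow> w \<in> closed_span Xd ipd ?a ?I"
    by (simp add: D_space_def bex_lin_span_Times_iff X.ltwo_finite_index)
qed

lemma gen_in_D_space: "z \<in> ball_d \<Longrightarrow> y \<in> Y \<Longrightarrow> gen z y \<in> D_space X ipX Y ipY A C"
  unfolding D_space_eq_closed_span
  using Xd.generator_in_closed_span[of "ball_d \<times> Y" "\<lambda>(z, y). gen z y" "(z, y)"] by auto

lemma D_space_subset: "D_space X ipX Y ipY A C \<subseteq> Xd"
  unfolding D_space_eq_closed_span by (rule Xd.closed_span_subset)

lemma csubspace_D_space: "csubspace (D_space X ipX Y ipY A C)"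
  unfolding D_space_eq_closed_span by (rule Xd.csubspace_closed_span) auto

lemma fold_A_mem [simp]: "x \<in> X \<Longrightarrow> fold A w x \<in> X"
  by (induction w arbitrary: x) auto

lemma energy_balance:
  assumes "x \<in> X"
  shows "(\<Sum>w | length w = N. (X.nrm (fold A w x))\<^sup>2) +
    (\<Sum>w | length w < N. (Y.nrm (C (fold A w x)))\<^sup>2) = (X.nrm x)\<^sup>2"
  using assms
proof (induction N arbitrary: x)
  case (Suc N)
  have "(\<Sum>w | length w = Suc N. (X.nrm (fold A w x))\<^sup>2) +
      (\<Sum>w | length w < Suc N. (Y.nrm (C (fold A w x)))\<^sup>2) =
      (\<Sum>j\<in>UNIV. (\<Sum>w | length w = N. (X.nrm (fold A w (A j x)))\<^sup>2) +
        (\<Sum>w | length w < N. (Y.nrm (C (fold A w (A j x))))\<^sup>2)) + (Y.nrm (C x))\<^sup>2"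
    by (simp add: sum_words_Suc sum_words_less_Suc_Cons sum.distrib)
  also have "\<dots> = (X.nrm x)\<^sup>2" using Suc by (simp add: isometric)
  finally show ?case .
qed simp

end

locale stable_pair = isometric_pair X ipX Y ipY A C
  for X :: "'x::cvector set" and ipX and Y :: "'y::cvector set" and ipY
    and A :: "'d::finite \<Rightarrow> 'x \<Rightarrow> 'x" and C +
  assumes commutative: "commutative_tuple X A"
    and stable: "x \<in> X \<Longrightarrow> (\<lambda>N. \<Sum>w | length w = N. (X.nrm (fold A w x))\<^sup>2) \<longlonglongrightarrow> 0"
begin

definition obs :: "'x \<Rightarrow> 'd list \<Rightarrow> 'y" where
  "obs x = (\<lambda>w. C (fold A w x))"

lemma obs_Nil [simp]: "obs x [] = C x"
  and shift_obs: "shift j (obs x) = obs (A j x)"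
  by (simp_all add: obs_def shift_def)

lemma obs_mem:
  assumes x: "x \<in> X"
  shows "obs x \<in> Y.H"
proof (rule Y.mem_fock_if_sum_words_le)
  show "symmetric (obs x)"
    unfolding symmetric_def obs_def using fold_mset_cong[OF _ commutative x] by (metis A.mem)
  show "(\<Sum>w | length w < N. (Y.nrm (obs x w))\<^sup>2) \<le> (X.nrm x)\<^sup>2" for N
    unfolding energy_balance[OF x, of N, symmetric] obs_def by (simp add: sum_nonneg)
qed (use x in \<open>simp add: obs_def\<close>)

lemma obs_nrm:
  assumes x: "x \<in> X"
  shows "Y.H.nrm (obs x) = X.nrm x"
proof -
  have "(\<lambda>N. (X.nrm x)\<^sup>2 - (\<Sum>w | length w = N. (X.nrm (fold A w x))\<^sup>2)) \<longlonglongrightarrow> (X.nrm x)\<^sup>2 - 0"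
    by (intro tendsto_intros stable x)
  moreover have "(X.nrm x)\<^sup>2 - (\<Sum>w | length w = N. (X.nrm (fold A w x))\<^sup>2) =
      (\<Sum>w | length w < N. (Y.nrm (obs x w))\<^sup>2)" for N
    using energy_balance[OF x, of N] by (simp add: obs_def)
  ultimately have "(\<lambda>N. \<Sum>w | length w < N. (Y.nrm (obs x w))\<^sup>2) \<longlonglongrightarrow> (X.nrm x)\<^sup>2" by simp
  then have "(Y.H.nrm (obs x))\<^sup>2 = (X.nrm x)\<^sup>2"
    using LIMSEQ_unique Y.fock_nrm_sq_limit[OF obs_mem[OF x]] by blast
  then show ?thesis using x obs_mem[OF x] by (simp add: power2_eq_iff_nonneg)
qed

sublocale obs: bounded_operator X ipX Y.H Y.ipH obs
proof (unfold_locales, rule bounded_opI)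
  fix x y c assume x: "x \<in> X" and y: "y \<in> X"
  have "fold A w (x + y) = fold A w x + fold A w y" for w
    using x y by (induction w arbitrary: x y) (auto simp: A.add)
  then show "obs (x + y) = obs x + obs y" using x y by (auto simp: obs_def C.add fun_eq_iff)
  have "fold A w (c *\<^sub>C x) = c *\<^sub>C fold A w x" for w
    using x by (induction w arbitrary: x) (auto simp: A.scale)
  then show "obs (c *\<^sub>C x) = c *\<^sub>C obs x" using x by (auto simp: obs_def C.scale fun_eq_iff)
  show "Y.H.nrm (obs x) \<le> 1 * X.nrm x" using obs_nrm[OF x] by simp
qed (rule obs_mem)

lemma ip_obs_obs: "x \<in> X \<Longrightarrow> y \<in> X \<Longrightarrow> Y.ipH (obs x) (obs y) = ipX x y"
  using obs.isometric_imp_ip_preserving[OF X.csubspace subset_refl] obs_nrm by blast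

lemma obs_adj_obs: "x \<in> X \<Longrightarrow> obs.adj (obs x) = x"
  by (rule obs.adj_eqI) (auto simp: ip_obs_obs)

lemma ip_obs_kernel_vec:
  assumes z: "z \<in> ball_d" and y: "y \<in> Y" and x: "x \<in> X"
  shows "Y.ipH (obs x) (kernel_vec z y) = ipX x (state_kernel z y)"
proof -
  let ?F = "\<lambda>x. Y.ipH (obs x) (kernel_vec z y)"
  define v where "v = resolvent z x"
  have v: "v \<in> X" "v - Z z v = x" using z x by (auto simp: v_def resolvent_eq)
  have "?F v = ipY (C v) y + (\<Sum>j\<in>UNIV. z $ j * ?F (A j v))"
    using Y.ip_kernel_vec_shift[OF obs_mem[OF v(1)] z y] by (simp add: shift_obs)
  also have "(\<Sum>j\<in>UNIV. z $ j * ?F (A j v)) = ?F (Z z v)"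
  proof -
    have "obs (Z z v) = (\<Sum>j\<in>UNIV. (z $ j) *\<^sub>C obs (A j v))"
      unfolding Z_def using v(1) by (subst obs.sum) (auto simp: obs.scale)
    then show ?thesis using v(1) z y by (simp add: Y.H.ip_sum_left Y.H.ip_scale_left)
  qed
  finally have "?F (v - Z z v) = ipY (C v) y"
    using v(1) z y by (simp add: obs.diff Y.H.ip_diff_left)
  then show ?thesis using v(2) ip_C_resolvent[OF z x y] by (simp add: v_def)
qed

lemma obs_adj_kernel_vec: "z \<in> ball_d \<Longrightarrow> y \<in> Y \<Longrightarrow> obs.adj (kernel_vec z y) = state_kernel z y"
  by (rule obs.adj_eqI) (auto simp: ip_obs_kernel_vec)

end

section \<open>Complementary output pairs\<close>

locale complementary_pair =
  stable_pair X ipX Y ipY A C + contractive_multiplier U ipU Y ipY S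
  for X :: "'x::cvector set" and ipX and Y :: "'y::cvector set" and ipY
    and A :: "'d::finite \<Rightarrow> 'x \<Rightarrow> 'x" and C
    and U :: "'u::cvector set" and ipU and S :: "complex^'d \<Rightarrow> 'u \<Rightarrow> 'y" +
  assumes mult_mult_adj_plus_obs_obs_adj: "h \<in> Y.H \<Longrightarrow> mult (mult.adj h) + obs (obs.adj h) = h"
begin

lemma mult_mult_adj: "h \<in> Y.H \<Longrightarrow> mult (mult.adj h) = h - obs (obs.adj h)"
  using mult_mult_adj_plus_obs_obs_adj[of h] by (metis add_diff_cancel_right')

lemma mult_adj_obs:
  assumes x: "x \<in> X"
  shows "mult.adj (obs x) = 0"
proof -
  have "mult (mult.adj (obs x)) = 0" using mult_mult_adj[of "obs x"] x by (simp add: obs_adj_obs)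
  then have "U.ipH (mult.adj (obs x)) (mult.adj (obs x)) = 0"
    using x mult.ip_adj_right[of "mult.adj (obs x)" "obs x"] by simp
  then show ?thesis using U.H.ip_self_eq_0[of "mult.adj (obs x)"] x by simp
qed

theorem inner_multiplier: "inner_multiplier U ipU Y ipY S"
proof -
  have "mult.adj (mult (mult.adj h)) = mult.adj h" if h: "h \<in> Y.H" for h
    using h bounded_operator.diff[OF mult.bounded_operator_adj]
    by (simp add: mult_mult_adj mult_adj_obs)
  then show ?thesis
    unfolding inner_multiplier_iff_partial_isometry
    using mult.partial_isometry_iff mult_nrm_le by blast
qed

end

section \<open>From weakly coisometric realizations to complementary pairs\<close>

locale weak_realization =
  stable_pair X ipX Y ipY A C + multiplier U ipU Y ipY S + BD: operator_column U ipU X ipX Y ipY B D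
  for X :: "'x::cvector set" and ipX and Y :: "'y::cvector set" and ipY
    and A :: "'d::finite \<Rightarrow> 'x \<Rightarrow> 'x" and C
    and U :: "'u::cvector set" and ipU and S :: "complex^'d \<Rightarrow> 'u \<Rightarrow> 'y"
    and B :: "'d \<Rightarrow> 'u \<Rightarrow> 'x" and D +
  assumes realizes: "realizes X U A B C D S"
    and weakly_coisometric: "weakly_coisometric X ipX U ipU Y ipY A B C D"
begin

sublocale conn: operator_row X ipX U ipU "Xd \<times> Y" "prod_ip ipd ipY" "col A C" "col B D" ..

lemma S_eq:
  "l \<in> ball_d \<Longrightarrow> u \<in> U \<Longrightarrow> S l u = D u + C (resolvent l (\<Sum>j\<in>UNIV. (l $ j) *\<^sub>C B j u))"
  using realizes by (simp add: realizes_def resolvent_def Z_def[abs_def])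

lemma S_adj_eq:
  assumes z: "z \<in> ball_d" and y: "y \<in> Y"
  shows "S_adj z y = BD.col.adj (gen z y, y)"
proof (rule bounded_operator.adj_eqI[OF bounded_operator_S[OF z] y])
  show "BD.col.adj (gen z y, y) \<in> U" using z y by simp
  fix u assume u: "u \<in> U"
  define b where "b = (\<Sum>j\<in>UNIV. (z $ j) *\<^sub>C B j u)"
  have b: "b \<in> X" using u by (auto simp: b_def intro!: X.sum_mem)
  have "ipY (S z u) y = ipY (D u) y + ipX b (state_kernel z y)"
    using z y u b by (simp add: S_eq[OF z u] b_def[symmetric] Y.ip_add_left ip_C_resolvent)
  also have "ipX b (state_kernel z y) = ipd (\<lambda>j. B j u) (gen z y)"
    using z y u by (simp add: b_def X.ip_sum_left X.ip_scale_left X.ip_scale_right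
        ltwo_ip_finite_index gen_eq)
  finally show "ipY (S z u) y = ipU u (BD.col.adj (gen z y, y))"
    using z y u by (simp add: BD.col.ip_adj_right) (simp add: prod_ip_def col_def)
qed

lemma row_adj_gen:
  "z \<in> ball_d \<Longrightarrow> y \<in> Y \<Longrightarrow> conn.row.adj (gen z y, y) = (state_kernel z y, S_adj z y)"
  by (simp add: conn.row_adj col_adj_gen S_adj_eq)

lemma row_adj_isometric:
  assumes "p \<in> D_space X ipX Y ipY A C \<times> Y"
  shows "conn.dom.nrm (conn.row.adj p) = XdY.nrm p"
proof -
  obtain w y where p: "p = (w, y)" and w: "w \<in> D_space X ipX Y ipY A C" and y: "y \<in> Y"
    using assms by blast
  have wX: "w \<in> Xd" using w D_space_subset by blast
  have "(conn.dom.nrm (conn.row.adj p))\<^sup>2 = (X.nrm (col.adj p))\<^sup>2 + (U.nrm (BD.col.adj p))\<^sup>2"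
    using wX y p by (simp add: conn.dom.hnorm_prod_ip_sq conn.row_adj)
  also have "\<dots> = (hnorm_d ipX w)\<^sup>2 + (Y.nrm y)\<^sup>2"
    using weakly_coisometric w y wX p by (simp add: weakly_coisometric_def col_adj BD.col_adj)
  also have "\<dots> = (XdY.nrm p)\<^sup>2"
    using wX y p by (simp add: XdY.hnorm_prod_ip_sq X.hnorm_d_eq_ltwo)
  finally show ?thesis using wX y p by (simp add: power2_eq_iff_nonneg)
qed

lemma kernel_identity:
  assumes z: "z \<in> ball_d" "y \<in> Y" and l: "l \<in> ball_d" "x \<in> Y"
  shows "kd l z * ipU (S_adj z y) (S_adj l x) + ipX (state_kernel z y) (state_kernel l x) =
      kd l z * ipY y x"
proof -
  interpret adj: bounded_operator "Xd \<times> Y" "prod_ip ipd ipY" "X \<times> U" "prod_ip ipX ipU" conn.row.adj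
    by (rule conn.row.bounded_operator_adj)
  have "prod_ip ipX ipU (conn.row.adj (gen z y, y)) (conn.row.adj (gen l x, x)) =
      prod_ip ipd ipY (gen z y, y) (gen l x, x)"
    using z l D_space_subset
    by (intro adj.isometric_imp_ip_preserving
      [OF XdY.csubspace_Times[OF csubspace_D_space Y.csubspace]]
        row_adj_isometric) (auto simp: gen_in_D_space)
  then show ?thesis
    using z l by (simp add: kd_mult_add_eq_iff row_adj_gen prod_ip_def ip_gen_gen)
qed

text \<open>The kernel identity makes \<open>k(z) y \<mapsto> (k(z) S(z)\<^sup>* y, state_kernel z y)\<close> isometric; its adjoint
  restricted to the first summand is multiplication by \<open>S\<close>.\<close>

lemma multiplication_contractive:
  obtains T where "\<And>g. g \<in> U.H \<Longrightarrow> T g \<in> Y.H" "\<And>g. g \<in> U.H \<Longrightarrow> Y.H.nrm (T g) \<le> U.H.nrm g"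
    "\<And>g z y. g \<in> U.H \<Longrightarrow> z \<in> ball_d \<Longrightarrow> y \<in> Y \<Longrightarrow>
      Y.ipH (T g) (kernel_vec z y) = U.ipH g (kernel_vec z (S_adj z y))"
proof -
  let ?I = "(ball_d :: (complex^'d) set) \<times> Y"
  let ?f = "\<lambda>(z, y). kernel_vec z y"
    and ?g = "\<lambda>(z, y). (kernel_vec z (S_adj z y), state_kernel z y)"
  interpret UX: hilbert_sum U.H U.ipH X ipX ..
  obtain T where T: "bounded_operator (U.H \<times> X) (prod_ip U.ipH ipX) Y.H Y.ipH T"
    and T_nrm: "\<And>v. v \<in> U.H \<times> X \<Longrightarrow> Y.H.nrm (T v) \<le> UX.nrm v"
    and ip_T: "\<And>i v. i \<in> ?I \<Longrightarrow> v \<in> U.H \<times> X \<Longrightarrow> Y.ipH (?f i) (T v) = prod_ip U.ipH ipX (?g i) v"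
  proof (rule lurking_isometry[OF Y.H.hilbert_axioms UX.hilbert_axioms, of ?I ?f ?g])
    fix i k assume "i \<in> ?I" "k \<in> ?I"
    then show "Y.ipH (?f i) (?f k) = prod_ip U.ipH ipX (?g i) (?g k)"
      by (auto simp: prod_ip_def Y.ip_kernel_vec_kernel_vec U.ip_kernel_vec_kernel_vec
        kernel_identity)
  qed auto
  interpret T: bounded_operator "U.H \<times> X" "prod_ip U.ipH ipX" Y.H Y.ipH T by (rule T)
  show thesis
  proof (rule that[of "\<lambda>g. T (g, 0)"])
    fix g assume g: "g \<in> U.H"
    show "T (g, 0) \<in> Y.H" using g by simp
    have "UX.nrm (g, 0) = U.H.nrm g" by (simp add: hnorm_def prod_ip_def)
    then show "Y.H.nrm (T (g, 0)) \<le> U.H.nrm g" using T_nrm[of "(g, 0)"] g by simp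
    show "Y.ipH (T (g, 0)) (kernel_vec z y) = U.ipH g (kernel_vec z (S_adj z y))"
      if "z \<in> ball_d" "y \<in> Y" for z y
      using ip_T[of "(z, y)" "(g, 0)"] g that Y.H.ip_sym[of "kernel_vec z y" "T (g, 0)"]
        U.H.ip_sym[of "kernel_vec z (S_adj z y)" g] by (simp add: prod_ip_def)
  qed
qed

sublocale contractive_multiplier U ipU Y ipY S
proof
  fix f :: "complex^'d \<Rightarrow> 'u" assume "in_Hkd U ipU f"
  then obtain g where f: "U.has_coeffs f g" using U.in_Hkd_iff by blast
  obtain T where T: "\<And>g. g \<in> U.H \<Longrightarrow> T g \<in> Y.H" "\<And>g. g \<in> U.H \<Longrightarrow> Y.H.nrm (T g) \<le> U.H.nrm g"
    "\<And>g z y. g \<in> U.H \<Longrightarrow> z \<in> ball_d \<Longrightarrow> y \<in> Y \<Longrightarrow>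
      Y.ipH (T g) (kernel_vec z y) = U.ipH g (kernel_vec z (S_adj z y))"
    using multiplication_contractive by blast
  have g: "g \<in> U.H" using f by simp
  have h: "Y.has_coeffs (mult_op S f) (T g)"
    using has_coeffs_mult_op_iff[OF f T(1)[OF g]] T(3)[OF g] by blast
  show "in_Hkd Y ipY (mult_op S f) \<and> Hkd_norm Y ipY (mult_op S f) \<le> Hkd_norm U ipU f"
    using h T(2)[OF g] Y.in_Hkd_iff by (auto simp: Y.Hkd_norm_eq[OF h] U.Hkd_norm_eq[OF f])
qed

lemma mult_kernel_vec_plus_obs_state_kernel:
  "z \<in> ball_d \<Longrightarrow> y \<in> Y \<Longrightarrow>
    mult (kernel_vec z (S_adj z y)) + obs (state_kernel z y) = kernel_vec z y"
  by (rule Y.eq_if_ip_kernel_vec_eq)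
    (auto simp: Y.H.ip_add_left ip_mult_kernel_vec ip_obs_kernel_vec U.ip_kernel_vec_kernel_vec
      Y.ip_kernel_vec_kernel_vec kernel_identity)

sublocale complementary_pair X ipX Y ipY A C U ipU S
proof
  fix h assume h: "h \<in> Y.H"
  show "mult (mult.adj h) + obs (obs.adj h) = h"
  proof (rule Y.eq_if_ip_kernel_vec_eq)
    fix z :: "complex^'d" and y assume zy: "z \<in> ball_d" "y \<in> Y"
    have "Y.ipH (mult (mult.adj h) + obs (obs.adj h)) (kernel_vec z y) =
        Y.ipH h (mult (kernel_vec z (S_adj z y)) + obs (state_kernel z y))"
      using h zy by (simp add: Y.H.ip_add_left Y.H.ip_add_right ip_mult_kernel_vec ip_obs_kernel_vec
          mult.ip_adj_left obs.ip_adj_left)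
    then show "Y.ipH (mult (mult.adj h) + obs (obs.adj h)) (kernel_vec z y) =
        Y.ipH h (kernel_vec z y)"
      using mult_kernel_vec_plus_obs_state_kernel[OF zy] by simp
  qed (use h in auto)
qed

end

section \<open>From complementary pairs to weakly coisometric realizations\<close>

context complementary_pair
begin

lemma ip_state_kernel_plus_ip_S_adj:
  assumes z: "z \<in> ball_d" "y \<in> Y" and l: "l \<in> ball_d" "x \<in> Y"
  shows "ipX (state_kernel z y) (state_kernel l x) + ipU (S_adj z y) (S_adj l x) =
    cinner_d l z * ipX (state_kernel z y) (state_kernel l x) + ipY y x"
proof -
  have "kernel_vec z y = mult (kernel_vec z (S_adj z y)) + obs (state_kernel z y)"
    using mult_mult_adj_plus_obs_obs_adj[of "kernel_vec z y"] z
    by (simp add: mult_adj_kernel_vec obs_adj_kernel_vec)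
  then have "Y.ipH (kernel_vec z y) (kernel_vec l x) =
      Y.ipH (mult (kernel_vec z (S_adj z y)) + obs (state_kernel z y)) (kernel_vec l x)"
    by simp
  then have "kd l z * ipU (S_adj z y) (S_adj l x) + ipX (state_kernel z y) (state_kernel l x) =
      kd l z * ipY y x"
    using z l by (simp add: Y.H.ip_add_left ip_mult_kernel_vec ip_obs_kernel_vec
        U.ip_kernel_vec_kernel_vec Y.ip_kernel_vec_kernel_vec)
  then show ?thesis using kd_mult_add_eq_iff[OF l(1) z(1)] by blast
qed

abbreviation lurking_domain :: "(complex^'d) \<times> 'y \<Rightarrow> ('d \<Rightarrow> 'x) \<times> 'y" where
  "lurking_domain \<equiv> \<lambda>(z, y). (gen z y, y)"

abbreviation lurking_range :: "(complex^'d) \<times> 'y \<Rightarrow> 'x \<times> 'u" where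
  "lurking_range \<equiv> \<lambda>(z, y). (state_kernel z y, S_adj z y)"

lemma lurking_domain_mem: "\<forall>i\<in>ball_d \<times> Y. lurking_domain i \<in> Xd \<times> Y"
  by auto

lemma perp_lurking_domain:
  assumes e: "e \<in> Xd \<times> Y"
    and perp: "\<forall>i\<in>ball_d \<times> Y. prod_ip ipd ipY (lurking_domain i) e = 0"
  shows "snd e = 0" and "z \<in> ball_d \<Longrightarrow> y \<in> Y \<Longrightarrow> ipd (gen z y) (fst e) = 0"
proof -
  have "gen 0 y = 0" for y by (simp add: gen_eq fun_eq_iff)
  then have "ipY y (snd e) = 0" if "y \<in> Y" for y
    using bspec[OF perp, of "(0, y)"] that e by (simp add: prod_ip_def mem_Times_iff)
  then show "snd e = 0" using e Y.ip_self_eq_0 by (simp add: mem_Times_iff)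
  then show "ipd (gen z y) (fst e) = 0" if "z \<in> ball_d" "y \<in> Y"
    using bspec[OF perp, of "(z, y)"] that by (simp add: prod_ip_def)
qed

lemma D_space_Times_subset:
  "D_space X ipX Y ipY A C \<times> Y \<subseteq> closed_span (Xd \<times> Y) (prod_ip ipd ipY) lurking_domain (ball_d \<times> Y)"
proof
  fix p assume p: "p \<in> D_space X ipX Y ipY A C \<times> Y"
  then have pX: "p \<in> Xd \<times> Y" using D_space_subset by auto
  show "p \<in> closed_span (Xd \<times> Y) (prod_ip ipd ipY) lurking_domain (ball_d \<times> Y)"
  proof (rule XdY.mem_closed_span_if_perp_perp[OF lurking_domain_mem pX])
    fix e assume e: "e \<in> Xd \<times> Y"
      and perp: "\<forall>i\<in>ball_d \<times> Y. prod_ip ipd ipY (lurking_domain i) e = 0"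
    note e_perp = perp_lurking_domain[OF e perp]
    have "ipd (fst p) (fst e) = 0"
      by (rule Xd.ip_closed_span_eq_0[of "ball_d \<times> Y" "\<lambda>(z, y). gen z y"])
        (use p e e_perp(2) in \<open>auto simp: D_space_eq_closed_span\<close>)
    then show "prod_ip ipd ipY p e = 0"
      using e_perp(1) p by (auto simp: prod_ip_def)
  qed
qed

lemma col_in_closed_span:
  assumes x: "x \<in> X"
  shows "col A C x \<in> closed_span (Xd \<times> Y) (prod_ip ipd ipY) lurking_domain (ball_d \<times> Y)"
proof (rule XdY.mem_closed_span_if_perp_perp[OF lurking_domain_mem])
  fix e assume e: "e \<in> Xd \<times> Y"
    and perp: "\<forall>i\<in>ball_d \<times> Y. prod_ip ipd ipY (lurking_domain i) e = 0"
  note e_perp = perp_lurking_domain[OF e perp]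
  have w: "fst e j \<in> X" for j using e by (auto simp: X.ltwo_finite_index mem_Times_iff)
  define G where "G = (\<Sum>j\<in>UNIV. Y.shift.A.adj j (obs (fst e j)))"
  have G: "G \<in> Y.H" unfolding G_def using w by (intro Y.H.sum_mem) simp
  have "Y.ipH G (kernel_vec z y) = 0" if z: "z \<in> ball_d" and y: "y \<in> Y" for z :: "complex^'d" and y
  proof -
    have "Y.ipH G (kernel_vec z y) = (\<Sum>j\<in>UNIV. z $ j * ipX (fst e j) (state_kernel z y))"
      unfolding G_def using w z y
      by (simp add: Y.H.ip_sum_left Y.ip_shift_adj_kernel_vec ip_obs_kernel_vec)
    also have "\<dots> = ipd (fst e) (gen z y)"
      using w z y by (simp add: ltwo_ip_finite_index gen_eq X.ip_scale_right)
    also have "\<dots> = cnj (ipd (gen z y) (fst e))"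
      using e z y by (intro Xd.ip_sym) (auto simp: mem_Times_iff)
    finally show ?thesis using e_perp(2)[OF z y] by simp
  qed
  then have "G = 0" using Y.eq_0_if_ip_kernel_vec_eq_0[OF G] by blast
  have "ipd (\<lambda>j. A j x) (fst e) = (\<Sum>j\<in>UNIV. Y.ipH (obs (A j x)) (obs (fst e j)))"
    using x w by (simp add: ltwo_ip_finite_index ip_obs_obs)
  also have "\<dots> = Y.ipH (obs x) G"
    unfolding G_def using x w
    by (subst Y.H.ip_sum_right) (auto simp: Y.shift.A.ip_adj_right shift_obs)
  finally show "prod_ip ipd ipY (col A C x) e = 0"
    using \<open>G = 0\<close> x e_perp(1) by (simp add: prod_ip_def col_def)
qed (use x in simp)

lemma eq_col_if_lurking_ip_eq:
  assumes x: "x \<in> X" and p: "p \<in> closed_span (Xd \<times> Y) (prod_ip ipd ipY) lurking_domain (ball_d \<times> Y)"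
    and ip_p: "\<And>z y. z \<in> ball_d \<Longrightarrow> y \<in> Y \<Longrightarrow>
      prod_ip ipd ipY (lurking_domain (z, y)) p = ipX (state_kernel z y) x"
  shows "p = col A C x"
proof (rule XdY.closed_span_eqI[OF lurking_domain_mem p col_in_closed_span[OF x]])
  fix i :: "(complex^'d) \<times> 'y" assume "i \<in> ball_d \<times> Y"
  then obtain z y where zy: "i = (z, y)" "z \<in> ball_d" "y \<in> Y" by blast
  have "prod_ip ipd ipY (lurking_domain i) (col A C x) = ipX (col.adj (gen z y, y)) x"
    using zy x by (simp add: col.ip_adj_left)
  then show "prod_ip ipd ipY (lurking_domain i) p = prod_ip ipd ipY (lurking_domain i) (col A C x)"
    using zy x by (simp add: ip_p[simplified] col_adj_gen)
qed

lemma lurking_colligation_exists: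
  obtains T where "bounded_operator (X \<times> U) (prod_ip ipX ipU) (Xd \<times> Y) (prod_ip ipd ipY) T"
    "\<And>v. v \<in> X \<times> U \<Longrightarrow> XdY.nrm (T v) \<le> hnorm (prod_ip ipX ipU) v"
    "\<And>x. x \<in> X \<Longrightarrow> T (x, 0) = col A C x"
    "\<And>p. p \<in> D_space X ipX Y ipY A C \<times> Y \<Longrightarrow>
      T (hadj (X \<times> U) (prod_ip ipX ipU) (Xd \<times> Y) (prod_ip ipd ipY) T p) = p"
    "\<And>z y v. z \<in> ball_d \<Longrightarrow> y \<in> Y \<Longrightarrow> v \<in> X \<times> U \<Longrightarrow>
      prod_ip ipd ipY (gen z y, y) (T v) = prod_ip ipX ipU (state_kernel z y, S_adj z y) v"
proof -
  interpret XU: hilbert_sum X ipX U ipU ..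
  let ?I = "(ball_d :: (complex^'d) set) \<times> Y"
  let ?M = "closed_span (Xd \<times> Y) (prod_ip ipd ipY) lurking_domain ?I"
  obtain T where T: "bounded_operator (X \<times> U) (prod_ip ipX ipU) (Xd \<times> Y) (prod_ip ipd ipY) T"
    and T_nrm: "\<And>v. v \<in> X \<times> U \<Longrightarrow> XdY.nrm (T v) \<le> XU.nrm v"
    and T_mem: "\<And>v. v \<in> X \<times> U \<Longrightarrow> T v \<in> ?M"
    and ip_T: "\<And>i v. i \<in> ?I \<Longrightarrow> v \<in> X \<times> U \<Longrightarrow>
      prod_ip ipd ipY (lurking_domain i) (T v) = prod_ip ipX ipU (lurking_range i) v"
    and T_adj: "\<And>p. p \<in> ?M \<Longrightarrow> T (hadj (X \<times> U) (prod_ip ipX ipU) (Xd \<times> Y) (prod_ip ipd ipY) T p) = p"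
  proof (rule lurking_isometry[OF XdY.hilbert_axioms XU.hilbert_axioms lurking_domain_mem,
    of lurking_range])
    fix i k assume "i \<in> ?I" "k \<in> ?I"
    then show "prod_ip ipd ipY (lurking_domain i) (lurking_domain k) =
        prod_ip ipX ipU (lurking_range i) (lurking_range k)"
      by (auto simp: prod_ip_def ip_gen_gen ip_state_kernel_plus_ip_S_adj)
  qed auto
  have T_col: "T (x, 0) = col A C x" if x: "x \<in> X" for x
    using x T_mem[of "(x, 0)"] ip_T[of _ "(x, 0)"]
    by (intro eq_col_if_lurking_ip_eq) (auto simp: prod_ip_def)
  have "T (hadj (X \<times> U) (prod_ip ipX ipU) (Xd \<times> Y) (prod_ip ipd ipY) T p) = p"
    if "p \<in> D_space X ipX Y ipY A C \<times> Y" for p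
    using T_adj D_space_Times_subset that by blast
  moreover have "prod_ip ipd ipY (gen z y, y) (T v) =
      prod_ip ipX ipU (state_kernel z y, S_adj z y) v"
    if "z \<in> ball_d" "y \<in> Y" "v \<in> X \<times> U" for z y v
    using ip_T[of "(z, y)" v] that by simp
  ultimately show thesis using that[of T] T T_nrm T_col by blast
qed

end

locale lurking_colligation = complementary_pair X ipX Y ipY A C U ipU S
  for X :: "'x::cvector set" and ipX and Y :: "'y::cvector set" and ipY
    and A :: "'d::finite \<Rightarrow> 'x \<Rightarrow> 'x" and C
    and U :: "'u::cvector set" and ipU and S :: "complex^'d \<Rightarrow> 'u \<Rightarrow> 'y" +
  fixes T :: "'x \<times> 'u \<Rightarrow> ('d \<Rightarrow> 'x) \<times> 'y"
  assumes T_bounded: "bounded_op (X \<times> U) (prod_ip ipX ipU) (Xd \<times> Y) (prod_ip ipd ipY) T"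
    and T_nrm_le: "v \<in> X \<times> U \<Longrightarrow> XdY.nrm (T v) \<le> hnorm (prod_ip ipX ipU) v"
    and T_col: "x \<in> X \<Longrightarrow> T (x, 0) = col A C x"
    and T_T_adj: "p \<in> D_space X ipX Y ipY A C \<times> Y \<Longrightarrow>
      T (hadj (X \<times> U) (prod_ip ipX ipU) (Xd \<times> Y) (prod_ip ipd ipY) T p) = p"
    and ip_gen_T: "z \<in> ball_d \<Longrightarrow> y \<in> Y \<Longrightarrow> v \<in> X \<times> U \<Longrightarrow>
      prod_ip ipd ipY (gen z y, y) (T v) = prod_ip ipX ipU (state_kernel z y, S_adj z y) v"
begin

sublocale XU: hilbert_sum X ipX U ipU ..

sublocale T: bounded_operator "X \<times> U" "prod_ip ipX ipU" "Xd \<times> Y" "prod_ip ipd ipY" T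
  by unfold_locales (rule T_bounded)

definition B :: "'d \<Rightarrow> 'u \<Rightarrow> 'x" where
  "B j u = fst (T (0, u)) j"

definition D :: "'u \<Rightarrow> 'y" where
  "D u = snd (T (0, u))"

lemma T_eq_col_B_D: "T (0, u) = col B D u"
  by (simp add: col_def B_def[abs_def] D_def)

lemma col_B_D_mem: "u \<in> U \<Longrightarrow> col B D u \<in> Xd \<times> Y"
  using T.mem[of "(0, u)"] by (simp add: T_eq_col_B_D)

lemma col_B_D_nrm_le: "u \<in> U \<Longrightarrow> XdY.nrm (col B D u) \<le> U.nrm u"
  using T_nrm_le[of "(0, u)"] by (simp add: T_eq_col_B_D hnorm_def[of "prod_ip ipX ipU"]
    prod_ip_def)
    (simp add: hnorm_def)

lemma col_B_D_add: "u \<in> U \<Longrightarrow> v \<in> U \<Longrightarrow> col B D (u + v) = col B D u + col B D v"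
  using T.add[of "(0, u)" "(0, v)"] by (simp add: T_eq_col_B_D)

lemma col_B_D_scale: "u \<in> U \<Longrightarrow> col B D (c *\<^sub>C u) = c *\<^sub>C col B D u"
  using T.scale[of "(0, u)" c] by (simp add: T_eq_col_B_D[symmetric] scaleC_prod_def)

sublocale BD: operator_column U ipU X ipX Y ipY B D
proof
  show "bounded_op U ipU X ipX (B j)" for j
  proof (rule bounded_opI)
    show "X.nrm (B j u) \<le> 1 * U.nrm u" if u: "u \<in> U" for u
      using X.ltwo_coord_le[of "fst (col B D u)" j] XdY.hnorm_fst_le[OF col_B_D_mem[OF u]]
        col_B_D_nrm_le[OF u] col_B_D_mem[OF u] by (simp add: mem_Times_iff) (simp add: col_def)
    show "B j u \<in> X" if "u \<in> U" for u
      using col_B_D_mem[OF that] by (simp add: col_def X.ltwo_finite_index)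
  qed (use col_B_D_add col_B_D_scale in \<open>auto simp: col_def prod_eq_iff fun_eq_iff\<close>)
  show "bounded_op U ipU Y ipY D"
  proof (rule bounded_opI)
    show "Y.nrm (D u) \<le> 1 * U.nrm u" if u: "u \<in> U" for u
      using XdY.hnorm_snd_le[OF col_B_D_mem[OF u]] col_B_D_nrm_le[OF u] by (simp add: col_def)
    show "D u \<in> Y" if "u \<in> U" for u using col_B_D_mem[OF that] by (simp add: col_def)
  qed (use col_B_D_add col_B_D_scale in \<open>auto simp: col_def prod_eq_iff\<close>)
qed

sublocale conn: operator_row X ipX U ipU "Xd \<times> Y" "prod_ip ipd ipY" "col A C" "col B D" ..

lemma T_eq_row: "v \<in> X \<times> U \<Longrightarrow> T v = row (col A C) (col B D) v"
  using T.add[of "(fst v, 0)" "(0, snd v)"]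
  by (auto simp: row_def T_col T_eq_col_B_D)

lemma T_adj_eq: "p \<in> Xd \<times> Y \<Longrightarrow> T.adj p = (col.adj p, BD.col.adj p)"
  unfolding conn.row_adj[symmetric]
  by (rule T.adj_eqI) (auto simp: T_eq_row conn.row.ip_adj_right)

lemma T_adj_nrm:
  assumes p: "p \<in> D_space X ipX Y ipY A C \<times> Y"
  shows "XU.nrm (T.adj p) = XdY.nrm p"
proof -
  have "p \<in> Xd \<times> Y" using p D_space_subset by auto
  then have "prod_ip ipX ipU (T.adj p) (T.adj p) = prod_ip ipd ipY p p"
    by (simp add: T.ip_adj_right T_T_adj[OF p])
  then show ?thesis by (simp add: hnorm_def)
qed

lemma weakly_coisometric: "weakly_coisometric X ipX U ipU Y ipY A B C D"
  unfolding weakly_coisometric_def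
proof (intro conjI ballI)
  fix x u assume x: "x \<in> X" and u: "u \<in> U"
  have "(XdY.nrm (T (x, u)))\<^sup>2 \<le> (XU.nrm (x, u))\<^sup>2"
    using T_nrm_le[of "(x, u)"] x u by (intro power_mono) auto
  moreover have "T (x, u) = ((\<lambda>j. A j x + B j u), C x + D u)"
    using x u by (simp add: T_eq_row row_def col_def plus_fun_def)
  ultimately show "(\<Sum>j\<in>UNIV. (X.nrm (A j x + B j u))\<^sup>2) + (Y.nrm (C x + D u))\<^sup>2 \<le>
      (X.nrm x)\<^sup>2 + (U.nrm u)\<^sup>2"
    using x u by (simp add: XdY.hnorm_prod_ip_sq XU.hnorm_prod_ip_sq X.ltwo_finite_index
      X.ltwo_nrm_sq)
next
  fix w y assume w: "w \<in> D_space X ipX Y ipY A C" and y: "y \<in> Y"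
  have wX: "w \<in> Xd" using w D_space_subset by blast
  have "(XU.nrm (T.adj (w, y)))\<^sup>2 = (XdY.nrm (w, y))\<^sup>2" using T_adj_nrm w y by simp
  then show "(X.nrm ((\<Sum>j\<in>UNIV. A.adj j (w j)) + C.adj y))\<^sup>2 +
      (U.nrm ((\<Sum>j\<in>UNIV. BD.A.adj j (w j)) + BD.C.adj y))\<^sup>2 = (hnorm_d ipX w)\<^sup>2 + (Y.nrm y)\<^sup>2"
    using wX y by (simp add: T_adj_eq XU.hnorm_prod_ip_sq XdY.hnorm_prod_ip_sq X.hnorm_d_eq_ltwo
        col_adj[symmetric] BD.col_adj[symmetric])
qed

lemma realizes: "realizes X U A B C D S"
  unfolding realizes_def
proof (intro ballI)
  fix l :: "complex^'d" and u assume l: "l \<in> ball_d" and u: "u \<in> U"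
  define b where "b = (\<Sum>j\<in>UNIV. (l $ j) *\<^sub>C B j u)"
  have b: "b \<in> X" using u by (auto simp: b_def intro!: X.sum_mem)
  have "S l u = D u + C (resolvent l b)"
  proof (rule Y.eq_if_ip_left_eq)
    fix y assume y: "y \<in> Y"
    have "ipY y (C (resolvent l b)) = ipX (state_kernel l y) b"
      using ip_C_resolvent[OF l b y] Y.ip_sym[of "C (resolvent l b)" y]
        X.ip_sym[of b "state_kernel l y"]
        l b y by simp
    also have "\<dots> = ipd (gen l y) (\<lambda>j. B j u)"
      using l u y by (simp add: b_def X.ip_sum_right X.ip_scale_left X.ip_scale_right
          ltwo_ip_finite_index gen_eq)
    finally have "ipY y (D u + C (resolvent l b)) = prod_ip ipd ipY (gen l y, y) (T (0, u))"
      using l u y b by (simp add: Y.ip_add_right T_eq_col_B_D prod_ip_def col_def)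
    also have "\<dots> = ipU (S_adj l y) u"
      using ip_gen_T[OF l y, of "(0, u)"] l u y by (simp add: prod_ip_def)
    also have "\<dots> = ipY y (S l u)"
      using l u y by (simp add: bounded_operator.ip_adj_left[OF bounded_operator_S])
    finally show "ipY y (S l u) = ipY y (D u + C (resolvent l b))" ..
  qed (use l u b in auto)
  then show "S l u = D u + C (inv_I_minus X (\<lambda>x. \<Sum>j\<in>UNIV. (l $ j) *\<^sub>C A j x)
      (\<Sum>j\<in>UNIV. (l $ j) *\<^sub>C B j u))"
    by (simp add: b_def resolvent_def Z_def[abs_def])
qed

end

lemma (in complementary_pair) weakly_coisometric_realization:
  obtains B D where "\<And>j. bounded_op U ipU X ipX (B j)" "bounded_op U ipU Y ipY D"
    "weakly_coisometric X ipX U ipU Y ipY A B C D" "realizes X U A B C D S"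
proof -
  obtain T where "bounded_operator (X \<times> U) (prod_ip ipX ipU) (Xd \<times> Y) (prod_ip ipd ipY) T"
    "\<And>v. v \<in> X \<times> U \<Longrightarrow> XdY.nrm (T v) \<le> hnorm (prod_ip ipX ipU) v"
    "\<And>x. x \<in> X \<Longrightarrow> T (x, 0) = col A C x"
    "\<And>p. p \<in> D_space X ipX Y ipY A C \<times> Y \<Longrightarrow>
      T (hadj (X \<times> U) (prod_ip ipX ipU) (Xd \<times> Y) (prod_ip ipd ipY) T p) = p"
    "\<And>z y v. z \<in> ball_d \<Longrightarrow> y \<in> Y \<Longrightarrow> v \<in> X \<times> U \<Longrightarrow>
      prod_ip ipd ipY (gen z y, y) (T v) = prod_ip ipX ipU (state_kernel z y, S_adj z y) v"
    using lurking_colligation_exists by blast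
  then interpret lurking_colligation X ipX Y ipY A C U ipU S T
    by unfold_locales (auto simp: bounded_operator_def bounded_operator_axioms_def)
  show thesis
    using that[OF BD.A_bounded BD.C_bounded weakly_coisometric realizes] .
qed

section \<open>The functional model of an inner multiplier\<close>

lemma (in bounded_operator) ker_adj_eq_range_perp:
  "{y \<in> W. adj y = 0} = {y \<in> W. \<forall>z\<in>T ` V. ipW y z = 0}"
proof -
  have "adj y = 0 \<longleftrightarrow> (\<forall>x\<in>V. ipW y (T x) = 0)" if y: "y \<in> W" for y
  proof
    assume "\<forall>x\<in>V. ipW y (T x) = 0"
    then show "adj y = 0"
      using y by (intro V.eq_if_ip_right_eq) (auto simp: ip_adj_left)
  qed (use y in \<open>auto simp: ip_adj_left[symmetric]\<close>)
  then show ?thesis by auto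
qed

locale inner_multiplication = contractive_multiplier U ipU Y ipY S
  for U :: "'u::cvector set" and ipU and Y :: "'y::cvector set" and ipY
    and S :: "complex^'d::finite \<Rightarrow> 'u \<Rightarrow> 'y" +
  assumes partial_isometry: mult.partial_isometry
begin

definition ker_mult_adj :: "('d list \<Rightarrow> 'y) set" where
  "ker_mult_adj = {h \<in> Y.H. mult.adj h = 0}"

definition X :: "(complex^'d \<Rightarrow> 'y) set" where
  "X = Y.fock_fun ` ker_mult_adj"

definition ipX :: "(complex^'d \<Rightarrow> 'y) \<Rightarrow> (complex^'d \<Rightarrow> 'y) \<Rightarrow> complex" where
  "ipX f g = Y.ipH (Y.coeffs f) (Y.coeffs g)"

definition A :: "'d \<Rightarrow> (complex^'d \<Rightarrow> 'y) \<Rightarrow> complex^'d \<Rightarrow> 'y" where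
  "A j f = Y.fock_fun (shift j (Y.coeffs f))"

definition C :: "(complex^'d \<Rightarrow> 'y) \<Rightarrow> 'y" where
  "C f = Y.coeffs f []"

lemma ker_mult_adj_fock: "h \<in> ker_mult_adj \<Longrightarrow> h \<in> Y.H"
  by (simp add: ker_mult_adj_def)

lemma ip_ker_mult_adj_mult: "h \<in> ker_mult_adj \<Longrightarrow> g \<in> U.H \<Longrightarrow> Y.ipH h (mult g) = 0"
  using mult.ip_adj_left[of g h] by (simp add: ker_mult_adj_def)

lemma hilbert_space_ker_mult_adj: "hilbert_space ker_mult_adj Y.ipH"
  unfolding ker_mult_adj_def mult.ker_adj_eq_range_perp
  by (rule Y.H.hilbert_space_orthogonal_complement) auto

lemma csubspace_ker_mult_adj: "csubspace ker_mult_adj"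
  using hilbert_space_ker_mult_adj by (simp add: hilbert_space_iff)

lemma fock_fun_in_X [simp]: "h \<in> ker_mult_adj \<Longrightarrow> Y.fock_fun h \<in> X"
  by (simp add: X_def)

lemma coeffs_fock_fun_ker_mult_adj: "h \<in> ker_mult_adj \<Longrightarrow> Y.coeffs (Y.fock_fun h) = h"
  by (simp add: ker_mult_adj_fock Y.coeffs_fock_fun)

lemma coeffs_in_ker_mult_adj [simp]: "x \<in> X \<Longrightarrow> Y.coeffs x \<in> ker_mult_adj"
  and fock_fun_coeffs: "x \<in> X \<Longrightarrow> Y.fock_fun (Y.coeffs x) = x"
  by (auto simp: X_def coeffs_fock_fun_ker_mult_adj)

lemma coeffs_fock [simp]: "x \<in> X \<Longrightarrow> Y.coeffs x \<in> Y.H"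
  using coeffs_in_ker_mult_adj ker_mult_adj_fock by blast

lemma csubspace_X: "csubspace X"
  unfolding csubspace_def
proof (intro conjI ballI allI)
  show "0 \<in> X"
    using Y.fock_fun_scale[of 0 0] fock_fun_in_X[OF csubspace_0[OF csubspace_ker_mult_adj]] by simp
next
  fix x y c assume x: "x \<in> X" and y: "y \<in> X"
  have "x + y = Y.fock_fun (Y.coeffs x + Y.coeffs y)"
    using x y by (simp add: Y.fock_fun_add fock_fun_coeffs)
  then show "x + y \<in> X"
    using x y fock_fun_in_X[OF csubspace_add[OF csubspace_ker_mult_adj]] by simp
  have "c *\<^sub>C x = Y.fock_fun (c *\<^sub>C Y.coeffs x)"
    using x by (simp add: Y.fock_fun_scale fock_fun_coeffs)
  then show "c *\<^sub>C x \<in> X"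
    using x fock_fun_in_X[OF csubspace_scaleC[OF csubspace_ker_mult_adj]] by simp
qed

lemma coeffs_add: "x \<in> X \<Longrightarrow> y \<in> X \<Longrightarrow> Y.coeffs (x + y) = Y.coeffs x + Y.coeffs y"
  using Y.coeffs_fock_fun[of "Y.coeffs x + Y.coeffs y"]
  by (simp add: Y.fock_fun_add fock_fun_coeffs)

lemma coeffs_scale: "x \<in> X \<Longrightarrow> Y.coeffs (c *\<^sub>C x) = c *\<^sub>C Y.coeffs x"
  using Y.coeffs_fock_fun[of "c *\<^sub>C Y.coeffs x"]
  by (simp add: Y.fock_fun_scale fock_fun_coeffs)

sublocale X: hilbert X ipX
proof
  have "bij_betw Y.coeffs X ker_mult_adj"
    by (rule bij_betw_byWitness[where f' = Y.fock_fun])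
      (auto simp: coeffs_fock_fun_ker_mult_adj fock_fun_coeffs)
  then show "hilbert_space X ipX"
    unfolding ipX_def[abs_def]
    by (intro hilbert_space_pullback[OF hilbert_space_ker_mult_adj csubspace_X] coeffs_add
      coeffs_scale)
qed

lemma X_nrm: "X.nrm x = Y.H.nrm (Y.coeffs x)"
  by (simp add: hnorm_def ipX_def)

lemma shift_in_ker_mult_adj [simp]:
  assumes h: "h \<in> ker_mult_adj"
  shows "shift j h \<in> ker_mult_adj"
proof -
  have hH: "h \<in> Y.H" using h by (rule ker_mult_adj_fock)
  have "mult.adj (shift j h) = 0"
  proof (rule U.H.eq_if_ip_right_eq)
    fix g assume g: "g \<in> U.H"
    have "U.ipH (mult.adj (shift j h)) g = Y.ipH h (Y.shift.A.adj j (mult g))"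
      using g hH by (simp add: mult.ip_adj_left Y.shift.A.ip_adj_right)
    also have "\<dots> = 0" using g h by (simp add: mult_shift_adj ip_ker_mult_adj_mult)
    finally show "U.ipH (mult.adj (shift j h)) g = U.ipH 0 g" using g by simp
  qed (use hH in auto)
  then show ?thesis using hH by (simp add: ker_mult_adj_def)
qed

lemma A_mem: "x \<in> X \<Longrightarrow> A j x \<in> X"
  by (simp add: A_def)

lemma coeffs_A: "x \<in> X \<Longrightarrow> Y.coeffs (A j x) = shift j (Y.coeffs x)"
  by (simp add: A_def coeffs_fock_fun_ker_mult_adj)

lemma C_fold_A: "x \<in> X \<Longrightarrow> C (fold A w x) = Y.coeffs x w"
  by (induction w arbitrary: x) (auto simp: C_def coeffs_A A_mem shift_def)

lemma sum_A_nrm_sq: "x \<in> X \<Longrightarrow> (\<Sum>j\<in>UNIV. (X.nrm (A j x))\<^sup>2) + (Y.nrm (C x))\<^sup>2 = (X.nrm x)\<^sup>2"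
  using Y.sum_shift_nrm_sq[of "Y.coeffs x"] by (simp add: X_nrm coeffs_A C_def)

lemma commutative_A: "commutative_tuple X A"
  unfolding commutative_tuple_def
proof (intro allI ballI)
  fix i j x assume x: "x \<in> X"
  have "shift i (shift j (Y.coeffs x)) = shift j (shift i (Y.coeffs x))"
    using symmetric_swap[OF Y.fock_symmetric[of "Y.coeffs x"]] x by (simp add: shift_def)
  then show "A i (A j x) = A j (A i x)"
    using x by (simp add: A_def[of i "A j x"] A_def[of j "A i x"] coeffs_A)
qed

sublocale pair: isometric_pair X ipX Y ipY A C
proof
  show "bounded_op X ipX X ipX (A j)" for j
  proof (rule bounded_opI)
    show "X.nrm (A j x) \<le> 1 * X.nrm x" if "x \<in> X" for x
      using that Y.shift.entry_nrm_le[of "Y.coeffs x" j] by (simp add: X_nrm coeffs_A)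
  qed (auto simp: A_mem A_def coeffs_add coeffs_scale Y.shift.A.add Y.shift.A.scale Y.fock_fun_add
      Y.fock_fun_scale)
  show "bounded_op X ipX Y ipY C"
  proof (rule bounded_opI)
    show "Y.nrm (C x) \<le> 1 * X.nrm x" if "x \<in> X" for x
      using Y.ltwo_coord_le[OF Y.fock_ltwo[OF coeffs_fock[OF that]]] by (simp add: X_nrm C_def)
  qed (auto simp: C_def coeffs_add coeffs_scale)
qed (rule sum_A_nrm_sq)

sublocale pair: stable_pair X ipX Y ipY A C
proof
  fix x assume x: "x \<in> X"
  have "(\<lambda>N. (X.nrm x)\<^sup>2 - (\<Sum>w | length w < N. (Y.nrm (Y.coeffs x w))\<^sup>2)) \<longlonglongrightarrow>
      (X.nrm x)\<^sup>2 - (Y.H.nrm (Y.coeffs x))\<^sup>2"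
    using x by (intro tendsto_intros Y.fock_nrm_sq_limit) simp
  moreover have "(X.nrm x)\<^sup>2 - (\<Sum>w | length w < N. (Y.nrm (Y.coeffs x w))\<^sup>2) =
      (\<Sum>w | length w = N. (X.nrm (fold A w x))\<^sup>2)" for N
    using pair.energy_balance[OF x, of N] x by (simp add: C_fold_A)
  ultimately show "(\<lambda>N. \<Sum>w | length w = N. (X.nrm (fold A w x))\<^sup>2) \<longlonglongrightarrow> 0" by (simp add: X_nrm)
qed (rule commutative_A)

lemma obs_eq_coeffs: "x \<in> X \<Longrightarrow> pair.obs x = Y.coeffs x"
  by (simp add: pair.obs_def C_fold_A)

lemma obs_adj_eq:
  assumes h: "h \<in> Y.H"
  shows "pair.obs.adj h = Y.fock_fun (h - mult (mult.adj h))"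
proof (rule pair.obs.adj_eqI[OF h])
  have adj: "mult.adj (mult (mult.adj h)) = mult.adj h"
    using partial_isometry mult.partial_isometry_iff mult_nrm_le h by blast
  have defect: "h - mult (mult.adj h) \<in> ker_mult_adj"
    using h bounded_operator.diff[OF mult.bounded_operator_adj, of h "mult (mult.adj h)"]
    by (simp add: ker_mult_adj_def adj)
  then show "Y.fock_fun (h - mult (mult.adj h)) \<in> X" by simp
  show "Y.ipH (pair.obs x) h = ipX x (Y.fock_fun (h - mult (mult.adj h)))" if x: "x \<in> X" for x
    using x h ip_ker_mult_adj_mult[OF coeffs_in_ker_mult_adj[OF x]]
    by (simp add: obs_eq_coeffs ipX_def coeffs_fock_fun_ker_mult_adj[OF defect]
      Y.H.ip_diff_right)
qed

sublocale pair: complementary_pair X ipX Y ipY A C U ipU S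
proof
  fix h assume h: "h \<in> Y.H"
  then have "pair.obs.adj h \<in> X" by simp
  then have "pair.obs (pair.obs.adj h) = h - mult (mult.adj h)"
    using h by (simp add: obs_eq_coeffs) (simp add: obs_adj_eq Y.coeffs_fock_fun)
  then show "mult (mult.adj h) + pair.obs (pair.obs.adj h) = h" by simp
qed

end

section \<open>Inner multipliers and weakly coisometric realizations\<close>

lemma operator_columnI:
  assumes "hilbert_space V ipV" "hilbert_space X ipX" "hilbert_space Y ipY"
    and "\<And>j. bounded_op V ipV X ipX (A j)" "bounded_op V ipV Y ipY C"
  shows "operator_column V ipV X ipX Y ipY A C"
  using assms by unfold_locales

lemma good_realization_imp_inner_multiplier:
  fixes S :: "complex^'d::{finite,enum} \<Rightarrow> 'u::cvector \<Rightarrow> 'y::cvector" and X :: "'x::cvector set"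
  assumes U: "hilbert_space U ipU" and Y: "hilbert_space Y ipY"
    and S: "\<forall>l\<in>ball_d. bounded_op U ipU Y ipY (S l)"
    and real: "good_realization X ipX U ipU Y ipY A B C D S"
  shows "inner_multiplier U ipU Y ipY S"
proof -
  have X: "hilbert_space X ipX" and A: "\<And>j. bounded_op X ipX X ipX (A j)"
    and B: "\<And>j. bounded_op U ipU X ipX (B j)" and C: "bounded_op X ipX Y ipY C"
    and D: "bounded_op U ipU Y ipY D"
    and coisometric: "weakly_coisometric X ipX U ipU Y ipY A B C D"
    and realizes: "realizes X U A B C D S" and commutative: "commutative_tuple X A"
    and stable: "strongly_stable X ipX A" and isometric: "isometric_output_pair X ipX Y ipY A C"
    using real unfolding good_realization_def by blast+
  have column: "operator_column X ipX X ipX Y ipY A C" by (intro operator_columnI X Y A C)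
  interpret isometric_pair X ipX Y ipY A C
    using column isometric[unfolded isometric_output_pair_iff[OF column]]
    by (intro isometric_pair.intro drury_arveson.intro hilbert.intro Y)
      (auto simp: isometric_pair_axioms_def)
  interpret weak_realization X ipX Y ipY A C U ipU S B D
    by unfold_locales
      (use U S B D coisometric realizes commutative stable
        strongly_stable_iff[OF A.mem commutative] in auto)
  show ?thesis by (rule inner_multiplier)
qed

lemma inner_multiplier_imp_good_realization:
  fixes S :: "complex^'d::{finite,enum} \<Rightarrow> 'u::cvector \<Rightarrow> 'y::cvector"
  assumes U: "hilbert_space U ipU" and Y: "hilbert_space Y ipY"
    and S: "\<forall>l\<in>ball_d. bounded_op U ipU Y ipY (S l)"
    and inner: "inner_multiplier U ipU Y ipY S"
  shows "\<exists>(X :: (complex^'d::_ \<Rightarrow> 'y) set) ipX A B C D. good_realization X ipX U ipU Y ipY A B C D S"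
proof -
  interpret contractive_multiplier U ipU Y ipY S
    by unfold_locales (use U Y S inner in \<open>auto simp: inner_multiplier_def schur_class_def\<close>)
  interpret inner_multiplication U ipU Y ipY S
    by unfold_locales (use inner inner_multiplier_iff_partial_isometry in blast)
  obtain B D where "\<And>j. bounded_op U ipU X ipX (B j)" "bounded_op U ipU Y ipY D"
    "weakly_coisometric X ipX U ipU Y ipY A B C D" "realizes X U A B C D S"
    using pair.weakly_coisometric_realization by blast
  moreover have "strongly_stable X ipX A"
    using strongly_stable_iff[OF A_mem commutative_A] pair.stable by blast
  moreover have "isometric_output_pair X ipX Y ipY A C"
    using isometric_output_pair_iff[OF pair.operator_column_axioms] pair.isometric by blast
  ultimately have "good_realization X ipX U ipU Y ipY A B C D S"
    unfolding good_realization_def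
    using X.hilbert_space pair.A_bounded pair.C_bounded commutative_A by blast
  then show ?thesis by blast
qed

theorem theorem4p3:
  fixes U :: "'u::cvector set" and ipU :: "'u \<Rightarrow> 'u \<Rightarrow> complex"
    and Y :: "'y::cvector set" and ipY :: "'y \<Rightarrow> 'y \<Rightarrow> complex"
    and S :: "complex^'d::{finite,enum} \<Rightarrow> 'u \<Rightarrow> 'y"
  assumes "hilbert_space U ipU" and "hilbert_space Y ipY"
    and "\<forall>l\<in>ball_d. bounded_op U ipU Y ipY (S l)"
  shows "(inner_multiplier U ipU Y ipY S \<longrightarrow>
            (\<exists>(X :: (complex^'d::_ \<Rightarrow> 'y) set) ipX A B C D.
               good_realization X ipX U ipU Y ipY A B C D S))
       \<and> (\<forall>(X :: 'x::cvector set) ipX A B C D.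
            good_realization X ipX U ipU Y ipY A B C D S \<longrightarrow> inner_multiplier U ipU Y ipY S)"
  using inner_multiplier_imp_good_realization[OF assms]
    good_realization_imp_inner_multiplier[OF assms] by blast

end
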